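(* Let $2\le p<\infty$. For a discrete Banach lattice $E$, the following are equivalent: (a) $E$ has the strong $p$-GP property. (b) $E$ has the weak $p$-GP property. (c) $E$ has the $p$-GP property.
   Context: A Banach lattice is discrete if for every $x>0$ there is an atom $a$ (an element $a>0$ such that $0\le y\le a$ implies $y=\lambda a$ for some scalar $\lambda$) with $0<a\le x$. A sequence $(x_n^* )_n\subset E^*$ is weak* $p$-summable if $(x_n^*(x))_n\in\ell_p$ for every $x\in E$. A subset $A$ of $E$ is $p$-limited (resp. almost $p$-limited) if for every (resp. every pairwise disjoint) weak* $p$-summable sequence $(x_n^* )_n\subset E^*$ there is $(a_n)_n\in\ell_p$ with $|x_n^*(x)|\le a_n$ for all $x\in A$ and $n\in\mathbb{N}$. A bounded set $A\subset E$ is relatively $p$-compact if there is a norm $p$-summable sequence $(x_n)_n$ in $E$ such that $A\subseteq\{\sum_{j=1}^\infty\lambda_jx_j:(\lambda_j)_j\in B_{\ell_{p^*}}\}$, where $1/p+1/p^*=1$ and $B_{\ell_{p^*}}$ is the closed unit ball of $\ell_{p^*}$. $E$ has the $p$-GP property if every $p$-limited subset is relatively $p$-compact; the weak $p$-GP property if every $p$-limited subset is relatively compact; the strong $p$-GP property if every almost $p$-limited subset is relatively compact. *)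

theory Defs
  imports "HOL-Analysis.Analysis" "HOL-Library.Lattice_Algebras"
begin

class banach_lattice = banach + ordered_real_vector + lattice_ab_group_add_abs +
  assumes norm_abs_mono: "\<bar>x\<bar> \<le> \<bar>y\<bar> \<Longrightarrow> norm x \<le> norm y"

text \<open>Sanity check that the class is inhabited.\<close>

instance real :: banach_lattice
  by standard (auto simp: sup_real_def)

definition atom :: "'a::banach_lattice \<Rightarrow> bool" where
  "atom a \<longleftrightarrow> 0 < a \<and> (\<forall>y. 0 \<le> y \<and> y \<le> a \<longrightarrow> (\<exists>c::real. y = c *\<^sub>R a))"

definition discrete_banach_lattice :: "'a::banach_lattice itself \<Rightarrow> bool" where
  "discrete_banach_lattice _ \<longleftrightarrow> (\<forall>x::'a. 0 < x \<longrightarrow> (\<exists>a. atom a \<and> a \<le> x))"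

text \<open>
  The order on the dual is the one induced by the positive cone of the space. It is a lattice
  order, but instead of choosing the lattice operations, suprema and infima are expressed
  as least upper and greatest lower bounds among all bounded linear functionals.
\<close>

definition dual_le :: "('a::banach_lattice \<Rightarrow>\<^sub>L real) \<Rightarrow> ('a \<Rightarrow>\<^sub>L real) \<Rightarrow> bool" where
  "dual_le f g \<longleftrightarrow> (\<forall>x\<ge>0. blinfun_apply f x \<le> blinfun_apply g x)"

definition is_dual_sup ::
    "('a::banach_lattice \<Rightarrow>\<^sub>L real) \<Rightarrow> ('a \<Rightarrow>\<^sub>L real) \<Rightarrow> ('a \<Rightarrow>\<^sub>L real) \<Rightarrow> bool" where
  "is_dual_sup f g h \<longleftrightarrow>
     dual_le f h \<and> dual_le g h \<and> (\<forall>u. dual_le f u \<and> dual_le g u \<longrightarrow> dual_le h u)"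

definition is_dual_inf ::
    "('a::banach_lattice \<Rightarrow>\<^sub>L real) \<Rightarrow> ('a \<Rightarrow>\<^sub>L real) \<Rightarrow> ('a \<Rightarrow>\<^sub>L real) \<Rightarrow> bool" where
  "is_dual_inf f g h \<longleftrightarrow>
     dual_le h f \<and> dual_le h g \<and> (\<forall>u. dual_le u f \<and> dual_le u g \<longrightarrow> dual_le u h)"

text \<open>Disjointness: the moduli \<open>u\<close> of \<open>f\<close> and \<open>v\<close> of \<open>g\<close> have infimum \<open>0\<close>.\<close>

definition dual_disjoint :: "('a::banach_lattice \<Rightarrow>\<^sub>L real) \<Rightarrow> ('a \<Rightarrow>\<^sub>L real) \<Rightarrow> bool" where
  "dual_disjoint f g \<longleftrightarrow>
     (\<exists>u v. is_dual_sup f (- f) u \<and> is_dual_sup g (- g) v \<and> is_dual_inf u v 0)"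

definition lp_seq :: "real \<Rightarrow> (nat \<Rightarrow> real) \<Rightarrow> bool" where
  "lp_seq p a \<longleftrightarrow> summable (\<lambda>n. \<bar>a n\<bar> powr p)"

definition weak_star_p_summable :: "real \<Rightarrow> (nat \<Rightarrow> 'a::real_normed_vector \<Rightarrow>\<^sub>L real) \<Rightarrow> bool" where
  "weak_star_p_summable p f \<longleftrightarrow> (\<forall>x. lp_seq p (\<lambda>n. blinfun_apply (f n) x))"

definition p_limited :: "real \<Rightarrow> 'a::real_normed_vector set \<Rightarrow> bool" where
  "p_limited p A \<longleftrightarrow>
     (\<forall>f :: nat \<Rightarrow> 'a \<Rightarrow>\<^sub>L real. weak_star_p_summable p f \<longrightarrow>
        (\<exists>a. lp_seq p a \<and> (\<forall>x\<in>A. \<forall>n. \<bar>blinfun_apply (f n) x\<bar> \<le> a n)))"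

definition almost_p_limited :: "real \<Rightarrow> 'a::banach_lattice set \<Rightarrow> bool" where
  "almost_p_limited p A \<longleftrightarrow>
     (\<forall>f :: nat \<Rightarrow> 'a \<Rightarrow>\<^sub>L real.
        weak_star_p_summable p f \<and> (\<forall>m n. m \<noteq> n \<longrightarrow> dual_disjoint (f m) (f n)) \<longrightarrow>
        (\<exists>a. lp_seq p a \<and> (\<forall>x\<in>A. \<forall>n. \<bar>blinfun_apply (f n) x\<bar> \<le> a n)))"

text \<open>For \<open>p > 1\<close>, the unique solution \<open>q\<close> of \<open>1 / p + 1 / q = 1\<close>.\<close>

definition conj_exponent :: "real \<Rightarrow> real" where
  "conj_exponent p = 1 / (1 - 1 / p)"

text \<open>The condition \<open>\<Sum> \<bar>c j\<bar> powr q \<le> 1\<close> says that the \<open>\<ell>\<^sub>q\<close> norm of \<open>c\<close> is at most \<open>1\<close>.\<close>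

definition lq_unit_ball :: "real \<Rightarrow> (nat \<Rightarrow> real) set" where
  "lq_unit_ball q = {c. lp_seq q c \<and> (\<Sum>j. \<bar>c j\<bar> powr q) \<le> 1}"

definition relatively_p_compact :: "real \<Rightarrow> 'a::banach set \<Rightarrow> bool" where
  "relatively_p_compact p A \<longleftrightarrow> bounded A \<and>
     (\<exists>x :: nat \<Rightarrow> 'a. summable (\<lambda>n. norm (x n) powr p) \<and>
        A \<subseteq> {y. \<exists>c \<in> lq_unit_ball (conj_exponent p). (\<lambda>j. c j *\<^sub>R x j) sums y})"

definition GP_property :: "real \<Rightarrow> 'a::banach itself \<Rightarrow> bool" where
  "GP_property p _ \<longleftrightarrow> (\<forall>A :: 'a set. p_limited p A \<longrightarrow> relatively_p_compact p A)"

definition weak_GP_property :: "real \<Rightarrow> 'a::banach itself \<Rightarrow> bool" where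
  "weak_GP_property p _ \<longleftrightarrow> (\<forall>A :: 'a set. p_limited p A \<longrightarrow> compact (closure A))"

definition strong_GP_property :: "real \<Rightarrow> 'a::banach_lattice itself \<Rightarrow> bool" where
  "strong_GP_property p _ \<longleftrightarrow> (\<forall>A :: 'a set. almost_p_limited p A \<longrightarrow> compact (closure A))"

end

theory Submission imports Defs begin

text \<open>
  The three properties are linked through a property of the lattice alone, \<open>KB_property\<close>: a positive series with bounded
  partial sums has terms that tend to zero.

  The weak GP property implies it. If \<open>d n \<ge> 0\<close> and the partial sums are bounded, then \<open>range d\<close> is \<open>p\<close>-limited:
  given a weak* \<open>p\<close>-summable sequence \<open>f\<close>, the sums \<open>\<Sum>k. \<bar>f k (\<Sum>n. \<plusminus> d n)\<bar> powr p\<close> are bounded uniformly in the signs,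
  and averaging over the signs bounds \<open>\<Sum>k. sup\<^sub>n \<bar>f k (d n)\<bar> powr p\<close> (\<open>positive_series_range_p_limited\<close>). Hence \<open>range d\<close>
  is relatively compact, and a nonzero limit point would make the partial sums unbounded.

  Conversely, a discrete lattice with \<open>KB_property\<close> behaves like a sequence space that is a dual space. Every \<open>x\<close> is the
  unconditional sum of its coordinates along the normalised atoms (\<open>KB_expansion\<close>), and the unit ball is
  sequentially compact for convergence of countably many coordinates (\<open>KB_ball_coordinate_compact\<close>). Consider disjoint finite
  blocks of atoms and on the \<open>i\<close>-th block a finite family of functionals whose \<open>p\<close>-th power sum \<open>w i\<close> is at most \<open>1\<close> on the unit ball.
  Then \<open>w i\<close> tends to \<open>0\<close> pointwise, hence by compactness some convex combinations tend to \<open>0\<close> uniformly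
  (\<open>pointwise_null_imp_small_convex\<close>), and there are weights \<open>\<alpha> i\<close> with divergent sum such that \<open>\<Sum>i. \<alpha> i * w i x\<close> is finite for
  every \<open>x\<close> (\<open>KB_block_weights\<close>). The functionals of block \<open>i\<close>, multiplied by \<open>\<alpha> i powr (1 / p)\<close>, thus form a weak* \<open>p\<close>-summable
  sequence. If the \<open>p\<close>-th powers of the suprema over \<open>A\<close> of the original functionals add up to at least a fixed \<open>\<delta> > 0\<close> on each
  block, then no \<open>\<ell>\<^sub>p\<close> sequence dominates this weak* \<open>p\<close>-summable sequence on \<open>A\<close>.

  With one functional per block the sequence is disjoint, so almost \<open>p\<close>-limited sets have uniformly small tails
  and are relatively compact: this is the strong GP property. With arbitrary finite families it follows that the tails of a
  \<open>p\<close>-limited set have small \<open>p\<close>-summing constants (\<open>p_limited_tail\<close>). Such a set is cut into blocks whose constants decrease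
  geometrically. On each block a finite form of Pietsch's domination theorem (\<open>pietsch_domination_block\<close>), derived from a minimax
  theorem, followed by Hahn-Banach (\<open>dominated_imp_combination\<close>) represents the block by combinations of vectors with small
  \<open>p\<close>-th power sum, and adding up the blocks gives the GP property.

  The remaining implications hold in general: \<open>p\<close>-limited sets are almost \<open>p\<close>-limited, and relatively \<open>p\<close>-compact sets are
  relatively compact.
\<close>

section \<open>Coordinates with respect to atoms\<close>

lemma norm_abs_lattice [simp]: "norm \<bar>x\<bar> = norm x" for x :: "'a::banach_lattice"
  by (rule antisym; rule norm_abs_mono) simp_all

lemma norm_mono_pos: "0 \<le> x \<Longrightarrow> x \<le> y \<Longrightarrow> norm x \<le> norm y" for x :: "'a::banach_lattice"
  by (rule norm_abs_mono) simp

lemma scaleR_inf: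
  fixes x y :: "'a::banach_lattice"
  assumes "0 < c"
  shows "c *\<^sub>R inf x y = inf (c *\<^sub>R x) (c *\<^sub>R y)"
proof (rule antisym)
  show "c *\<^sub>R inf x y \<le> inf (c *\<^sub>R x) (c *\<^sub>R y)"
    using assms by (intro inf_greatest scaleR_left_mono) auto
  have "(1/c) *\<^sub>R inf (c *\<^sub>R x) (c *\<^sub>R y) \<le> (1/c) *\<^sub>R (c *\<^sub>R x)"
    using assms by (intro scaleR_left_mono) auto
  moreover have "(1/c) *\<^sub>R inf (c *\<^sub>R x) (c *\<^sub>R y) \<le> (1/c) *\<^sub>R (c *\<^sub>R y)"
    using assms by (intro scaleR_left_mono) auto
  ultimately have "(1/c) *\<^sub>R inf (c *\<^sub>R x) (c *\<^sub>R y) \<le> inf x y"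
    using assms by simp
  then have "c *\<^sub>R ((1/c) *\<^sub>R inf (c *\<^sub>R x) (c *\<^sub>R y)) \<le> c *\<^sub>R inf x y"
    using assms by (intro scaleR_left_mono) auto
  then show "inf (c *\<^sub>R x) (c *\<^sub>R y) \<le> c *\<^sub>R inf x y" using assms by simp
qed

lemma abs_scaleR_lattice: "\<bar>c *\<^sub>R x\<bar> = \<bar>c\<bar> *\<^sub>R \<bar>x\<bar>" for x :: "'a::banach_lattice"
proof -
  have pos: "\<bar>c *\<^sub>R x\<bar> = c *\<^sub>R \<bar>x\<bar>" if "0 < c" for c :: real and x :: 'a
  proof (rule antisym)
    have "c *\<^sub>R x \<le> c *\<^sub>R \<bar>x\<bar>" "c *\<^sub>R (- x) \<le> c *\<^sub>R \<bar>x\<bar>"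
      using that abs_ge_self[of x] abs_ge_minus_self[of x] by (auto intro!: scaleR_left_mono simp del: scaleR_minus_right)
    then show "\<bar>c *\<^sub>R x\<bar> \<le> c *\<^sub>R \<bar>x\<bar>" by (intro abs_leI) auto
    have "(1/c) *\<^sub>R (c *\<^sub>R x) \<le> (1/c) *\<^sub>R \<bar>c *\<^sub>R x\<bar>" "(1/c) *\<^sub>R (- (c *\<^sub>R x)) \<le> (1/c) *\<^sub>R \<bar>c *\<^sub>R x\<bar>"
      using that abs_ge_self[of "c *\<^sub>R x"] abs_ge_minus_self[of "c *\<^sub>R x"]
      by (intro scaleR_left_mono; simp del: scaleR_minus_right)+
    then have "\<bar>x\<bar> \<le> (1/c) *\<^sub>R \<bar>c *\<^sub>R x\<bar>" using that by (intro abs_leI) auto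
    then have "c *\<^sub>R \<bar>x\<bar> \<le> c *\<^sub>R ((1/c) *\<^sub>R \<bar>c *\<^sub>R x\<bar>)"
      using that by (intro scaleR_left_mono) auto
    then show "c *\<^sub>R \<bar>x\<bar> \<le> \<bar>c *\<^sub>R x\<bar>" using that by simp
  qed
  consider "c = 0" | "0 < c" | "0 < - c" by linarith
  then show ?thesis
  proof cases
    case 3
    have "\<bar>c *\<^sub>R x\<bar> = \<bar>(- c) *\<^sub>R x\<bar>" by simp
    then show ?thesis using pos[OF 3, of x] 3 by simp
  qed (use pos in auto)
qed

lemma inf_add_le:
  fixes x y a :: "'a::banach_lattice"
  assumes "0 \<le> x" "0 \<le> y" "0 \<le> a"
  shows "inf (x + y) a \<le> inf x a + inf y a"
proof -
  have "inf (x + y) a - y \<le> x" by (simp add: diff_le_eq)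
  moreover have "inf (x + y) a - y \<le> a"
    using assms by (simp add: diff_le_eq add_increasing2 le_infI2)
  ultimately have "inf (x + y) a - y \<le> inf x a" by (rule le_infI)
  then have "inf (x + y) a - inf x a \<le> y" by (metis add.commute diff_le_eq)
  moreover have "inf (x + y) a - inf x a \<le> a"
  proof -
    have "0 \<le> inf x a" using assms by simp
    then have "inf (x + y) a - inf x a \<le> inf (x + y) a" using diff_left_mono[of 0 "inf x a" "inf (x + y) a"] by (simp only: diff_zero)
    then show ?thesis by (meson inf_le2 order_trans)
  qed
  ultimately have "inf (x + y) a - inf x a \<le> inf y a" by (rule le_infI)
  then show ?thesis by (metis add.commute diff_le_eq)
qed

definition perp :: "'a::banach_lattice \<Rightarrow> 'a set" where
  "perp a = {z. inf \<bar>z\<bar> a = 0}"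

lemma perp_mono:
  fixes z w a :: "'a::banach_lattice"
  assumes "0 \<le> a" "z \<in> perp a" "\<bar>w\<bar> \<le> \<bar>z\<bar>"
  shows "w \<in> perp a"
  using assms inf_mono[OF assms(3) order_refl[of a]] unfolding perp_def
  by (auto intro: antisym)

lemma perp_add:
  fixes z w a :: "'a::banach_lattice"
  assumes "0 \<le> a" "z \<in> perp a" "w \<in> perp a"
  shows "z + w \<in> perp a"
proof -
  have "inf \<bar>z + w\<bar> a \<le> inf (\<bar>z\<bar> + \<bar>w\<bar>) a" by (intro inf_mono abs_triangle_ineq) simp
  also have "\<dots> \<le> inf \<bar>z\<bar> a + inf \<bar>w\<bar> a" using assms by (intro inf_add_le) auto
  also have "\<dots> = 0" using assms by (simp add: perp_def)
  finally show ?thesis using assms by (auto simp: perp_def intro: antisym)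
qed

lemma perp_scaleR:
  fixes z a :: "'a::banach_lattice"
  assumes "0 \<le> a" "z \<in> perp a"
  shows "c *\<^sub>R z \<in> perp a"
proof -
  define n where "n = \<bar>c\<bar> + 1"
  have n: "1 \<le> n" "\<bar>c\<bar> \<le> n" by (auto simp: n_def)
  have "inf \<bar>c *\<^sub>R z\<bar> a \<le> inf (n *\<^sub>R \<bar>z\<bar>) (n *\<^sub>R a)"
  proof (rule inf_mono)
    show "\<bar>c *\<^sub>R z\<bar> \<le> n *\<^sub>R \<bar>z\<bar>" using n by (auto simp: abs_scaleR_lattice intro: scaleR_right_mono)
    show "a \<le> n *\<^sub>R a" using scaleR_right_mono[OF n(1) assms(1)] by simp
  qed
  also have "\<dots> = n *\<^sub>R inf \<bar>z\<bar> a" using n by (subst scaleR_inf) auto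
  also have "\<dots> = 0" using assms by (simp add: perp_def)
  finally show ?thesis using assms by (auto simp: perp_def intro: antisym)
qed

lemma perp_self:
  fixes a :: "'a::banach_lattice"
  assumes "0 < a" "c *\<^sub>R a \<in> perp a"
  shows "c = 0"
proof (rule ccontr)
  assume "c \<noteq> 0"
  define s where "s = min \<bar>c\<bar> 1"
  have s: "0 < s" "s \<le> \<bar>c\<bar>" "s \<le> 1" using \<open>c \<noteq> 0\<close> by (auto simp: s_def)
  have "s *\<^sub>R a \<le> inf \<bar>c *\<^sub>R a\<bar> a"
    using s assms(1) scaleR_right_mono[of s 1 a] scaleR_right_mono[of s "\<bar>c\<bar>" a]
    by (auto simp: abs_scaleR_lattice)
  then have "s *\<^sub>R a \<le> 0" using assms unfolding perp_def by (metis mem_Collect_eq)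
  moreover have "0 < s *\<^sub>R a" using s assms(1) by (auto simp: order_less_le intro!: scaleR_nonneg_nonneg)
  ultimately show False by simp
qed

text \<open>
  The infimum of \<open>x\<close> with a large multiple \<open>n a\<close> lies below \<open>n a\<close>, hence is a multiple \<open>c a\<close> of the
  atom, and \<open>c\<close> cannot exceed \<open>norm x / norm a\<close>. Once \<open>n\<close> exceeds this bound by \<open>1\<close>, the cutoff \<open>n a\<close>
  no longer matters and what is left of \<open>x\<close> is disjoint from \<open>a\<close>. So every atom spans a projection band.
\<close>

lemma atom_split_pos:
  fixes a x :: "'a::banach_lattice"
  assumes "atom a" "0 \<le> x"
  shows "\<exists>c\<ge>0. x - c *\<^sub>R a \<in> perp a"
proof -
  have a: "0 < a" using assms by (simp add: atom_def)
  then have na: "norm a > 0" by auto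
  define n where "n = norm x / norm a + 1"
  have n: "1 \<le> n" using na by (simp add: n_def)
  define y where "y = inf x (n *\<^sub>R a)"
  have y: "0 \<le> y" "y \<le> x" "y \<le> n *\<^sub>R a"
    using a n assms by (auto simp: y_def intro!: scaleR_nonneg_nonneg)
  have "0 \<le> (1/n) *\<^sub>R y" using y n by (intro scaleR_nonneg_nonneg) auto
  moreover have "(1/n) *\<^sub>R y \<le> a"
    using scaleR_left_mono[OF y(3), of "1/n"] n by simp
  ultimately obtain c' where c': "(1/n) *\<^sub>R y = c' *\<^sub>R a" using assms(1) unfolding atom_def by blast
  define c where "c = n * c'"
  have yc: "y = c *\<^sub>R a"
    using arg_cong[OF c', of "scaleR n"] n by (simp add: c_def)
  have c0: "0 \<le> c"
  proof (rule ccontr)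
    assume "\<not> 0 \<le> c"
    then have "0 \<le> (-c) *\<^sub>R a" using a by (intro scaleR_nonneg_nonneg) auto
    with y(1) have "c *\<^sub>R a = 0" unfolding yc by (intro antisym) auto
    with \<open>\<not> 0 \<le> c\<close> a show False by auto
  qed
  have "c * norm a \<le> norm x"
    using norm_mono_pos[OF y(1,2)] c0 by (simp add: yc)
  then have cn: "c + 1 \<le> n" using na by (simp add: n_def field_simps)
  have "inf (x - y) (n *\<^sub>R a - y) = inf x (n *\<^sub>R a) - y"
    using add_inf_distrib_right[of x "n *\<^sub>R a" "- y"] by simp
  then have z: "inf (x - y) (n *\<^sub>R a - y) = 0" by (simp add: y_def)
  have "a \<le> n *\<^sub>R a - y"
    using scaleR_right_mono[OF cn, of a] a by (simp add: yc algebra_simps)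
  then have "inf (x - y) a \<le> 0" using z inf_mono[of "x - y" "x - y" a "n *\<^sub>R a - y"] by simp
  moreover have "0 \<le> x - y" using y by simp
  ultimately have "x - c *\<^sub>R a \<in> perp a"
    using a by (auto simp: perp_def yc[symmetric] intro!: antisym)
  with c0 show ?thesis by blast
qed

definition coord :: "'a::banach_lattice \<Rightarrow> 'a \<Rightarrow> real" where
  "coord a x = (THE c. x - c *\<^sub>R a \<in> perp a)"

lemma coord_unique:
  fixes a x :: "'a::banach_lattice"
  assumes "atom a" "x - c *\<^sub>R a \<in> perp a"
  shows "coord a x = c"
  unfolding coord_def
proof (rule the_equality)
  fix d assume d: "x - d *\<^sub>R a \<in> perp a"
  have a: "0 < a" using assms by (simp add: atom_def)
  then have a': "0 \<le> a" by simp
  have "(x - c *\<^sub>R a) + (-1) *\<^sub>R (x - d *\<^sub>R a) \<in> perp a"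
    by (intro perp_add[OF a'] perp_scaleR[OF a'] assms d)
  then have "(d - c) *\<^sub>R a \<in> perp a" by (simp add: algebra_simps)
  from perp_self[OF a this] show "d = c" by simp
qed (rule assms)

lemma coord_split:
  fixes a x :: "'a::banach_lattice"
  assumes "atom a"
  shows "x - coord a x *\<^sub>R a \<in> perp a"
proof -
  have a': "0 \<le> a" using assms by (simp add: atom_def order_less_imp_le)
  obtain c d where "pprt x - c *\<^sub>R a \<in> perp a" "- nprt x - d *\<^sub>R a \<in> perp a"
    using atom_split_pos[OF assms, of "pprt x"] atom_split_pos[OF assms, of "- nprt x"] by auto
  then have "(pprt x - c *\<^sub>R a) + (-1) *\<^sub>R (- nprt x - d *\<^sub>R a) \<in> perp a"
    by (intro perp_add[OF a'] perp_scaleR[OF a'])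
  moreover have "(pprt x - c *\<^sub>R a) + (-1) *\<^sub>R (- nprt x - d *\<^sub>R a) = x - (c - d) *\<^sub>R a"
    using prts[of x] by (simp add: algebra_simps)
  ultimately have "x - (c - d) *\<^sub>R a \<in> perp a" by simp
  with coord_unique[OF assms this] show ?thesis by simp
qed

lemma coord_add: "atom a \<Longrightarrow> coord a (x + y) = coord a x + coord a y"
  using perp_add[OF _ coord_split[of a x] coord_split[of a y]]
  by (intro coord_unique) (auto simp: atom_def algebra_simps order_less_imp_le)

lemma coord_scaleR: "atom a \<Longrightarrow> coord a (c *\<^sub>R x) = c * coord a x"
  using perp_scaleR[OF _ coord_split[of a x], of c]
  by (intro coord_unique) (auto simp: atom_def algebra_simps order_less_imp_le)

lemma coord_nonneg: "atom a \<Longrightarrow> 0 \<le> x \<Longrightarrow> 0 \<le> coord a x"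
  using atom_split_pos[of a x] coord_unique[of a x] by auto

text \<open>
  If \<open>x = c a + z\<close> with \<open>z\<close> disjoint from \<open>a\<close>, then \<open>\<bar>c\<bar> a \<le> \<bar>x\<bar> + \<bar>z\<bar>\<close>, and the part of this bound that
  comes from \<open>\<bar>z\<bar>\<close> contributes nothing below a multiple of \<open>a\<close>.
\<close>

lemma coord_le_abs:
  fixes a x :: "'a::banach_lattice"
  assumes "atom a"
  shows "\<bar>coord a x\<bar> *\<^sub>R a \<le> \<bar>x\<bar>"
proof -
  define c where "c = coord a x"
  define z where "z = x - c *\<^sub>R a"
  have a: "0 \<le> a" "0 < a" using assms by (auto simp: atom_def)
  have z: "z \<in> perp a" unfolding z_def c_def by (rule coord_split[OF assms])
  have ca: "0 \<le> \<bar>c\<bar> *\<^sub>R a" using a by (intro scaleR_nonneg_nonneg) auto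
  have "\<bar>c\<bar> *\<^sub>R a = \<bar>x - z\<bar>" using a by (simp add: z_def abs_scaleR_lattice)
  also have "\<dots> \<le> \<bar>x\<bar> + \<bar>z\<bar>" by (rule abs_triangle_ineq4)
  finally have "\<bar>c\<bar> *\<^sub>R a \<le> inf (\<bar>x\<bar> + \<bar>z\<bar>) (\<bar>c\<bar> *\<^sub>R a)" by simp
  also have "\<dots> \<le> inf \<bar>x\<bar> (\<bar>c\<bar> *\<^sub>R a) + inf \<bar>z\<bar> (\<bar>c\<bar> *\<^sub>R a)" using ca by (intro inf_add_le) auto
  also have "inf \<bar>z\<bar> (\<bar>c\<bar> *\<^sub>R a) \<le> inf (\<bar>(\<bar>c\<bar> + 1) *\<^sub>R z\<bar>) ((\<bar>c\<bar> + 1) *\<^sub>R a)"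
  proof (rule inf_mono)
    show "\<bar>z\<bar> \<le> \<bar>(\<bar>c\<bar> + 1) *\<^sub>R z\<bar>"
      using scaleR_right_mono[of 1 "\<bar>c\<bar> + 1" "\<bar>z\<bar>"] by (simp add: abs_scaleR_lattice)
    show "\<bar>c\<bar> *\<^sub>R a \<le> (\<bar>c\<bar> + 1) *\<^sub>R a" using a by (intro scaleR_right_mono) auto
  qed
  also have "\<dots> = (\<bar>c\<bar> + 1) *\<^sub>R inf \<bar>z\<bar> a" by (subst scaleR_inf) (auto simp: abs_scaleR_lattice)
  also have "\<dots> = 0" using z by (simp add: perp_def)
  finally have "\<bar>c\<bar> *\<^sub>R a \<le> inf \<bar>x\<bar> (\<bar>c\<bar> *\<^sub>R a)" by simp
  then show ?thesis by (simp add: c_def)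
qed

text \<open>
  Two atoms are either proportional or disjoint, so normalising picks one representative of each atomic
  direction: distinct elements of this set are disjoint.
\<close>

definition unit_atoms :: "'a::banach_lattice set" where
  "unit_atoms = {a. atom a \<and> norm a = 1}"

lemma unit_atomsD [dest]: "a \<in> unit_atoms \<Longrightarrow> atom a" "a \<in> unit_atoms \<Longrightarrow> norm a = 1"
  "a \<in> unit_atoms \<Longrightarrow> 0 \<le> a"
  by (auto simp: unit_atoms_def atom_def)

lemma coord_norm_le: "a \<in> unit_atoms \<Longrightarrow> \<bar>coord a x\<bar> \<le> norm x" for x :: "'a::banach_lattice"
  using norm_mono_pos[OF _ coord_le_abs[of a x]] unit_atomsD[of a]
    scaleR_nonneg_nonneg[of "\<bar>coord a x\<bar>" a] by auto

lemma bounded_linear_coord: "a \<in> unit_atoms \<Longrightarrow> bounded_linear (coord a)"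
  by (rule bounded_linear_intro[where K=1]) (auto simp: coord_add coord_scaleR coord_norm_le)

lemma coord_0 [simp]: "a \<in> unit_atoms \<Longrightarrow> coord a 0 = 0"
  using coord_scaleR[of a 0 0] by auto

lemma coord_diff: "a \<in> unit_atoms \<Longrightarrow> coord a (x - y) = coord a x - coord a y"
  using linear_diff[OF bounded_linear.linear[OF bounded_linear_coord]] .

lemma coord_sum: "a \<in> unit_atoms \<Longrightarrow> coord a (sum f S) = (\<Sum>i\<in>S. coord a (f i))"
  using linear_sum[OF bounded_linear.linear[OF bounded_linear_coord]] .

lemma coord_self: "a \<in> unit_atoms \<Longrightarrow> coord a a = 1"
  by (rule coord_unique) (auto simp: perp_def inf_absorb1)

lemma coord_other:
  fixes a b :: "'a::banach_lattice"
  assumes "a \<in> unit_atoms" "b \<in> unit_atoms" "a \<noteq> b"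
  shows "coord a b = 0"
proof -
  define y where "y = inf a b"
  have ab: "0 \<le> a" "0 \<le> b" "atom a" "atom b" "norm a = 1" "norm b = 1" using assms by auto
  then have y: "0 \<le> y" "y \<le> a" "y \<le> b" by (auto simp: y_def)
  obtain c d where c: "y = c *\<^sub>R a" and d: "y = d *\<^sub>R b"
    using ab y unfolding atom_def by metis
  have "y = 0"
  proof (rule ccontr)
    assume "y \<noteq> 0"
    then have cd: "c \<noteq> 0" "d \<noteq> 0" using c d by auto
    have "\<bar>c\<bar> = norm y" "\<bar>d\<bar> = norm y" using ab c d by (metis mult.right_neutral norm_scaleR)+
    moreover have "0 \<le> c"
      using coord_nonneg[OF ab(3) y(1)] coord_self[OF assms(1)] coord_scaleR[OF ab(3), of c a] c by simp
    moreover have "0 \<le> d"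
      using coord_nonneg[OF ab(4) y(1)] coord_self[OF assms(2)] coord_scaleR[OF ab(4), of d b] d by simp
    ultimately have "c = d" by simp
    then show False using c d cd assms(3) by auto
  qed
  then have "b - 0 *\<^sub>R a \<in> perp a" using ab by (simp add: perp_def y_def inf_commute)
  then show ?thesis using coord_unique ab by blast
qed

definition proj :: "'a::banach_lattice set \<Rightarrow> 'a \<Rightarrow> 'a" where
  "proj S x = (\<Sum>a\<in>S. coord a x *\<^sub>R a)"

lemma coord_comb:
  assumes "finite S" "S \<subseteq> unit_atoms" "b \<in> unit_atoms"
  shows "coord b (\<Sum>a\<in>S. t a *\<^sub>R a) = (if b \<in> S then t b else 0)"
proof -
  have "coord b (\<Sum>a\<in>S. t a *\<^sub>R a) = (\<Sum>a\<in>S. if a = b then t b else 0)"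
    unfolding coord_sum[OF assms(3)] using assms
    by (intro sum.cong) (auto simp: coord_scaleR coord_self coord_other subset_iff unit_atomsD)
  then show ?thesis using assms by simp
qed

lemma coord_proj:
  assumes "finite S" "S \<subseteq> unit_atoms" "b \<in> unit_atoms"
  shows "coord b (proj S x) = (if b \<in> S then coord b x else 0)"
  unfolding proj_def by (rule coord_comb[OF assms])

lemma proj_comb:
  assumes "finite S" "S \<subseteq> unit_atoms" "T \<subseteq> S" 
  shows "proj T (\<Sum>a\<in>S. t a *\<^sub>R a) = (\<Sum>a\<in>T. t a *\<^sub>R a)"
  unfolding proj_def using assms by (intro sum.cong) (auto simp: coord_comb subset_iff)

lemma proj_proj_subset:
  assumes "finite S" "S \<subseteq> unit_atoms" "T \<subseteq> S"
  shows "proj T (proj S x) = proj T x"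
  using proj_comb[OF assms] by (simp add: proj_def)

lemma bounded_linear_proj: "S \<subseteq> unit_atoms \<Longrightarrow> bounded_linear (proj S)"
  unfolding proj_def
  by (intro bounded_linear_sum bounded_linear_compose[OF bounded_linear_scaleR_left] bounded_linear_coord) auto

lemma linear_proj: "S \<subseteq> unit_atoms \<Longrightarrow> linear (proj S)"
  by (rule bounded_linear.linear[OF bounded_linear_proj])

text \<open>
  The coordinates are split off one at a time. The coordinate of \<open>x - proj S x\<close> at a new atom \<open>b\<close> is still
  that of \<open>x\<close>, so the multiple of \<open>b\<close> that is added next is dominated by the positive remainder.
\<close>

lemma proj_pos_bounds:
  fixes x :: "'a::banach_lattice"
  assumes "finite S" "S \<subseteq> unit_atoms" "0 \<le> x"
  shows "0 \<le> proj S x \<and> proj S x \<le> x"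
  using assms
proof (induction S rule: finite_induct)
  case (insert b S)
  then have b: "b \<in> unit_atoms" and S: "S \<subseteq> unit_atoms" by auto
  then have IH: "0 \<le> proj S x" "proj S x \<le> x" using insert by auto
  have c: "coord b (x - proj S x) = coord b x"
    using insert.hyps b S by (simp add: coord_diff coord_proj)
  have pos: "0 \<le> coord b x *\<^sub>R b" using insert b by (auto intro!: scaleR_nonneg_nonneg coord_nonneg)
  have "coord b x *\<^sub>R b \<le> \<bar>coord b (x - proj S x)\<bar> *\<^sub>R b"
    unfolding c using b by (auto intro!: scaleR_right_mono)
  also have "\<dots> \<le> \<bar>x - proj S x\<bar>" using b by (intro coord_le_abs) auto
  also have "\<dots> = x - proj S x" using IH by simp
  finally have "coord b x *\<^sub>R b + proj S x \<le> x" by (simp add: le_diff_eq)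
  with IH pos insert.hyps show ?case by (simp add: proj_def)
qed (auto simp: proj_def)

lemma abs_proj_le:
  fixes x :: "'a::banach_lattice"
  assumes "finite S" "S \<subseteq> unit_atoms"
  shows "\<bar>proj S x\<bar> \<le> proj S \<bar>x\<bar>"
proof (rule abs_leI)
  have "0 \<le> proj S (\<bar>x\<bar> - x)" "0 \<le> proj S (\<bar>x\<bar> - - x)"
    using proj_pos_bounds[OF assms, of "\<bar>x\<bar> - x"] proj_pos_bounds[OF assms, of "\<bar>x\<bar> - - x"]
    by (simp_all only: diff_ge_0_iff_ge abs_ge_self abs_ge_minus_self)
  then show "proj S x \<le> proj S \<bar>x\<bar>" "- proj S x \<le> proj S \<bar>x\<bar>"
    unfolding linear_diff[OF linear_proj[OF assms(2)]] linear_neg[OF linear_proj[OF assms(2)]]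
    by (simp_all only: diff_ge_0_iff_ge)
qed

lemma norm_proj_le:
  assumes "finite S" "S \<subseteq> unit_atoms"
  shows "norm (proj S x) \<le> norm x"
  using abs_proj_le[OF assms, of x] proj_pos_bounds[OF assms, of "\<bar>x\<bar>"]
  by (intro norm_abs_mono) auto

text \<open>
  The triangle inequality gives one direction. For the other, the coordinate of \<open>\<bar>x\<bar>\<close> at \<open>a\<close> is at least
  \<open>\<bar>t a\<bar>\<close>, and \<open>proj S \<bar>x\<bar> \<le> \<bar>x\<bar>\<close>.
\<close>

lemma abs_comb:
  fixes t :: "'a::banach_lattice \<Rightarrow> real"
  assumes S: "finite S" "S \<subseteq> unit_atoms"
  shows "\<bar>\<Sum>a\<in>S. t a *\<^sub>R a\<bar> = (\<Sum>a\<in>S. \<bar>t a\<bar> *\<^sub>R a)"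
proof (rule antisym)
  have "\<bar>\<Sum>a\<in>S. t a *\<^sub>R a\<bar> \<le> (\<Sum>a\<in>S. \<bar>t a *\<^sub>R a\<bar>)" by (rule sum_abs)
  also have "\<dots> = (\<Sum>a\<in>S. \<bar>t a\<bar> *\<^sub>R a)"
    using S by (intro sum.cong) (auto simp: abs_scaleR_lattice subset_iff unit_atomsD)
  finally show "\<bar>\<Sum>a\<in>S. t a *\<^sub>R a\<bar> \<le> (\<Sum>a\<in>S. \<bar>t a\<bar> *\<^sub>R a)" .
  define x where "x = (\<Sum>a\<in>S. t a *\<^sub>R a)"
  have "\<bar>t a\<bar> \<le> coord a \<bar>x\<bar>" if "a \<in> S" for a
  proof -
    have a: "a \<in> unit_atoms" using that S by auto
    have "\<bar>t a\<bar> *\<^sub>R a \<le> \<bar>x\<bar>"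
      using coord_le_abs[of a x] that a S coord_comb[of S a t] by (auto simp: x_def)
    then have "0 \<le> coord a (\<bar>x\<bar> - \<bar>t a\<bar> *\<^sub>R a)" using a by (intro coord_nonneg) auto
    then show ?thesis using a by (simp add: coord_diff coord_scaleR coord_self unit_atomsD)
  qed
  then have "(\<Sum>a\<in>S. \<bar>t a\<bar> *\<^sub>R a) \<le> proj S \<bar>x\<bar>"
    unfolding proj_def using S by (intro sum_mono scaleR_right_mono) (auto dest: subsetD)
  also have "\<dots> \<le> \<bar>x\<bar>" using proj_pos_bounds[OF S, of "\<bar>x\<bar>"] by simp
  finally show "(\<Sum>a\<in>S. \<bar>t a\<bar> *\<^sub>R a) \<le> \<bar>\<Sum>a\<in>S. t a *\<^sub>R a\<bar>" by (simp add: x_def)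
qed

text \<open>
  This is where discreteness enters: a nonzero \<open>\<bar>x - y\<bar>\<close> would dominate an atom, on whose normalisation
  \<open>x - y\<close> would have a nonzero coordinate.
\<close>

lemma discrete_coord_eqI:
  fixes x y :: "'a::banach_lattice"
  assumes "discrete_banach_lattice TYPE('a)" "\<And>a. a \<in> unit_atoms \<Longrightarrow> coord a x = coord a y"
  shows "x = y"
proof (rule ccontr)
  assume "x \<noteq> y"
  then have "0 < \<bar>x - y\<bar>" by simp
  then obtain a where a: "atom a" "a \<le> \<bar>x - y\<bar>" using assms(1) unfolding discrete_banach_lattice_def by blast
  define b where "b = (1 / norm a) *\<^sub>R a"
  have a0: "0 < a" using a by (simp add: atom_def)
  have "atom b"
    unfolding atom_def
  proof (intro conjI allI impI)
    show "0 < b" using a0 by (auto simp: b_def order_less_le intro!: scaleR_nonneg_nonneg)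
    fix y assume "0 \<le> y \<and> y \<le> b"
    then have "0 \<le> norm a *\<^sub>R y \<and> norm a *\<^sub>R y \<le> a"
      using scaleR_left_mono[of y b "norm a"] a0 by (auto simp: b_def intro!: scaleR_nonneg_nonneg split: if_splits)
    then obtain c where "norm a *\<^sub>R y = c *\<^sub>R a" using a(1) unfolding atom_def by blast
    then have "(1 / norm a) *\<^sub>R (norm a *\<^sub>R y) = c *\<^sub>R b" by (simp add: b_def)
    then show "\<exists>c. y = c *\<^sub>R b" using a0 by (auto split: if_splits)
  qed
  then have b: "b \<in> unit_atoms" using a0 by (simp add: unit_atoms_def b_def)
  then have "coord b (x - y) = 0" using assms(2) by (simp add: coord_diff)
  then have "inf \<bar>x - y\<bar> b = 0" using coord_split[OF \<open>atom b\<close>, of "x - y"] by (simp add: perp_def)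
  then have "norm a *\<^sub>R b \<in> perp b" 
    using perp_mono[of b "x - y" "norm a *\<^sub>R b"] b a a0 by (auto simp: perp_def b_def)
  moreover have "0 < b" using \<open>atom b\<close> by (simp add: atom_def)
  ultimately show False using perp_self[of b "norm a"] a0 by auto
qed

section \<open>Unconditional expansion along the atoms\<close>

text \<open>
  An equivalent form of the usual definition of a KB-space, in which bounded increasing sequences
  converge in norm; it excludes lattice copies of \<open>c\<^sub>0\<close>. The form with differences is the one in which the
  property is both derived and applied.
\<close>

definition KB_property :: "'a::banach_lattice itself \<Rightarrow> bool" where
  "KB_property _ \<longleftrightarrow> (\<forall>d :: nat \<Rightarrow> 'a. (\<forall>n. 0 \<le> d n) \<longrightarrow> (\<exists>M. \<forall>N. norm (\<Sum>n<N. d n) \<le> M) \<longrightarrow> d \<longlonglongrightarrow> 0)"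

text \<open>
  The gliding hump: if the property \<open>Q\<close> can be met by finite sets that avoid any given finite set, it can be
  met along a disjoint sequence. The sets chosen so far are collected and avoided at the next step.
\<close>

lemma disjoint_blocks:
  assumes "\<And>S. finite S \<Longrightarrow> S \<subseteq> U \<Longrightarrow> \<exists>T. finite T \<and> T \<subseteq> U - S \<and> Q T"
  shows "\<exists>B :: nat \<Rightarrow> 'a set. (\<forall>n. finite (B n) \<and> B n \<subseteq> U \<and> Q (B n)) \<and> disjoint_family B"
proof -
  obtain g where g: "\<And>S. finite S \<Longrightarrow> S \<subseteq> U \<Longrightarrow> finite (g S) \<and> g S \<subseteq> U - S \<and> Q (g S)"
    using assms by metis
  define A where "A = rec_nat {} (\<lambda>_ S. S \<union> g S)"
  have A0: "A 0 = {}" and AS: "\<And>n. A (Suc n) = A n \<union> g (A n)" by (auto simp: A_def)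
  have A: "finite (A n) \<and> A n \<subseteq> U" for n
    by (induction n) (use g in \<open>auto simp: A0 AS\<close>)
  have mono: "m \<le> n \<Longrightarrow> A m \<subseteq> A n" for m n
    by (rule lift_Suc_mono_le[of A]) (auto simp: AS)
  have dis: "g (A m) \<inter> g (A n) = {}" if "m < n" for m n
    using mono[of "Suc m" n] that g[of "A n"] A[of n] by (auto simp: AS)
  have "disjoint_family (\<lambda>n. g (A n))"
    unfolding disjoint_family_on_def using dis by (metis inf_commute nat_neq_iff)
  then show ?thesis using g A by (intro exI[of _ "\<lambda>n. g (A n)"]) blast
qed

lemma sum_over_disjoint_blocks:
  assumes "\<And>n::nat. finite (B n)" "disjoint_family B"
  shows "(\<Sum>n<N. \<Sum>a\<in>B n. f a) = (\<Sum>a\<in>(\<Union>n<N. B n). f a)"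
  using assms by (subst sum.UNION_disjoint) (auto simp: disjoint_family_on_def)

text \<open>
  The moduli of the block sums are positive and their partial sums are moduli of sums over finite sets
  of atoms, so they are the terms of a bounded positive series.
\<close>

lemma KB_block_null:
  fixes t :: "'a::banach_lattice \<Rightarrow> real"
  assumes KB: "KB_property TYPE('a)"
    and bd: "\<And>S. finite S \<Longrightarrow> S \<subseteq> unit_atoms \<Longrightarrow> norm (\<Sum>a\<in>S. t a *\<^sub>R a) \<le> M"
    and B: "\<And>n::nat. finite (B n)" "\<And>n. B n \<subseteq> unit_atoms" "disjoint_family B"
  shows "(\<lambda>n. \<Sum>a\<in>B n. t a *\<^sub>R a) \<longlonglongrightarrow> 0"
proof -
  define d where "d n = (\<Sum>a\<in>B n. \<bar>t a\<bar> *\<^sub>R a)" for n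
  have d: "d n = \<bar>\<Sum>a\<in>B n. t a *\<^sub>R a\<bar>" for n
    unfolding d_def using B by (simp add: abs_comb)
  have "norm (\<Sum>n<N. d n) \<le> M" for N
  proof -
    have U: "finite (\<Union>n<N. B n)" "(\<Union>n<N. B n) \<subseteq> unit_atoms" using B by auto
    have "(\<Sum>n<N. d n) = (\<Sum>a\<in>(\<Union>n<N. B n). \<bar>t a\<bar> *\<^sub>R a)"
      unfolding d_def using B by (intro sum_over_disjoint_blocks) auto
    also have "\<dots> = \<bar>\<Sum>a\<in>(\<Union>n<N. B n). t a *\<^sub>R a\<bar>"
      using abs_comb[OF U, of t] by simp
    finally show ?thesis using bd[OF U] by simp
  qed
  moreover have "\<forall>n. 0 \<le> d n" by (simp add: d)
  ultimately have "d \<longlonglongrightarrow> 0" using KB unfolding KB_property_def by blast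
  then have "(\<lambda>n. norm (d n)) \<longlonglongrightarrow> 0" by (rule tendsto_norm_zero)
  then show ?thesis unfolding d norm_abs_lattice by (rule tendsto_norm_zero_cancel)
qed

lemma KB_tail_small:
  fixes t :: "'a::banach_lattice \<Rightarrow> real"
  assumes KB: "KB_property TYPE('a)"
    and bd: "\<And>S. finite S \<Longrightarrow> S \<subseteq> unit_atoms \<Longrightarrow> norm (\<Sum>a\<in>S. t a *\<^sub>R a) \<le> M"
    and e: "0 < e"
  shows "\<exists>S. finite S \<and> S \<subseteq> unit_atoms \<and>
    (\<forall>T. finite T \<and> T \<subseteq> unit_atoms - S \<longrightarrow> norm (\<Sum>a\<in>T. t a *\<^sub>R a) < e)"
proof (rule ccontr)
  assume "\<not> ?thesis"
  then have "\<exists>T. finite T \<and> T \<subseteq> unit_atoms - S \<and> e \<le> norm (\<Sum>a\<in>T. t a *\<^sub>R a)"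
    if "finite S" "S \<subseteq> unit_atoms" for S using that by (meson not_le)
  from disjoint_blocks[of unit_atoms, OF this] obtain B :: "nat \<Rightarrow> 'a set"
    where B: "\<And>n. finite (B n)" "\<And>n. B n \<subseteq> unit_atoms" "disjoint_family B"
      and le: "\<And>n. e \<le> norm (\<Sum>a\<in>B n. t a *\<^sub>R a)" by blast
  have "(\<lambda>n. norm (\<Sum>a\<in>B n. t a *\<^sub>R a)) \<longlonglongrightarrow> 0"
    by (rule tendsto_norm_zero[OF KB_block_null[OF KB bd B]])
  from order_tendstoD(2)[OF this e] obtain n where "norm (\<Sum>a\<in>B n. t a *\<^sub>R a) < e"
    by (auto simp: eventually_sequentially)
  with le[of n] show False by simp
qed

text \<open>
  Formal sums over atoms with bounded finite partial sums converge. This replaces a predual of \<open>'a\<close>: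
  it turns coordinatewise limits of bounded sequences into elements of the space.
\<close>

lemma KB_comb_has_sum:
  fixes t :: "'a::banach_lattice \<Rightarrow> real"
  assumes KB: "KB_property TYPE('a)"
    and bd: "\<And>S. finite S \<Longrightarrow> S \<subseteq> unit_atoms \<Longrightarrow> norm (\<Sum>a\<in>S. t a *\<^sub>R a) \<le> M"
  shows "\<exists>v. ((\<lambda>a. t a *\<^sub>R a) has_sum v) unit_atoms \<and> (\<forall>a\<in>unit_atoms. coord a v = t a)"
proof -
  let ?s = "\<lambda>S. \<Sum>a\<in>S. t a *\<^sub>R a"
  have "\<exists>S. \<forall>n. finite (S n) \<and> S n \<subseteq> unit_atoms \<and>
    (\<forall>T. finite T \<and> T \<subseteq> unit_atoms - S n \<longrightarrow> norm (?s T) < 1 / real (Suc n))"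
    by (rule choice, rule allI, rule KB_tail_small[OF KB bd]) auto
  then obtain S where S': "\<forall>n. finite (S n) \<and> S n \<subseteq> unit_atoms \<and>
    (\<forall>T. finite T \<and> T \<subseteq> unit_atoms - S n \<longrightarrow> norm (?s T) < 1 / real (Suc n))" ..
  then have S: "\<And>n. finite (S n)" "\<And>n. S n \<subseteq> unit_atoms" by simp_all
  have tail: "norm (?s T) < 1 / real (Suc n)" if "finite T" "T \<subseteq> unit_atoms - S n" for n T
    using S' that by simp
  define V where "V n = (\<Union>i\<le>n. S i)" for n
  have V: "finite (V n)" "V n \<subseteq> unit_atoms" "S n \<subseteq> V n" for n using S by (auto simp: V_def)
  have Vm: "m \<le> n \<Longrightarrow> V m \<subseteq> V n" for m n unfolding V_def by (intro UN_mono) auto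
  have near: "norm (?s F - ?s (V n)) < 1 / real (Suc n)"
    if "finite F" "V n \<subseteq> F" "F \<subseteq> unit_atoms" for F n
  proof -
    have "?s F - ?s (V n) = ?s (F - V n)" using that by (simp add: sum_diff)
    then show ?thesis using tail[of "F - V n" n] that V(3)[of n] by auto
  qed
  have "Cauchy (\<lambda>n. ?s (V n))"
  proof (rule CauchyI')
    fix e :: real assume "0 < e"
    then obtain n where n: "1 / real (Suc n) < e" using nat_approx_posE by blast
    show "\<exists>M. \<forall>m\<ge>M. \<forall>k>m. dist (?s (V m)) (?s (V k)) < e"
    proof (intro exI[of _ n] allI impI)
      fix m k :: nat assume mk: "n \<le> m" "m < k"
      have "norm (?s (V k) - ?s (V m)) < 1 / real (Suc m)" using near[of "V k" m] Vm[of m k] V mk by auto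
      also have "\<dots> \<le> 1 / real (Suc n)" using mk by (simp add: field_simps)
      finally show "dist (?s (V m)) (?s (V k)) < e" using n by (simp add: dist_norm norm_minus_commute)
    qed
  qed
  then obtain v where v: "(\<lambda>n. ?s (V n)) \<longlonglongrightarrow> v" using Cauchy_convergent convergent_def by blast
  have hs: "((\<lambda>a. t a *\<^sub>R a) has_sum v) unit_atoms"
    unfolding has_sum_def tendsto_iff eventually_finite_subsets_at_top
  proof (intro allI impI)
    fix e :: real assume e: "0 < e"
    then obtain n where n: "1 / real (Suc n) < e / 2" using nat_approx_posE[of "e/2"] by auto
    from v e have "eventually (\<lambda>n. dist (?s (V n)) v < e/2) sequentially"
      using tendstoD[of _ v _ "e/2"] by fastforce
    then obtain m where m: "m \<ge> n" "dist (?s (V m)) v < e/2"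
      unfolding eventually_sequentially by (meson nle_le order_refl)
    have mn: "1 / real (Suc m) < e / 2" using n m(1) frac_le[of 1 1 "real (Suc n)" "real (Suc m)"] by simp
    show "\<exists>X. finite X \<and> X \<subseteq> unit_atoms \<and> (\<forall>Y. finite Y \<and> X \<subseteq> Y \<and> Y \<subseteq> unit_atoms \<longrightarrow> dist (?s Y) v < e)"
    proof (intro exI[of _ "V m"] conjI allI impI)
      fix Y assume Y: "finite Y \<and> V m \<subseteq> Y \<and> Y \<subseteq> unit_atoms"
      have "dist (?s Y) (?s (V m)) < e/2" using near[of Y m] Y mn by (auto simp: dist_norm)
      then show "dist (?s Y) v < e" using m(2) dist_triangle[of "?s Y" v "?s (V m)"] by linarith
    qed (use V in auto)
  qed
  have "coord b v = t b" if b: "b \<in> unit_atoms" for b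
  proof -
    have 1: "((\<lambda>a. coord b (t a *\<^sub>R a)) has_sum coord b v) unit_atoms"
      using has_sum_bounded_linear[OF bounded_linear_coord[OF b] hs] by (simp add: o_def)
    have 2: "((\<lambda>a. coord b (t a *\<^sub>R a)) has_sum t b) unit_atoms"
      by (rule has_sum_finite_neutralI[of "{b}"])
        (use b in \<open>auto simp: coord_scaleR coord_self coord_other unit_atomsD\<close>)
    show ?thesis by (rule has_sum_unique[OF 1 2])
  qed
  with hs show ?thesis by blast
qed

lemma KB_expansion:
  fixes x :: "'a::banach_lattice"
  assumes KB: "KB_property TYPE('a)" and D: "discrete_banach_lattice TYPE('a)"
  shows "((\<lambda>a. coord a x *\<^sub>R a) has_sum x) unit_atoms"
proof -
  have "norm (\<Sum>a\<in>S. coord a x *\<^sub>R a) \<le> norm x" if "finite S" "S \<subseteq> unit_atoms" for S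
    using norm_proj_le[OF that, of x] by (simp add: proj_def)
  from KB_comb_has_sum[OF KB this] obtain v
    where v: "((\<lambda>a. coord a x *\<^sub>R a) has_sum v) unit_atoms" "\<And>a. a \<in> unit_atoms \<Longrightarrow> coord a v = coord a x"
    by blast
  have "v = x" by (rule discrete_coord_eqI[OF D]) (rule v(2))
  with v(1) show ?thesis by simp
qed

lemma KB_proj_blocks_null:
  fixes x :: "'a::banach_lattice"
  assumes KB: "KB_property TYPE('a)"
    and B: "\<And>n::nat. finite (B n)" "\<And>n. B n \<subseteq> unit_atoms" "disjoint_family B"
  shows "(\<lambda>n. proj (B n) x) \<longlonglongrightarrow> 0"
  unfolding proj_def
proof (rule KB_block_null[OF KB _ B])
  show "norm (\<Sum>a\<in>S. coord a x *\<^sub>R a) \<le> norm x" if "finite S" "S \<subseteq> unit_atoms" for S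
    using norm_proj_le[OF that, of x] by (simp add: proj_def)
qed

lemma KB_remainder_le:
  fixes x :: "'a::banach_lattice"
  assumes KB: "KB_property TYPE('a)" and D: "discrete_banach_lattice TYPE('a)"
    and S: "finite S" "S \<subseteq> unit_atoms"
    and le: "\<And>T. finite T \<Longrightarrow> T \<subseteq> unit_atoms - S \<Longrightarrow> norm (proj T x) \<le> e"
  shows "norm (x - proj S x) \<le> e"
proof -
  have "((\<lambda>a. coord a x *\<^sub>R a) has_sum proj S x) S"
    unfolding proj_def using S by (simp add: has_sum_finite)
  then have "((\<lambda>a. coord a x *\<^sub>R a) has_sum (x - proj S x)) (unit_atoms - S)"
    using has_sum_Diff[OF KB_expansion[OF KB D]] S by blast
  then have "((\<lambda>F. norm (proj F x)) \<longlongrightarrow> norm (x - proj S x)) (finite_subsets_at_top (unit_atoms - S))"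
    unfolding has_sum_def proj_def by (rule tendsto_norm)
  then show ?thesis
    by (rule tendsto_upperbound) (auto intro!: eventually_finite_subsets_at_top_weakI le)
qed

section \<open>A minimax theorem for finitely many functions\<close>

text \<open>
  The condition on \<open>c\<close> is an upper bound for each \<open>v\<close> with \<open>f v < 0\<close> and a lower bound for each \<open>v\<close> with
  \<open>g v < 0\<close>. If some lower bound exceeded some upper bound, then a suitable mixture of the two elements
  would make \<open>f\<close> and \<open>g\<close> negative at once.
\<close>

lemma two_function_minimax:
  fixes f g :: "'c \<Rightarrow> real"
  assumes conv: "\<And>u v t. u \<in> C \<Longrightarrow> v \<in> C \<Longrightarrow> 0 \<le> t \<Longrightarrow> t \<le> 1 \<Longrightarrow>
      \<exists>w\<in>C. f w \<le> t * f u + (1 - t) * f v \<and> g w \<le> t * g u + (1 - t) * g v"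
    and max: "\<And>v. v \<in> C \<Longrightarrow> 0 \<le> f v \<or> 0 \<le> g v"
  shows "\<exists>c\<ge>0. c \<le> 1 \<and> (\<forall>v\<in>C. 0 \<le> c * f v + (1 - c) * g v)"
proof -
  define A where "A = {v \<in> C. f v < 0}"
  define ub where "ub v = g v / (g v - f v)" for v
  have A: "0 \<le> g u" "0 < g u - f u" if "u \<in> A" for u using max[of u] that by (auto simp: A_def)
  have cross: "f u * g v \<le> g u * f v" if u: "u \<in> A" and v: "v \<in> C" "g v < 0" for u v
  proof (rule ccontr)
    assume "\<not> f u * g v \<le> g u * f v"
    define a b c d where "a = - f u" and "b = g u" and "c = f v" and "d = - g v"
    have abcd: "a > 0" "b \<ge> 0" "c \<ge> 0" "d > 0" "b * c < a * d"
      using u v max[of v] max[of u] \<open>\<not> f u * g v \<le> g u * f v\<close> by (auto simp: A_def a_def b_def c_def d_def)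
    have "\<exists>s>0. c < s * a \<and> s * b < d"
    proof (cases "b = 0")
      case True
      then show ?thesis using abcd by (intro exI[of _ "c / a + 1"]) (auto simp: field_simps add_pos_nonneg add_nonneg_pos)
    next
      case False
      then have "c / a < d / b" using abcd by (simp add: field_simps)
      then obtain s where s: "c / a < s" "s < d / b" using dense by blast
      moreover have "0 \<le> c / a" using abcd by simp
      ultimately have "s > 0" by linarith
      then show ?thesis using s False abcd by (intro exI[of _ s]) (auto simp: field_simps)
    qed
    then obtain s where s: "s > 0" "c < s * a" "s * b < d" by blast
    define t where "t = s / (1 + s)"
    have t: "0 \<le> t" "t \<le> 1" "1 - t = 1 / (1 + s)" using s by (auto simp: t_def field_simps)
    obtain w where w: "w \<in> C" "f w \<le> t * f u + (1 - t) * f v" "g w \<le> t * g u + (1 - t) * g v"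
      using conv[of u v t] t u v by (auto simp: A_def)
    have "t * f u + (1 - t) * f v = (c - s * a) / (1 + s)"
      unfolding t(3) by (simp add: t_def a_def c_def add_divide_distrib)
    moreover have "(c - s * a) / (1 + s) < 0" using s by (intro divide_neg_pos) auto
    moreover have "t * g u + (1 - t) * g v = (s * b - d) / (1 + s)"
      unfolding t(3) by (simp add: t_def b_def d_def add_divide_distrib)
    moreover have "(s * b - d) / (1 + s) < 0" using s by (intro divide_neg_pos) auto
    ultimately show False using max[OF w(1)] w by linarith
  qed
  show ?thesis
  proof (cases "A = {}")
    case True
    then show ?thesis by (intro exI[of _ 1]) (auto simp: A_def not_less)
  next
    case False
    define c where "c = Inf (ub ` A)"
    have ub0: "0 \<le> ub u" if "u \<in> A" for u using A[OF that] by (simp add: ub_def)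
    then have bdd: "bdd_below (ub ` A)" by (intro bdd_belowI2[of _ 0])
    have c_le: "c \<le> ub u" if "u \<in> A" for u unfolding c_def using bdd that by (intro cINF_lower)
    have c0: "0 \<le> c" unfolding c_def using False ub0 by (intro cINF_greatest) auto
    obtain u0 where u0: "u0 \<in> A" using False by blast
    have "ub u0 \<le> 1" using A[OF u0] u0 by (simp add: ub_def A_def)
    then have c1: "c \<le> 1" using c_le[OF u0] by simp
    have "0 \<le> c * f v + (1 - c) * g v" if v: "v \<in> C" for v
    proof -
      consider "v \<in> A" | "v \<notin> A" "g v < 0" | "0 \<le> f v" "0 \<le> g v"
        using v unfolding A_def by fastforce
      then show ?thesis
      proof cases
        case 1
        have "c * (g v - f v) \<le> g v" using c_le[OF 1] A[OF 1] by (simp add: ub_def field_simps)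
        then show ?thesis by (simp add: algebra_simps)
      next
        case 2
        have fv: "0 \<le> f v" using 2 v by (simp add: A_def not_less)
        have "- g v / (f v - g v) \<le> c"
          unfolding c_def
        proof (rule cINF_greatest[OF False])
          fix u assume u: "u \<in> A"
          have "- g v * (g u - f u) \<le> g u * (f v - g v)" using cross[OF u v 2(2)] by (simp add: algebra_simps)
          moreover have "0 < f v - g v" using 2 fv by simp
          ultimately show "- g v / (f v - g v) \<le> ub u"
            unfolding ub_def by (simp only: pos_divide_le_eq times_divide_eq_left pos_le_divide_eq[OF A(2)[OF u]])
        qed
        then have "- g v \<le> c * (f v - g v)" using 2 fv by (simp add: field_simps)
        then show ?thesis by (simp add: algebra_simps)
      next
        case 3
        then show ?thesis using c0 c1 by simp
      qed
    qed
    with c0 c1 show ?thesis by blast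
  qed
qed

text \<open>
  A minimax theorem in the style of Ky Fan for convexlike functions. The induction merges the last two
  functions into one: restricted to the elements on which all others are negative, their maximum is
  nonnegative, so the two-function case supplies the mixing weight.
\<close>

lemma finite_minimax:
  fixes \<phi> :: "nat \<Rightarrow> 'c \<Rightarrow> real"
  assumes "\<And>u v t. u \<in> C \<Longrightarrow> v \<in> C \<Longrightarrow> 0 \<le> t \<Longrightarrow> t \<le> 1 \<Longrightarrow>
      \<exists>w\<in>C. \<forall>l\<le>n. \<phi> l w \<le> t * \<phi> l u + (1 - t) * \<phi> l v"
    and "\<And>v. v \<in> C \<Longrightarrow> \<exists>l\<le>n. 0 \<le> \<phi> l v"
  shows "\<exists>\<mu>. (\<forall>l. 0 \<le> \<mu> l) \<and> (\<Sum>l\<le>n. \<mu> l) = (1::real) \<and> (\<forall>v\<in>C. 0 \<le> (\<Sum>l\<le>n. \<mu> l * \<phi> l v))"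
  using assms
proof (induction n arbitrary: \<phi>)
  case 0
  then show ?case by (intro exI[of _ "\<lambda>l. 1"]) auto
next
  case (Suc n)
  define D where "D = {v \<in> C. \<forall>l<n. \<phi> l v < 0}"
  have "\<exists>c\<ge>0. c \<le> 1 \<and> (\<forall>v\<in>D. 0 \<le> c * \<phi> n v + (1 - c) * \<phi> (Suc n) v)"
  proof (rule two_function_minimax)
    fix u v :: 'c and t :: real assume uv: "u \<in> D" "v \<in> D" and t: "0 \<le> t" "t \<le> 1"
    then obtain w where w: "w \<in> C" "\<And>l. l \<le> Suc n \<Longrightarrow> \<phi> l w \<le> t * \<phi> l u + (1 - t) * \<phi> l v"
      using Suc.prems(1)[of u v t] by (auto simp: D_def)
    have "\<phi> l w < 0" if "l < n" for l
    proof -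
      have "\<phi> l u < 0" "\<phi> l v < 0" using uv that by (auto simp: D_def)
      then have "t * \<phi> l u + (1 - t) * \<phi> l v < 0"
        using t by (cases "t = 0") (auto simp: mult_pos_neg mult_nonneg_nonpos intro!: add_neg_nonpos)
      then show ?thesis using w(2)[of l] that by linarith
    qed
    then have "w \<in> D" using w by (simp add: D_def)
    then show "\<exists>w\<in>D. \<phi> n w \<le> t * \<phi> n u + (1 - t) * \<phi> n v \<and>
        \<phi> (Suc n) w \<le> t * \<phi> (Suc n) u + (1 - t) * \<phi> (Suc n) v" using w(2) by (intro bexI[of _ w]) auto
  next
    fix v assume "v \<in> D"
    then show "0 \<le> \<phi> n v \<or> 0 \<le> \<phi> (Suc n) v"
      using Suc.prems(2)[of v] unfolding D_def by (fastforce simp: le_Suc_eq order_le_less[of _ n] dest: leD)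
  qed
  then obtain c where c: "0 \<le> c" "c \<le> 1" and cD: "\<And>v. v \<in> D \<Longrightarrow> 0 \<le> c * \<phi> n v + (1 - c) * \<phi> (Suc n) v"
    by blast
  define \<psi> where "\<psi> l v = (if l = n then c * \<phi> n v + (1 - c) * \<phi> (Suc n) v else \<phi> l v)" for l v
  have "\<exists>\<mu>. (\<forall>l. 0 \<le> \<mu> l) \<and> (\<Sum>l\<le>n. \<mu> l) = (1::real) \<and> (\<forall>v\<in>C. 0 \<le> (\<Sum>l\<le>n. \<mu> l * \<psi> l v))"
  proof (rule Suc.IH)
    fix u v :: 'c and t :: real assume uv: "u \<in> C" "v \<in> C" and t: "0 \<le> t" "t \<le> 1"
    then obtain w where w: "w \<in> C" "\<And>l. l \<le> Suc n \<Longrightarrow> \<phi> l w \<le> t * \<phi> l u + (1 - t) * \<phi> l v"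
      using Suc.prems(1)[of u v t] by blast
    have "\<psi> l w \<le> t * \<psi> l u + (1 - t) * \<psi> l v" if "l \<le> n" for l
    proof (cases "l = n")
      case True
      have "c * \<phi> n w + (1 - c) * \<phi> (Suc n) w
          \<le> c * (t * \<phi> n u + (1 - t) * \<phi> n v) + (1 - c) * (t * \<phi> (Suc n) u + (1 - t) * \<phi> (Suc n) v)"
        using w(2) c by (intro add_mono mult_left_mono) auto
      then show ?thesis unfolding \<psi>_def using True by (simp add: algebra_simps)
    qed (use w(2)[of l] that in \<open>auto simp: \<psi>_def\<close>)
    then show "\<exists>w\<in>C. \<forall>l\<le>n. \<psi> l w \<le> t * \<psi> l u + (1 - t) * \<psi> l v" using w(1) by blast
  next
    fix v assume v: "v \<in> C"
    show "\<exists>l\<le>n. 0 \<le> \<psi> l v"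
    proof (cases "v \<in> D")
      case True
      then show ?thesis using cD[of v] by (intro exI[of _ n]) (simp add: \<psi>_def)
    next
      case False
      then obtain l where "l < n" "0 \<le> \<phi> l v" using v by (auto simp: D_def not_less)
      then show ?thesis by (intro exI[of _ l]) (simp add: \<psi>_def)
    qed
  qed
  then obtain \<mu> where \<mu>: "\<And>l. 0 \<le> \<mu> l" "(\<Sum>l\<le>n. \<mu> l) = 1" "\<And>v. v \<in> C \<Longrightarrow> 0 \<le> (\<Sum>l\<le>n. \<mu> l * \<psi> l v)"
    by blast
  define \<nu> where "\<nu> l = (if l = n then c * \<mu> n else if l = Suc n then (1 - c) * \<mu> n else \<mu> l)" for l
  have split: "(\<Sum>l\<le>Suc n. h l) = (\<Sum>l<n. h l) + h n + h (Suc n)" for h :: "nat \<Rightarrow> real"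
    by (simp flip: lessThan_Suc_atMost)
  have split': "(\<Sum>l\<le>n. h l) = (\<Sum>l<n. h l) + h n" for h :: "nat \<Rightarrow> real"
    by (simp flip: lessThan_Suc_atMost)
  have "(\<Sum>l\<le>Suc n. \<nu> l) = 1"
    using \<mu>(2) unfolding split split' by (simp add: \<nu>_def algebra_simps)
  moreover have "(\<Sum>l\<le>Suc n. \<nu> l * \<phi> l v) = (\<Sum>l\<le>n. \<mu> l * \<psi> l v)" for v
    unfolding split split' by (simp add: \<nu>_def \<psi>_def algebra_simps)
  moreover have "\<forall>l. 0 \<le> \<nu> l" using c \<mu>(1) by (auto simp: \<nu>_def)
  ultimately show ?case using \<mu>(3) by (intro exI[of _ \<nu>]) auto
qed

section \<open>Making sublinear functionals linear on finite-dimensional subspaces\<close>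

definition sublinear :: "('a::real_vector \<Rightarrow> real) \<Rightarrow> bool" where
  "sublinear q \<longleftrightarrow> (\<forall>x y. q (x + y) \<le> q x + q y) \<and> (\<forall>c x. 0 \<le> c \<longrightarrow> q (c *\<^sub>R x) = c * q x)"

text \<open>
  Oddness at a point says that the functional is linear on the line through it, and it survives when
  the functional is decreased further.
\<close>

lemma sublinear_minorant_odd:
  assumes "sublinear q" "sublinear m" "\<And>x. m x \<le> q x" "q (- a) = - q a"
  shows "m a = q a \<and> m (- a) = - m a"
proof -
  have "m (0 *\<^sub>R a) = 0 * m a" using assms(2) unfolding sublinear_def by blast
  moreover have "m (a + - a) \<le> m a + m (- a)" using assms(2) unfolding sublinear_def by blast
  ultimately have "0 \<le> m a + m (- a)" by simp
  then show ?thesis using assms(3)[of a] assms(3)[of "- a"] assms(4) by linarith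
qed

text \<open>
  One step of the Hahn-Banach extension, performed on the sublinear functional instead of on a linear
  one: the infimum of \<open>q (x + t y) - t q y\<close> over \<open>t \<ge> 0\<close> is the largest sublinear minorant that
  agrees with \<open>q\<close> at \<open>y\<close> and is odd there.
\<close>

lemma sublinear_odd_at:
  fixes q :: "'a::real_vector \<Rightarrow> real"
  assumes q: "sublinear q"
  shows "\<exists>m. sublinear m \<and> (\<forall>x. m x \<le> q x) \<and> m y = q y \<and> m (- y) = - m y"
proof -
  have add: "q (x + z) \<le> q x + q z" and hom: "0 \<le> c \<Longrightarrow> q (c *\<^sub>R x) = c * q x" for x z c
    using q by (auto simp: sublinear_def)
  have q0: "q 0 = 0" using hom[of 0 0] by simp
  define h where "h x t = q (x + t *\<^sub>R y) - t * q y" for x t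
  define m where "m x = (INF t\<in>{0..}. h x t)" for x
  have low: "- q (- x) \<le> h x t" if "0 \<le> t" for x t
    using add[of "x + t *\<^sub>R y" "- x"] hom[OF that, of y] by (simp add: h_def)
  have bdd: "bdd_below (h x ` {0..})" for x using low by (intro bdd_belowI2[of _ "- q (- x)"]) auto
  have m_le: "m x \<le> h x t" if "0 \<le> t" for x t
    unfolding m_def using bdd that by (intro cINF_lower) auto
  have m_ge: "z \<le> m x" if "\<And>t. 0 \<le> t \<Longrightarrow> z \<le> h x t" for x z
    unfolding m_def using that by (intro cINF_greatest) auto
  have madd: "m (x + z) \<le> m x + m z" for x z
  proof -
    have "m (x + z) - m z \<le> m x"
    proof (rule m_ge)
      fix t :: real assume t: "0 \<le> t"
      have "m (x + z) - h x t \<le> m z"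
      proof (rule m_ge)
        fix s :: real assume s: "0 \<le> s"
        have "m (x + z) \<le> h (x + z) (t + s)" using t s by (intro m_le) auto
        also have "\<dots> \<le> h x t + h z s"
          using add[of "x + t *\<^sub>R y" "z + s *\<^sub>R y"] by (simp add: h_def algebra_simps)
        finally show "m (x + z) - h x t \<le> h z s" by simp
      qed
      then show "m (x + z) - m z \<le> h x t" by simp
    qed
    then show ?thesis by simp
  qed
  have hh: "h (c *\<^sub>R x) (c * t) = c * h x t" if "0 \<le> c" for c x t
    using hom[OF that, of "x + t *\<^sub>R y"] by (simp add: h_def algebra_simps)
  have mle: "m (c *\<^sub>R x) \<le> c * m x" if c: "0 < c" for c x
  proof -
    have "m (c *\<^sub>R x) / c \<le> m x"
    proof (rule m_ge)
      fix t :: real assume "0 \<le> t"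
      then have "m (c *\<^sub>R x) \<le> c * h x t" using m_le[of "c * t" "c *\<^sub>R x"] c by (simp add: hh)
      then show "m (c *\<^sub>R x) / c \<le> h x t" using c by (simp add: field_simps)
    qed
    then show ?thesis using c by (simp add: field_simps)
  qed
  have mhom: "m (c *\<^sub>R x) = c * m x" if "0 \<le> c" for c x
  proof (cases "c = 0")
    case True
    have "m 0 \<le> 0" using m_le[of 0 0] by (simp add: h_def q0)
    moreover have "0 \<le> m 0" using hom by (intro m_ge) (simp add: h_def)
    ultimately show ?thesis using True by simp
  next
    case False
    then have c: "0 < c" using that by simp
    have "m ((1/c) *\<^sub>R (c *\<^sub>R x)) \<le> (1/c) * m (c *\<^sub>R x)" using c by (intro mle) simp
    then have "c * m x \<le> m (c *\<^sub>R x)" using c by (simp add: field_simps)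
    with mle[OF c, of x] show ?thesis by simp
  qed
  have sub: "sublinear m" using madd mhom by (simp add: sublinear_def)
  have mq: "m x \<le> q x" for x using m_le[of 0 x] by (simp add: h_def)
  have my: "q y \<le> m y"
  proof (rule m_ge)
    fix t :: real assume "0 \<le> t"
    then have "q ((1 + t) *\<^sub>R y) = (1 + t) * q y" by (intro hom) simp
    then show "q y \<le> h y t" by (simp add: h_def algebra_simps)
  qed
  have "m (- y) \<le> - q y" using m_le[of 1 "- y"] by (simp add: h_def q0)
  moreover have "0 \<le> m y + m (- y)" using madd[of y "- y"] mhom[of 0 0] by simp
  ultimately have "m (- y) = - m y" "m y = q y" using my mq[of y] by linarith+
  with sub mq show ?thesis by blast
qed

lemma sublinear_odd_on_finite:
  fixes q :: "'a::real_vector \<Rightarrow> real"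
  assumes "finite B" "sublinear q"
  shows "\<exists>m. sublinear m \<and> (\<forall>x. m x \<le> q x) \<and> (\<forall>a\<in>B. m (- a) = - m a)"
  using assms
proof (induction B rule: finite_induct)
  case (insert b B)
  then obtain m where m: "sublinear m" "\<And>x. m x \<le> q x" "\<And>a. a \<in> B \<Longrightarrow> m (- a) = - m a" by blast
  obtain k where k: "sublinear k" "\<And>x. k x \<le> m x" "k (- b) = - k b"
    using sublinear_odd_at[OF m(1), of b] by blast
  have "k (- a) = - k a" if "a \<in> insert b B" for a
    using that k(3) m(3) sublinear_minorant_odd[OF m(1) k(1) k(2)] by blast
  moreover have "k x \<le> q x" for x using k(2) m(2) order_trans by blast
  ultimately show ?case using k(1) by blast
qed auto

lemma sublinear_odd_sum:
  fixes m :: "'a::real_vector \<Rightarrow> real"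
  assumes "sublinear m" "finite B" "\<forall>a\<in>B. m (- a) = - m a"
  shows "m (\<Sum>a\<in>B. t a *\<^sub>R a) = (\<Sum>a\<in>B. t a * m a)"
  using assms(2,3)
proof (induction B rule: finite_induct)
  have add: "m (x + z) \<le> m x + m z" and hom: "0 \<le> c \<Longrightarrow> m (c *\<^sub>R x) = c * m x" for x z c
    using assms(1) by (auto simp: sublinear_def)
  {
    case empty
    show ?case using hom[of 0 0] by simp
  next
    case (insert b B)
    have hb: "m (s *\<^sub>R b) = s * m b" for s
    proof (cases "0 \<le> s")
      case False
      then have "m ((- s) *\<^sub>R (- b)) = (- s) * m (- b)" by (intro hom) simp
      then show ?thesis using insert.prems by simp
    qed (rule hom)
    define x where "x = (\<Sum>a\<in>B. t a *\<^sub>R a)"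
    have "m (x + t b *\<^sub>R b) \<le> m x + t b * m b" using add[of x "t b *\<^sub>R b"] hb by simp
    moreover have "m x \<le> m (x + t b *\<^sub>R b) - t b * m b"
      using add[of "x + t b *\<^sub>R b" "(- t b) *\<^sub>R b"] hb[of "- t b"] by simp
    ultimately have "m (x + t b *\<^sub>R b) = m x + t b * m b" by linarith
    then show ?case using insert by (simp add: x_def add.commute)
  }
qed

section \<open>Convex combinations of pointwise null sequences\<close>

text \<open>
  Tychonoff's theorem for countably many compact intervals, in sequential form.
\<close>

lemma bounded_pointwise_subseq:
  fixes u :: "nat \<Rightarrow> nat \<Rightarrow> real"
  assumes "\<And>k i. \<bar>u k i\<bar> \<le> M i"
  shows "\<exists>r l. strict_mono r \<and> (\<forall>i. (\<lambda>k. u (r k) i) \<longlonglongrightarrow> l i)"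
proof -
  have "compactin (product_topology (\<lambda>i. euclidean) UNIV) (PiE UNIV (\<lambda>i. {- M i..M i}))"
    by (subst compactin_PiE) (simp add: compact_Icc)
  then have "compact (PiE UNIV (\<lambda>i. {- M i..M i}))"
    by (metis compactin_euclidean_iff euclidean_product_topology)
  moreover have "u k \<in> PiE UNIV (\<lambda>i. {- M i..M i})" for k
    using assms[of k] by (auto simp: abs_le_iff PiE_iff) (metis minus_le_iff)
  ultimately obtain l r where r: "strict_mono r" "(u \<circ> r) \<longlonglongrightarrow> l"
    by (metis compact_imp_seq_compact seq_compactE)
  have "(\<lambda>k. u (r k) i) \<longlonglongrightarrow> l i" for i
  proof -
    have "continuous_on UNIV (\<lambda>f :: nat \<Rightarrow> real. f i)" by (rule continuous_on_product_coordinates)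
    then have "isCont (\<lambda>f :: nat \<Rightarrow> real. f i) l" by (meson UNIV_I continuous_on_eq_continuous_at open_UNIV)
    from isCont_tendsto_compose[OF this r(2)] show ?thesis by (simp add: o_def)
  qed
  with r(1) show ?thesis by blast
qed

text \<open>
  The convex hull of the functions \<open>w m, w (m + 1), \<dots>\<close>.
\<close>

definition tail_hull :: "(nat \<Rightarrow> 'a \<Rightarrow> real) \<Rightarrow> nat \<Rightarrow> ('a \<Rightarrow> real) set" where
  "tail_hull w m = {g. \<exists>c N. (\<forall>i. 0 \<le> c i) \<and> (\<Sum>i\<in>{m..<N}. c i) = 1 \<and> g = (\<lambda>x. \<Sum>i\<in>{m..<N}. c i * w i x)}"

lemma tail_hull_midpoint:
  assumes "g \<in> tail_hull w m" "g' \<in> tail_hull w m'" "m \<le> m'"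
  shows "(\<lambda>x. (g x + g' x) / 2) \<in> tail_hull w m"
proof -
  obtain c N where c: "\<And>i. 0 \<le> c i" "(\<Sum>i\<in>{m..<N}. c i) = 1" "g = (\<lambda>x. \<Sum>i\<in>{m..<N}. c i * w i x)"
    using assms(1) by (auto simp: tail_hull_def)
  obtain c' N' where c': "\<And>i. 0 \<le> c' i" "(\<Sum>i\<in>{m'..<N'}. c' i) = 1" "g' = (\<lambda>x. \<Sum>i\<in>{m'..<N'}. c' i * w i x)"
    using assms(2) by (auto simp: tail_hull_def)
  define L where "L = max N N'"
  define d where "d i = (if i < N then c i else 0)" for i
  define d' where "d' i = (if m' \<le> i \<and> i < N' then c' i else 0)" for i
  have d: "(\<Sum>i\<in>{m..<L}. d i * h i) = (\<Sum>i\<in>{m..<N}. c i * h i)" for h :: "nat \<Rightarrow> real"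
    by (rule sum.mono_neutral_cong_right) (auto simp: d_def L_def)
  have d': "(\<Sum>i\<in>{m..<L}. d' i * h i) = (\<Sum>i\<in>{m'..<N'}. c' i * h i)" for h :: "nat \<Rightarrow> real"
    by (rule sum.mono_neutral_cong_right) (use assms(3) in \<open>auto simp: d'_def L_def\<close>)
  have e: "(\<Sum>i\<in>{m..<L}. (d i + d' i) / 2 * h i)
      = ((\<Sum>i\<in>{m..<N}. c i * h i) + (\<Sum>i\<in>{m'..<N'}. c' i * h i)) / 2" for h :: "nat \<Rightarrow> real"
    unfolding d[symmetric] d'[symmetric]
    by (simp add: add_divide_distrib sum_divide_distrib distrib_right sum.distrib)
  show ?thesis
    unfolding tail_hull_def
  proof (intro CollectI exI[of _ "\<lambda>i. (d i + d' i) / 2"] exI[of _ L] conjI allI)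
    show "0 \<le> (d i + d' i) / 2" for i using c c' by (simp add: d_def d'_def)
    show "(\<Sum>i = m..<L. (d i + d' i) / 2) = 1" using e[of "\<lambda>_. 1"] c c' by simp
    show "(\<lambda>x. (g x + g' x) / 2) = (\<lambda>x. \<Sum>i = m..<L. (d i + d' i) / 2 * w i x)"
      unfolding e c(3) c'(3) ..
  qed
qed

lemma tail_hull_const_bound:
  assumes "g \<in> tail_hull w m" "\<And>i. m \<le> i \<Longrightarrow> l \<le> w i x" "\<And>i. m \<le> i \<Longrightarrow> w i x \<le> u"
  shows "l \<le> g x \<and> g x \<le> u"
proof -
  obtain c N where c: "\<And>i. 0 \<le> c i" "(\<Sum>i\<in>{m..<N}. c i) = 1" "g = (\<lambda>x. \<Sum>i\<in>{m..<N}. c i * w i x)"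
    using assms(1) by (auto simp: tail_hull_def)
  have "(\<Sum>i\<in>{m..<N}. c i * l) \<le> g x" "g x \<le> (\<Sum>i\<in>{m..<N}. c i * u)"
    unfolding c(3) using assms c(1) by (auto intro!: sum_mono mult_left_mono)
  then show ?thesis using c(2) by (simp flip: sum_distrib_right)
qed

lemma tail_hull_tendsto:
  assumes "g \<in> tail_hull w m" "\<And>i. (\<lambda>k. w i (u k)) \<longlonglongrightarrow> w i t"
  shows "(\<lambda>k. g (u k)) \<longlonglongrightarrow> g t"
  using assms by (auto simp: tail_hull_def intro!: tendsto_sum tendsto_mult_left)

text \<open>
  A case of Mazur's theorem, namely that a bounded sequence of continuous functions on a compact space
  that tends to \<open>0\<close> pointwise has convex combinations that tend to \<open>0\<close> uniformly, proved by the argument of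
  Simons' inequality so that no measures are needed. Compactness is only assumed for the functions at hand.
  
  Suppose that every convex combination of the tail exceeds \<open>\<delta>\<close> somewhere. Functions \<open>g k\<close> in the hulls of the
  tails are chosen one after the other such that, for \<open>H k = g 0 / 2 + \<dots> + g (k - 1) / 2 ^ k\<close>, the
  supremum of \<open>H k + g k / 2 ^ k\<close> is almost minimal. The sum \<open>F\<close> of the whole series attains its supremum
  at some \<open>t\<close>. Minimality prevents \<open>H k t\<close> from approaching \<open>F t\<close> faster than \<open>2 ^ - k\<close> times a
  constant, so the averages of the \<open>g k\<close> at \<open>t\<close> stay away from \<open>0\<close>, and so do values \<open>w i t\<close> with large \<open>i\<close>.
\<close>

lemma pointwise_null_imp_small_convex:
  fixes w :: "nat \<Rightarrow> 'a \<Rightarrow> real"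
  assumes ne: "K \<noteq> {}"
    and w01: "\<And>i x. x \<in> K \<Longrightarrow> 0 \<le> w i x" "\<And>i x. x \<in> K \<Longrightarrow> w i x \<le> 1"
    and null: "\<And>x. x \<in> K \<Longrightarrow> (\<lambda>i. w i x) \<longlonglongrightarrow> 0"
    and cpt: "\<And>u. (\<And>k. u k \<in> K) \<Longrightarrow> \<exists>r t. strict_mono r \<and> t \<in> K \<and> (\<forall>i. (\<lambda>k. w i (u (r k :: nat))) \<longlonglongrightarrow> w i t)"
    and \<delta>: "0 < \<delta>"
  shows "\<exists>g\<in>tail_hull w n. \<forall>x\<in>K. g x \<le> \<delta>"
proof (rule ccontr)
  assume "\<not> ?thesis"
  then have big: "\<exists>x\<in>K. \<delta> < g x" if "g \<in> tail_hull w n" for g using that by (meson not_le)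
  have g01: "0 \<le> g x \<and> g x \<le> 1" if "g \<in> tail_hull w m" "x \<in> K" for g m x
    using tail_hull_const_bound[OF that(1), of 0 x 1] w01 that(2) by auto
  define S where "S f = (SUP x\<in>K. f x)" for f :: "'a \<Rightarrow> real"
  have S_le: "S f \<le> b" if "\<And>x. x \<in> K \<Longrightarrow> f x \<le> b" for f b
    unfolding S_def using ne that by (intro cSUP_least)
  have S_ge: "f x \<le> S f" if "x \<in> K" "\<And>x. x \<in> K \<Longrightarrow> f x \<le> b" for f x and b :: real
    unfolding S_def using that by (intro cSUP_upper bdd_aboveI2[of _ _ b]) auto
  \<comment> \<open>The tolerance must beat the factor \<open>2 ^ k\<close> in the final estimate, where the errors sum to at most \<open>\<delta> / 4\<close>.\<close>
  define \<epsilon> where "\<epsilon> k = \<delta> / 16 * (1/4) ^ k" for k :: nat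
  have \<epsilon>: "0 < \<epsilon> k" for k using \<delta> by (simp add: \<epsilon>_def)
  have step: "\<exists>g. g \<in> tail_hull w (n + k) \<and>
      (\<forall>g'\<in>tail_hull w (n + k). S (\<lambda>x. h x + (1/2)^k * g x) \<le> S (\<lambda>x. h x + (1/2)^k * g' x) + \<epsilon> k)"
    if h: "\<And>x. x \<in> K \<Longrightarrow> 0 \<le> h x" "\<And>x. x \<in> K \<Longrightarrow> h x \<le> 1" for h k
  proof -
    let ?f = "\<lambda>g. S (\<lambda>x. h x + (1/2)^k * g x)"
    obtain x0 where x0: "x0 \<in> K" using ne by blast
    have nonneg: "0 \<le> ?f g" if "g \<in> tail_hull w (n + k)" for g
    proof -
      have "0 \<le> h x0 + (1/2)^k * g x0" using h g01[OF that x0] x0 by simp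
      also have "\<dots> \<le> ?f g"
      proof (rule S_ge[OF x0, of _ 2])
        fix x assume x: "x \<in> K"
        have "(1/2)^k * g x \<le> 1"
          using g01[OF that x] by (intro mult_le_one power_le_one) auto
        then show "h x + (1/2)^k * g x \<le> 2" using h(2)[OF x] by simp
      qed
      finally show ?thesis .
    qed
    have "w (n + k) \<in> tail_hull w (n + k)"
      unfolding tail_hull_def by (intro CollectI exI[of _ "\<lambda>i. 1"] exI[of _ "Suc (n + k)"]) auto
    then have neT: "tail_hull w (n + k) \<noteq> {}" by blast
    have bdd: "bdd_below (?f ` tail_hull w (n + k))" using nonneg by (intro bdd_belowI2[of _ 0])
    have "Inf (?f ` tail_hull w (n + k)) < Inf (?f ` tail_hull w (n + k)) + \<epsilon> k" using \<epsilon> by simp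
    from cInf_lessD[OF _ this] neT obtain g where g: "g \<in> tail_hull w (n + k)"
      "?f g < Inf (?f ` tail_hull w (n + k)) + \<epsilon> k" by auto
    have "Inf (?f ` tail_hull w (n + k)) \<le> ?f g'" if "g' \<in> tail_hull w (n + k)" for g'
      using bdd that by (intro cINF_lower)
    with g show ?thesis by (intro exI[of _ g]) fastforce
  qed
  define good where "good h k g \<longleftrightarrow> g \<in> tail_hull w (n + k) \<and>
      (\<forall>g'\<in>tail_hull w (n + k). S (\<lambda>x. h x + (1/2)^k * g x) \<le> S (\<lambda>x. h x + (1/2)^k * g' x) + \<epsilon> k)" for h k g
  define pick where "pick h k = (SOME g. good h k g)" for h k
  define H where "H = rec_nat (\<lambda>_. 0) (\<lambda>k h x. h x + (1/2)^Suc k * pick h k x)"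
  define g where "g k = pick (H k) k" for k
  have H0: "H 0 = (\<lambda>_. 0)" and HS: "\<And>k x. H (Suc k) x = H k x + (1/2)^Suc k * g k x"
    by (auto simp: H_def g_def)
  have inv: "(\<forall>x\<in>K. 0 \<le> H k x \<and> H k x \<le> 1 - (1/2)^k) \<and> good (H k) k (g k)" for k
  proof (induction k)
    case 0
    have "\<exists>g. good (H 0) 0 g" unfolding good_def by (rule step) (auto simp: H0)
    then have "good (H 0) 0 (g 0)" unfolding g_def pick_def by (rule someI_ex)
    then show ?case by (simp add: H0)
  next
    case (Suc k)
    have b: "0 \<le> H (Suc k) x \<and> H (Suc k) x \<le> 1 - (1/2)^Suc k" if x: "x \<in> K" for x
    proof -
      have gx: "0 \<le> g k x" "g k x \<le> 1" using Suc g01[OF _ x] by (auto simp: good_def)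
      have "(1/2)^Suc k * g k x \<le> (1/2)^Suc k" using gx by (simp add: mult_left_le)
      moreover have "0 \<le> (1/2)^Suc k * g k x" using gx by simp
      moreover have "(1::real) - (1/2)^k + (1/2)^Suc k = 1 - (1/2)^Suc k" by simp
      moreover have "0 \<le> H k x" "H k x \<le> 1 - (1/2)^k" using Suc x by auto
      ultimately show ?thesis unfolding HS by linarith
    qed
    have le1: "H (Suc k) x \<le> 1" if "x \<in> K" for x
      using b[OF that] zero_le_power[of "1/2::real" "Suc k"] by linarith
    have "\<exists>g. good (H (Suc k)) (Suc k) g" unfolding good_def by (rule step) (use b le1 in auto)
    then have "good (H (Suc k)) (Suc k) (g (Suc k))" unfolding g_def pick_def by (rule someI_ex)
    with b show ?case by blast
  qed
  have gk: "g k \<in> tail_hull w (n + k)" for k using inv by (auto simp: good_def)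
  have Hb: "0 \<le> H k x" "H k x \<le> 1 - (1/2)^k" if "x \<in> K" for k x using inv that by auto
  have gb: "0 \<le> g k x" "g k x \<le> 1" if "x \<in> K" for k x using g01[OF gk that] by auto
  define e where "e k x = H k x + (1/2)^k * g k x" for k x
  have e1: "e k x \<le> 1" if "x \<in> K" for k x
  proof -
    have "(1/2)^k * g k x \<le> (1/2)^k" using gb[OF that] by (simp add: mult_left_le)
    then show ?thesis using Hb(2)[OF that, of k] unfolding e_def by linarith
  qed
  \<comment> \<open>The function \<open>e (k + 1)\<close> competes with \<open>e k\<close> in the minimisation, since it uses the midpoint of \<open>g k\<close> and \<open>g (k + 1)\<close>.\<close>
  have eS: "S (e k) \<le> S (e (Suc k)) + \<epsilon> k" for k
  proof -
    have "(\<lambda>x. (g k x + g (Suc k) x) / 2) \<in> tail_hull w (n + k)"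
      using tail_hull_midpoint[OF gk gk, of k "Suc k"] by simp
    then have "S (e k) \<le> S (\<lambda>x. H k x + (1/2)^k * ((g k x + g (Suc k) x) / 2)) + \<epsilon> k"
      using inv[of k] unfolding good_def e_def by (elim conjE bspec)
    also have "(\<lambda>x. H k x + (1/2)^k * ((g k x + g (Suc k) x) / 2)) = e (Suc k)"
      unfolding e_def HS by (auto simp: field_simps)
    finally show ?thesis .
  qed
  have eS2: "S (e k) \<le> S (e (k + j)) + 2 * \<epsilon> k" for k j
  proof -
    have "S (e k) \<le> S (e (k + j)) + (2 - 2 * (1/4)^j) * \<epsilon> k"
    proof (induction j)
      case (Suc j)
      have "\<epsilon> (k + j) = (1/4)^j * \<epsilon> k" by (simp add: \<epsilon>_def power_add)
      then have "S (e k) \<le> S (e (Suc (k + j))) + (1/4)^j * \<epsilon> k + (2 - 2 * (1/4)^j) * \<epsilon> k"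
        using eS[of "k + j"] Suc by linarith
      also have "\<dots> \<le> S (e (Suc (k + j))) + (2 - 2 * (1/4)^Suc j) * \<epsilon> k"
        using \<epsilon>[of k] by (simp add: algebra_simps)
      finally show ?case by simp
    qed (use \<epsilon>[of k] in auto)
    also have "(2 - 2 * (1/4)^j) * \<epsilon> k \<le> 2 * \<epsilon> k" using \<epsilon>[of k] by (intro mult_right_mono) auto
    finally show ?thesis by simp
  qed
  have Hmono: "H j x \<le> H k x" if "x \<in> K" "j \<le> k" for j k x
    by (rule lift_Suc_mono_le[of "\<lambda>k. H k x", OF _ that(2)]) (use gb[OF that(1)] in \<open>simp add: HS\<close>)
  have Hanti: "H k x + c * (1/2)^k \<le> H j x + c * (1/2)^j"
    if "j \<le> k" "\<And>i. j \<le> i \<Longrightarrow> g i x \<le> c" for j k x c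
    using \<open>j \<le> k\<close>
  proof (induction k rule: dec_induct)
    case (step k)
    have "H (Suc k) x + c * (1/2)^Suc k = H k x + (1/2)^Suc k * (g k x + c)" by (simp add: HS algebra_simps)
    also have "\<dots> \<le> H k x + (1/2)^Suc k * (c + c)"
      using that(2)[of k] step by (intro add_left_mono mult_left_mono add_mono) auto
    also have "\<dots> = H k x + c * (1/2)^k" by simp
    finally show ?case using step by linarith
  qed simp
  define F where "F x = (SUP k. H k x)" for x
  have Hbd: "bdd_above (range (\<lambda>k. H k x))" if "x \<in> K" for x
    using Hb(2)[OF that] by (intro bdd_aboveI2[of _ _ 1]) (metis diff_ge_0_iff_ge diff_left_mono diff_zero order_trans zero_le_power half_gt_zero_iff less_imp_le zero_less_one)
  have HF: "H k x \<le> F x" if "x \<in> K" for k x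
    unfolding F_def using Hbd[OF that] by (intro cSUP_upper) auto
  have FH: "F x \<le> H j x + c * (1/2)^j" if "x \<in> K" "\<And>i. j \<le> i \<Longrightarrow> g i x \<le> c" "0 \<le> c" for j x c
    unfolding F_def
  proof (rule cSUP_least)
    fix k
    have "0 \<le> c * (1/2)^max j k" using that by simp
    moreover have "H (max j k) x + c * (1/2)^max j k \<le> H j x + c * (1/2)^j"
      by (rule Hanti[OF _ that(2)]) simp_all
    moreover have "H k x \<le> H (max j k) x" by (rule Hmono[OF that(1)]) simp
    ultimately show "H k x \<le> H j x + c * (1/2)^j" by linarith
  qed simp
  have FH1: "F x \<le> H j x + (1/2)^j" if "x \<in> K" for j x
    using FH[of x j 1] gb[OF that] that by simp
  have F1: "F x \<le> 1" if "x \<in> K" for x using FH1[OF that, of 0] by (simp add: H0)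
  have FS: "F x \<le> S F" if "x \<in> K" for x by (rule S_ge[OF that]) (rule F1)
  have eS': "e k x \<le> S (e k)" if "x \<in> K" for k x by (rule S_ge[OF that]) (rule e1)
  have eF: "S (e k) \<le> S F + 2 * \<epsilon> k" for k
  proof (rule field_le_epsilon)
    fix \<eta> :: real assume "0 < \<eta>"
    then obtain j where j: "(1/2)^j < \<eta>" using real_arch_pow_inv[of \<eta> "1/2"] by auto
    have "S (e (k + j)) \<le> S F + (1/2)^(k + j)"
    proof (rule S_le)
      fix x assume x: "x \<in> K"
      have "(1/2)^(k + j) * g (k + j) x \<le> (1/2)^(k + j)" using gb[OF x] by (simp add: mult_left_le)
      then show "e (k + j) x \<le> S F + (1/2)^(k + j)"
        using HF[OF x, of "k + j"] FS[OF x] unfolding e_def by linarith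
    qed
    also have "(1/2)^(k + j) \<le> (1/2::real)^j" by (rule power_decreasing) auto
    finally show "S (e k) \<le> S F + 2 * \<epsilon> k + \<eta>" using eS2[of k j] j by linarith
  qed
  obtain t where t: "t \<in> K" "S F \<le> F t"
  proof -
    have "\<exists>x\<in>K. S F - (1/2)^k < F x" for k :: nat
    proof (rule ccontr)
      assume "\<not> ?thesis"
      then have "S F \<le> S F - (1/2)^k" by (intro S_le) (auto simp: not_less)
      moreover have "(0::real) < (1/2)^k" by simp
      ultimately show False by linarith
    qed
    then obtain u where u: "\<And>k. u k \<in> K" "\<And>k. S F - (1/2)^k < F (u k)" by metis
    obtain r t where r: "strict_mono r" "t \<in> K" "\<And>i. (\<lambda>k. w i (u (r k))) \<longlonglongrightarrow> w i t"
      using cpt[of u, OF u(1)] by blast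
    have Hlim: "(\<lambda>k. H j (u (r k))) \<longlonglongrightarrow> H j t" for j
    proof (induction j)
      case (Suc j)
      show ?case unfolding HS
        by (intro tendsto_add tendsto_mult_left Suc tail_hull_tendsto[OF gk r(3)])
    qed (simp add: H0)
    have "S F \<le> F t + (1/2)^j" for j
    proof -
      have "(\<lambda>k. S F - (1/2)^r k) \<longlonglongrightarrow> S F - 0"
        using LIMSEQ_subseq_LIMSEQ[OF LIMSEQ_power_zero[of "1/2::real"] r(1)]
        by (intro tendsto_diff tendsto_const) (simp add: o_def)
      moreover have "S F - (1/2)^r k \<le> H j (u (r k)) + (1/2)^j" for k
        using u(2)[of "r k"] FH1[OF u(1), of "r k" j] by linarith
      moreover have "(\<lambda>k. H j (u (r k)) + (1/2)^j) \<longlonglongrightarrow> H j t + (1/2)^j"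
        by (intro tendsto_add Hlim tendsto_const)
      ultimately have "S F - 0 \<le> H j t + (1/2)^j" by (intro LIMSEQ_le) auto
      then show ?thesis using HF[OF r(2), of j] by simp
    qed
    moreover have "(\<lambda>j. F t + (1/2)^j) \<longlonglongrightarrow> F t + 0"
      by (intro tendsto_add tendsto_const LIMSEQ_power_zero) simp
    ultimately have "S F \<le> F t + 0" by (intro LIMSEQ_le_const) auto
    with r(2) show thesis by (intro that) auto
  qed
  have SF: "\<delta> / 2 \<le> S F"
  proof -
    obtain x where x: "x \<in> K" "\<delta> < g 0 x" using big[of "g 0"] gk[of 0] by auto
    then have "\<delta> / 2 \<le> H 1 x" by (simp add: HS[of 0, simplified] H0)
    then show ?thesis using HF[OF x(1), of 1] FS[OF x(1)] by linarith
  qed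
  \<comment> \<open>From \<open>e k = 2 H (k + 1) - H k\<close> the remainder \<open>F - H k\<close> at \<open>t\<close> at most halves in each step, up to an error \<open>\<epsilon> k\<close>.\<close>
  have low: "\<delta> / 4 + \<delta> / 4 * (1/2)^k \<le> 2^k * (F t - H k t)" for k
  proof (induction k)
    case 0
    show ?case using SF t(2) by (simp add: H0)
  next
    case (Suc k)
    have "e k t \<le> F t + 2 * \<epsilon> k"
      using eS'[OF t(1), of k] eF[of k] t(2) by linarith
    then have "F t - H k t - 2 * \<epsilon> k \<le> 2 * (F t - H (Suc k) t)"
      by (simp add: e_def HS field_simps)
    then have "2^k * (F t - H k t - 2 * \<epsilon> k) \<le> 2^k * (2 * (F t - H (Suc k) t))"
      by (intro mult_left_mono) auto
    then have "2^k * (F t - H k t) - 2^k * (2 * \<epsilon> k) \<le> 2^Suc k * (F t - H (Suc k) t)"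
      by (simp add: algebra_simps)
    moreover have "2^k * (2 * \<epsilon> k) = \<delta> / 8 * (1/2)^k"
    proof -
      have "2^k * (1/4::real)^k = (1/2)^k" by (simp flip: power_mult_distrib)
      then show ?thesis by (simp add: \<epsilon>_def)
    qed
    ultimately show ?case using Suc by simp
  qed
  have "eventually (\<lambda>i. w i t < \<delta> / 8) sequentially"
    using null[OF t(1)] \<delta> by (intro order_tendstoD) auto
  then obtain I where I: "\<And>i. I \<le> i \<Longrightarrow> w i t < \<delta> / 8" by (auto simp: eventually_sequentially)
  have "g i t \<le> \<delta> / 8" if "I \<le> i" for i
  proof (rule conjunct2[OF tail_hull_const_bound[OF gk]])
    show "0 \<le> w j t" for j by (rule w01(1)[OF t(1)])
    show "w j t \<le> \<delta> / 8" if "n + i \<le> j" for j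
      using I[of j] that \<open>I \<le> i\<close> by simp
  qed
  then have "F t \<le> H I t + \<delta> / 8 * (1/2)^I" using \<delta> by (intro FH[OF t(1)]) auto
  then have "2^I * (F t - H I t) \<le> 2^I * (\<delta> / 8 * (1/2)^I)" by (intro mult_left_mono) auto
  also have "\<dots> = \<delta> / 8" by (simp add: power_divide)
  finally have "2^I * (F t - H I t) \<le> \<delta> / 8" .
  moreover have "0 < \<delta> / 4 * (1/2)^I" using \<delta> by simp
  ultimately show False using low[of I] \<delta> by linarith
qed


text \<open>
  Adding up convex combinations of the \<open>n\<close>-th tail that are uniformly at most \<open>2 ^ - n\<close>, each contributes
  \<open>1\<close> to the total weight but only \<open>2 ^ - n\<close> to the weighted sum.
\<close>

lemma pointwise_null_imp_weights:
  fixes w :: "nat \<Rightarrow> 'a \<Rightarrow> real"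
  assumes ne: "K \<noteq> {}"
    and w01: "\<And>i x. x \<in> K \<Longrightarrow> 0 \<le> w i x" "\<And>i x. x \<in> K \<Longrightarrow> w i x \<le> 1"
    and null: "\<And>x. x \<in> K \<Longrightarrow> (\<lambda>i. w i x) \<longlonglongrightarrow> 0"
    and cpt: "\<And>u. (\<And>k. u k \<in> K) \<Longrightarrow> \<exists>r t. strict_mono r \<and> t \<in> K \<and> (\<forall>i. (\<lambda>k. w i (u (r k :: nat))) \<longlonglongrightarrow> w i t)"
  shows "\<exists>\<alpha>. (\<forall>i. 0 \<le> \<alpha> i) \<and> \<not> summable \<alpha> \<and> (\<forall>x\<in>K. summable (\<lambda>i. \<alpha> i * w i x))"
proof -
  have "\<exists>g\<in>tail_hull w n. \<forall>x\<in>K. g x \<le> (1/2)^n" for n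
    by (rule pointwise_null_imp_small_convex[OF assms]) auto
  then have "\<exists>c N. (\<forall>i. 0 \<le> c i) \<and> (\<Sum>i\<in>{n..<N}. c i) = 1 \<and>
      (\<forall>x\<in>K. (\<Sum>i\<in>{n..<N}. c i * w i x) \<le> (1/2)^n)" for n
    unfolding tail_hull_def by blast
  then obtain c N where c: "\<And>n i. 0 \<le> c n i" "\<And>n. (\<Sum>i\<in>{n..<N n}. c n i) = 1"
    and cw: "\<And>n x. x \<in> K \<Longrightarrow> (\<Sum>i\<in>{n..<N n}. c n i * w i x) \<le> (1/2)^n" by metis
  define d where "d n i = (if n \<le> i \<and> i < N n then c n i else 0)" for n i
  have d0: "0 \<le> d n i" for n i using c(1) by (simp add: d_def)
  have dsum: "(\<Sum>i<L. d n i * h i) = (\<Sum>i\<in>{n..<min L (N n)}. c n i * h i)" for n L and h :: "nat \<Rightarrow> real"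
    by (rule sum.mono_neutral_cong_right) (auto simp: d_def)
  define \<alpha> where "\<alpha> i = (\<Sum>n\<le>i. d n i)" for i
  have \<alpha>: "\<alpha> i = (\<Sum>n<L. d n i)" if "i < L" for i L
    unfolding \<alpha>_def by (rule sum.mono_neutral_left) (use that in \<open>auto simp: d_def\<close>)
  have \<alpha>sum: "(\<Sum>i<L. \<alpha> i * h i) = (\<Sum>n<L. \<Sum>i\<in>{n..<min L (N n)}. c n i * h i)" for L and h :: "nat \<Rightarrow> real"
  proof -
    have "(\<Sum>i<L. \<alpha> i * h i) = (\<Sum>i<L. \<Sum>n<L. d n i * h i)"
      by (rule sum.cong) (auto simp: \<alpha>[of _ L] sum_distrib_right)
    also have "\<dots> = (\<Sum>n<L. \<Sum>i<L. d n i * h i)" by (rule sum.swap)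
    finally show ?thesis by (simp add: dsum)
  qed
  have \<alpha>0: "0 \<le> \<alpha> i" for i unfolding \<alpha>_def using d0 by (intro sum_nonneg) auto
  have "\<not> summable \<alpha>"
  proof
    assume s: "summable \<alpha>"
    obtain J :: nat where J: "suminf \<alpha> < real J" using reals_Archimedean2 by blast
    define L where "L = J + (\<Sum>n<J. N n)"
    have L: "min L (N n) = N n" if "n < J" for n
      using member_le_sum[of n "{..<J}" N] that by (simp add: L_def)
    have "real J = (\<Sum>n<J. \<Sum>i\<in>{n..<min L (N n)}. c n i * 1)" using L c(2) by simp
    also have "\<dots> \<le> (\<Sum>n<L. \<Sum>i\<in>{n..<min L (N n)}. c n i * 1)"
      using c(1) by (intro sum_mono2) (auto simp: L_def intro!: sum_nonneg)
    also have "\<dots> = (\<Sum>i<L. \<alpha> i)" using \<alpha>sum[of "\<lambda>_. 1" L] by simp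
    also have "\<dots> \<le> suminf \<alpha>" using s \<alpha>0 by (intro sum_le_suminf) auto
    finally show False using J by simp
  qed
  moreover have "summable (\<lambda>i. \<alpha> i * w i x)" if x: "x \<in> K" for x
  proof (rule summableI_nonneg_bounded[where x=2])
    fix L
    have "(\<Sum>i<L. \<alpha> i * w i x) \<le> (\<Sum>n<L. \<Sum>i\<in>{n..<N n}. c n i * w i x)"
      unfolding \<alpha>sum using c(1) w01(1)[OF x] by (intro sum_mono sum_mono2) auto
    also have "\<dots> \<le> (\<Sum>n<L. (1/2)^n)" using cw[OF x] by (intro sum_mono)
    also have "\<dots> = 2 - 2 * (1/2)^L" by (induction L) auto
    also have "\<dots> \<le> 2" by simp
    finally show "(\<Sum>i<L. \<alpha> i * w i x) \<le> 2" .
  qed (use \<alpha>0 w01(1)[OF x] in auto)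
  ultimately show ?thesis using \<alpha>0 by blast
qed

section \<open>Power inequalities, sign averages and uniform boundedness\<close>

lemma powr_convex_comb:
  fixes a b t p :: real
  assumes "1 \<le> p" "0 \<le> a" "0 \<le> b" "0 \<le> t" "t \<le> 1"
  shows "(t * a + (1 - t) * b) powr p \<le> t * a powr p + (1 - t) * b powr p"
proof -
  have z: "(s * c) powr p \<le> s * c powr p" if "0 \<le> s" "s \<le> 1" "0 \<le> c" for s c :: real
  proof -
    have "s powr p \<le> s powr 1" if "0 < s" using assms(1) that \<open>s \<le> 1\<close> by (intro powr_mono') auto
    then have "s powr p \<le> s" using that(1) by (cases "s = 0") auto
    then show ?thesis using that by (simp add: powr_mult mult_right_mono)
  qed
  consider "a = 0" | "b = 0" | "0 < a" "0 < b" using assms by linarith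
  then show ?thesis
  proof cases
    case 3
    then show ?thesis
      using convex_onD[OF powr_convex[OF assms(1)], of "1 - t" a b] assms by (simp add: algebra_simps)
  qed (use z[of "1 - t" b] z[of t a] assms in auto)
qed

lemma powr_add_le:
  fixes a b p :: real
  assumes "1 \<le> p"
  shows "\<bar>a + b\<bar> powr p \<le> 2 powr (p - 1) * (\<bar>a\<bar> powr p + \<bar>b\<bar> powr p)"
proof -
  have "\<bar>a + b\<bar> powr p \<le> (2 * (1/2 * \<bar>a\<bar> + (1 - 1/2) * \<bar>b\<bar>)) powr p"
    using assms by (intro powr_mono2) auto
  also have "\<dots> = 2 powr p * (1/2 * \<bar>a\<bar> + (1 - 1/2) * \<bar>b\<bar>) powr p" by (subst powr_mult) auto
  also have "\<dots> \<le> 2 powr p * (1/2 * \<bar>a\<bar> powr p + (1 - 1/2) * \<bar>b\<bar> powr p)"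
    using assms by (intro mult_left_mono powr_convex_comb) auto
  also have "\<dots> = 2 powr (p - 1) * (\<bar>a\<bar> powr p + \<bar>b\<bar> powr p)" by (simp add: powr_diff field_simps)
  finally show ?thesis .
qed

lemma powr_sum_opposite:
  fixes a b p :: real
  assumes "1 \<le> p"
  shows "2 * \<bar>b\<bar> powr p \<le> \<bar>a + b\<bar> powr p + \<bar>a - b\<bar> powr p"
proof -
  have "\<bar>b\<bar> powr p \<le> (1/2 * \<bar>a + b\<bar> + (1 - 1/2) * \<bar>a - b\<bar>) powr p"
  proof (rule powr_mono2)
    have "2 * \<bar>b\<bar> \<le> \<bar>a + b\<bar> + \<bar>a - b\<bar>" by linarith
    then show "\<bar>b\<bar> \<le> 1/2 * \<bar>a + b\<bar> + (1 - 1/2) * \<bar>a - b\<bar>" by simp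
  qed (use assms in auto)
  also have "\<dots> \<le> 1/2 * \<bar>a + b\<bar> powr p + (1 - 1/2) * \<bar>a - b\<bar> powr p"
    using assms by (intro powr_convex_comb) auto
  finally show ?thesis by simp
qed

definition sgn_sum :: "(nat \<Rightarrow> 'a::real_vector) \<Rightarrow> nat \<Rightarrow> nat set \<Rightarrow> 'a" where
  "sgn_sum d N S = (\<Sum>n<N. if n \<in> S then d n else - d n)"

text \<open>
  The sign patterns are paired by flipping the sign of the \<open>m\<close>-th term. In each pair the two sums are
  \<open>r + t m\<close> and \<open>r - t m\<close>, and convexity bounds the average of their powers from below.
\<close>

lemma powr_le_sum_over_signs:
  fixes t :: "nat \<Rightarrow> real"
  assumes p: "1 \<le> p" and m: "m < N"
  shows "2 ^ N * \<bar>t m\<bar> powr p \<le> (\<Sum>S\<in>Pow {..<N}. \<bar>sgn_sum t N S\<bar> powr p)"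
proof -
  define G where "G S = \<bar>sgn_sum t N S\<bar> powr p" for S
  \<comment> \<open>The involution that flips the sign of the \<open>m\<close>-th term.\<close>
  define \<tau> where "\<tau> S = (if m \<in> S then S - {m} else insert m S)" for S
  have inv: "\<tau> (\<tau> S) = S" for S by (auto simp: \<tau>_def)
  have \<tau>P: "\<tau> S \<in> Pow {..<N}" if "S \<in> Pow {..<N}" for S using that m by (auto simp: \<tau>_def split: if_splits)
  have bij: "bij_betw \<tau> (Pow {..<N}) (Pow {..<N})"
    by (rule bij_betw_byWitness[where f'=\<tau>]) (use inv \<tau>P in auto)
  have "(\<Sum>S\<in>Pow {..<N}. G S) = (\<Sum>S\<in>Pow {..<N}. G (\<tau> S))"
    by (rule sum.reindex_bij_betw[OF bij, symmetric])
  then have "2 * (\<Sum>S\<in>Pow {..<N}. G S) = (\<Sum>S\<in>Pow {..<N}. G S + G (\<tau> S))" by (simp add: sum.distrib)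
  also have "\<dots> \<ge> (\<Sum>S\<in>Pow {..<N}. 2 * \<bar>t m\<bar> powr p)"
  proof (rule sum_mono)
    fix S :: "nat set"
    define r where "r = (\<Sum>n\<in>{..<N} - {m}. if n \<in> S then t n else - t n)"
    have r1: "sgn_sum t N S = (if m \<in> S then t m else - t m) + r"
      unfolding sgn_sum_def r_def using m by (subst sum.remove[of _ m]) auto
    have "sgn_sum t N (\<tau> S) = (if m \<in> \<tau> S then t m else - t m)
        + (\<Sum>n\<in>{..<N} - {m}. if n \<in> \<tau> S then t n else - t n)"
      unfolding sgn_sum_def using m by (subst sum.remove[of _ m]) auto
    also have "(\<Sum>n\<in>{..<N} - {m}. if n \<in> \<tau> S then t n else - t n) = r"
      unfolding r_def by (rule sum.cong) (auto simp: \<tau>_def)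
    finally have r2: "sgn_sum t N (\<tau> S) = (if m \<in> \<tau> S then t m else - t m) + r" .
    show "2 * \<bar>t m\<bar> powr p \<le> G S + G (\<tau> S)"
    proof (cases "m \<in> S")
      case True
      then have "m \<notin> \<tau> S" by (simp add: \<tau>_def)
      then show ?thesis using powr_sum_opposite[OF p, of "t m" r] True
        by (simp add: G_def r1 r2 add.commute)
    next
      case False
      then have "m \<in> \<tau> S" by (simp add: \<tau>_def)
      then show ?thesis using powr_sum_opposite[OF p, of "t m" r] False
        by (simp add: G_def r1 r2 add.commute)
    qed
  qed
  finally show ?thesis by (simp add: G_def card_Pow)
qed

text \<open>
  The suprema may be taken one index at a time because the choices \<open>\<sigma> k\<close> are independent.
\<close>

lemma sum_of_Sups_le:
  fixes g :: "nat \<Rightarrow> 'i \<Rightarrow> real"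
  assumes "\<And>k. bdd_above (range (g k))" "\<And>\<sigma>. (\<Sum>k<K. g k (\<sigma> k)) \<le> C"
  shows "(\<Sum>k<K. SUP n. g k n) \<le> C"
  using assms(2)
proof (induction K arbitrary: C)
  case (Suc K)
  have "(SUP n. g K n) \<le> C - (\<Sum>k<K. SUP n. g k n)"
  proof (rule cSUP_least)
    fix n
    have "(\<Sum>k<K. SUP n. g k n) \<le> C - g K n"
    proof (rule Suc.IH)
      fix \<sigma>
      have "(\<Sum>k<Suc K. g k ((\<sigma>(K := n)) k)) \<le> C" by (rule Suc.prems)
      moreover have "(\<Sum>k<K. g k ((\<sigma>(K := n)) k)) = (\<Sum>k<K. g k (\<sigma> k))" by (rule sum.cong) auto
      ultimately show "(\<Sum>k<K. g k (\<sigma> k)) \<le> C - g K n" by simp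
    qed
    then show "g K n \<le> C - (\<Sum>k<K. SUP n. g k n)" by simp
  qed simp
  then show ?case by simp
qed simp

text \<open>
  The uniform boundedness principle for the operator \<open>x \<mapsto> (f k x)\<^sub>k\<close> into \<open>\<ell>\<^sub>p\<close>. By Baire's theorem one of the
  closed sets on which all partial sums are bounded by \<open>m\<close> contains a ball.
\<close>

lemma weak_star_p_summable_bounded:
  fixes f :: "nat \<Rightarrow> 'a::banach \<Rightarrow>\<^sub>L real"
  assumes p: "1 \<le> p" and ws: "weak_star_p_summable p f"
  shows "\<exists>C. \<forall>x N. norm x \<le> 1 \<longrightarrow> (\<Sum>k<N. \<bar>f k x\<bar> powr p) \<le> C"
proof -
  define G where "G m = {x. \<forall>N. (\<Sum>k<N. \<bar>f k x\<bar> powr p) \<le> real m}" for m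
  have clo: "closed (G m)" for m
  proof -
    have "G m = (\<Inter>N. {x. (\<Sum>k<N. \<bar>f k x\<bar> powr p) \<le> real m})" by (auto simp: G_def)
    moreover have "closed {x. (\<Sum>k<N. \<bar>f k x\<bar> powr p) \<le> real m}" for N
      using p by (intro closed_Collect_le continuous_on_sum continuous_on_powr' continuous_intros) auto
    ultimately show ?thesis by auto
  qed
  have "x \<in> (\<Union>m. G m)" for x
  proof -
    have s: "summable (\<lambda>k. \<bar>f k x\<bar> powr p)" using ws by (auto simp: weak_star_p_summable_def lp_seq_def)
    obtain m :: nat where "(\<Sum>k. \<bar>f k x\<bar> powr p) \<le> real m" using real_arch_simple by blast
    moreover have "(\<Sum>k<N. \<bar>f k x\<bar> powr p) \<le> (\<Sum>k. \<bar>f k x\<bar> powr p)" for N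
      by (rule sum_le_suminf[OF s]) auto
    ultimately have "x \<in> G m" unfolding G_def by (blast intro: order_trans)
    then show ?thesis by blast
  qed
  then have U: "\<Union>(range G) = UNIV" by auto
  have "\<exists>m. interior (G m) \<noteq> {}"
  proof (rule ccontr)
    assume "\<not> ?thesis"
    then have "euclidean interior_of \<Union>(range G) = ({} :: 'a set)"
      using Met_TC.metric_Baire_category_alt[of "range G"] clo by (auto simp: complete_UNIV)
    then show False using U by simp
  qed
  then obtain m x0 where "x0 \<in> interior (G m)" by blast
  then obtain r where r: "r > 0" "cball x0 r \<subseteq> G m" by (auto simp: mem_interior_cball)
  define C where "C = 2 powr (p - 1) * (real m + real m) / r powr p"
  have "(\<Sum>k<N. \<bar>f k x\<bar> powr p) \<le> C" if x: "norm x \<le> 1" for x N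
  proof -
    have "x0 + r *\<^sub>R x \<in> cball x0 r" using x r by (simp add: dist_norm mult_left_le)
    then have 1: "(\<Sum>k<N. \<bar>f k (x0 + r *\<^sub>R x)\<bar> powr p) \<le> real m" using r by (auto simp: G_def)
    have "x0 \<in> cball x0 r" using r by simp
    then have "x0 \<in> G m" using r by blast
    then have 2: "(\<Sum>k<N. \<bar>f k x0\<bar> powr p) \<le> real m" by (simp add: G_def)
    have "r powr p * (\<Sum>k<N. \<bar>f k x\<bar> powr p) = (\<Sum>k<N. \<bar>f k (x0 + r *\<^sub>R x) + - f k x0\<bar> powr p)"
      using r by (simp add: sum_distrib_left blinfun.bilinear_simps abs_mult powr_mult)
    also have "\<dots> \<le> (\<Sum>k<N. 2 powr (p - 1) * (\<bar>f k (x0 + r *\<^sub>R x)\<bar> powr p + \<bar>- f k x0\<bar> powr p))"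
      by (intro sum_mono powr_add_le p)
    also have "\<dots> = 2 powr (p - 1) * ((\<Sum>k<N. \<bar>f k (x0 + r *\<^sub>R x)\<bar> powr p) + (\<Sum>k<N. \<bar>f k x0\<bar> powr p))"
      by (simp add: sum_distrib_left sum.distrib distrib_left)
    also have "\<dots> \<le> 2 powr (p - 1) * (real m + real m)" using 1 2 by (intro mult_left_mono add_mono) auto
    finally show ?thesis using r by (simp add: C_def field_simps)
  qed
  then show ?thesis by blast
qed

section \<open>Bounded positive series in spaces with the weak GP property\<close>

lemma p_limited_imp_almost: "p_limited p A \<Longrightarrow> almost_p_limited p A"
  unfolding p_limited_def almost_p_limited_def by blast

lemma powr_sum_homogeneous_le:
  fixes f :: "nat \<Rightarrow> 'a::banach \<Rightarrow>\<^sub>L real"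
  assumes "\<And>x. norm x \<le> 1 \<Longrightarrow> (\<Sum>k<N. \<bar>f k x\<bar> powr p) \<le> C" "norm x \<le> R" "0 < R"
  shows "(\<Sum>k<N. \<bar>f k x\<bar> powr p) \<le> C * R powr p"
proof -
  have "(\<Sum>k<N. \<bar>f k ((1/R) *\<^sub>R x)\<bar> powr p) \<le> C"
    using assms by (intro assms(1)) (simp add: field_simps)
  moreover have "(\<Sum>k<N. \<bar>f k ((1/R) *\<^sub>R x)\<bar> powr p) = (\<Sum>k<N. \<bar>f k x\<bar> powr p) / R powr p"
    using assms(3) by (simp add: blinfun.bilinear_simps abs_mult powr_divide sum_divide_distrib)
  ultimately show ?thesis using assms(3) by (simp add: field_simps)
qed

text \<open>
  All signed sums of the \<open>d n\<close> are bounded by \<open>M\<close> in norm, so the sums \<open>\<Sum>k. \<bar>f k (\<Sum>n. \<plusminus> d n)\<bar> powr p\<close> are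
  bounded uniformly in the signs. Averaging over the signs bounds \<open>\<Sum>k. \<bar>f k (d (\<sigma> k))\<bar> powr p\<close> for every
  choice of indices \<open>\<sigma>\<close>, and therefore the sum of the suprema.
\<close>

lemma positive_series_range_p_limited:
  fixes d :: "nat \<Rightarrow> 'a::banach_lattice"
  assumes p: "1 \<le> p" and d: "\<And>n. 0 \<le> d n" "\<And>N. norm (\<Sum>n<N. d n) \<le> M"
  shows "p_limited p (range d)"
  unfolding p_limited_def
proof (intro allI impI)
  fix f :: "nat \<Rightarrow> 'a \<Rightarrow>\<^sub>L real" assume "weak_star_p_summable p f"
  then obtain C where C: "\<And>x N. norm x \<le> 1 \<Longrightarrow> (\<Sum>k<N. \<bar>f k x\<bar> powr p) \<le> C"
    using weak_star_p_summable_bounded[OF p] by blast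
  define R where "R = max M 1"
  define C' where "C' = C * R powr p"
  have sgn_le: "norm (sgn_sum d N S) \<le> R" for N S
  proof -
    have "\<bar>sgn_sum d N S\<bar> \<le> (\<Sum>n<N. \<bar>if n \<in> S then d n else - d n\<bar>)"
      unfolding sgn_sum_def by (rule sum_abs)
    also have "\<dots> = (\<Sum>n<N. d n)" using d(1) by (intro sum.cong) auto
    also have "\<dots> = \<bar>\<Sum>n<N. d n\<bar>" using d(1) by (simp add: sum_nonneg)
    finally have "norm (sgn_sum d N S) \<le> norm (\<Sum>n<N. d n)" by (rule norm_abs_mono)
    then show ?thesis using d(2)[of N] by (simp add: R_def)
  qed
  have bound: "(\<Sum>k<K. \<bar>f k (d (\<sigma> k))\<bar> powr p) \<le> C'" for K \<sigma>
  proof -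
    \<comment> \<open>Any number above all of the finitely many indices \<open>\<sigma> k\<close> would do.\<close>
    define N where "N = Suc (\<Sum>k<K. \<sigma> k)"
    have \<sigma>N: "\<sigma> k < N" if "k < K" for k
      using member_le_sum[of k "{..<K}" \<sigma>] that by (simp add: N_def)
    have lin: "sgn_sum (\<lambda>n. f k (d n)) N S = f k (sgn_sum d N S)" for k S
      unfolding sgn_sum_def blinfun.sum_right by (intro sum.cong) (auto simp: blinfun.bilinear_simps)
    have "2 ^ N * (\<Sum>k<K. \<bar>f k (d (\<sigma> k))\<bar> powr p)
        \<le> (\<Sum>k<K. \<Sum>S\<in>Pow {..<N}. \<bar>sgn_sum (\<lambda>n. f k (d n)) N S\<bar> powr p)"
      unfolding sum_distrib_left by (intro sum_mono powr_le_sum_over_signs[OF p, of _ N "\<lambda>n. f _ (d n)"] \<sigma>N) auto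
    also have "\<dots> = (\<Sum>S\<in>Pow {..<N}. \<Sum>k<K. \<bar>f k (sgn_sum d N S)\<bar> powr p)"
      unfolding lin by (rule sum.swap)
    also have "\<dots> \<le> (\<Sum>S\<in>Pow {..<N}. C')"
      unfolding C'_def by (intro sum_mono powr_sum_homogeneous_le C sgn_le) (auto simp: R_def)
    also have "\<dots> = 2 ^ N * C'" by (simp add: card_Pow)
    finally show ?thesis by simp
  qed
  have pt: "\<bar>f k (d n)\<bar> powr p \<le> C'" for k n
  proof -
    have "\<bar>f k (d n)\<bar> powr p \<le> (\<Sum>k<Suc k. \<bar>f k (d n)\<bar> powr p)" by (simp add: sum_nonneg)
    then show ?thesis using bound[of "\<lambda>_. n" "Suc k"] by simp
  qed
  have bdd: "bdd_above (range (\<lambda>n. \<bar>f k (d n)\<bar> powr p))" for k using pt by (intro bdd_aboveI2)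
  define s where "s k = (SUP n. \<bar>f k (d n)\<bar> powr p)" for k
  have s_ge: "\<bar>f k (d n)\<bar> powr p \<le> s k" for k n unfolding s_def using bdd by (intro cSUP_upper) auto
  have s0: "0 \<le> s k" for k using s_ge[of k 0] by (meson order_trans powr_ge_zero)
  have "(\<Sum>k<K. s k) \<le> C'" for K unfolding s_def by (rule sum_of_Sups_le[OF bdd bound])
  then have "summable s" using s0 by (intro summableI_nonneg_bounded)
  moreover have "\<bar>s k powr (1/p)\<bar> powr p = s k" for k using p s0 by (simp add: powr_powr)
  ultimately have "lp_seq p (\<lambda>k. s k powr (1/p))" by (simp add: lp_seq_def)
  moreover have "\<bar>f k (d n)\<bar> \<le> s k powr (1/p)" for k n
  proof -
    have "\<bar>f k (d n)\<bar> = (\<bar>f k (d n)\<bar> powr p) powr (1/p)" using p by (simp add: powr_powr)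
    also have "\<dots> \<le> s k powr (1/p)" using p s_ge by (intro powr_mono2) auto
    finally show ?thesis .
  qed
  ultimately show "\<exists>a. lp_seq p a \<and> (\<forall>x\<in>range d. \<forall>n. \<bar>f n x\<bar> \<le> a n)" by blast
qed

text \<open>
  If a subsequence converged to \<open>l \<noteq> 0\<close>, sums of \<open>m\<close> consecutive terms far out would be close to \<open>m l\<close>,
  while by positivity they are dominated by partial sums of the whole series.
\<close>

lemma positive_series_compact_null:
  fixes d :: "nat \<Rightarrow> 'a::banach_lattice"
  assumes d: "\<And>n. 0 \<le> d n" "\<And>N. norm (\<Sum>n<N. d n) \<le> M" and cpt: "compact (closure (range d))"
  shows "d \<longlonglongrightarrow> 0"
proof (rule ccontr)
  assume "\<not> d \<longlonglongrightarrow> 0"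
  then obtain e where e: "0 < e" "\<And>N. \<exists>n\<ge>N. e \<le> norm (d n)"
    unfolding LIMSEQ_def by (auto simp: dist_norm not_less)
  then have "infinite {n. e \<le> norm (d n)}" by (auto simp: infinite_nat_iff_unbounded_le)
  from infinite_enumerate[OF this] obtain r :: "nat \<Rightarrow> nat"
    where r: "strict_mono r" "\<And>n. e \<le> norm (d (r n))" by auto
  have "\<forall>n. d (r n) \<in> closure (range d)" by (meson closure_subset rangeI subsetD)
  then obtain l s where s: "strict_mono s" "((\<lambda>n. d (r n)) \<circ> s) \<longlonglongrightarrow> l"
    using cpt unfolding compact_eq_seq_compact_metric seq_compact_def by metis
  define \<rho> where "\<rho> = r \<circ> s"
  have \<rho>: "strict_mono \<rho>" using r s by (simp add: \<rho>_def strict_mono_o)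
  have lim: "(\<lambda>n. d (\<rho> n)) \<longlonglongrightarrow> l" using s by (simp add: \<rho>_def o_def)
  have l: "e \<le> norm l"
    by (rule LIMSEQ_le_const[OF tendsto_norm[OF lim]]) (use r in \<open>auto simp: \<rho>_def\<close>)
  obtain J where J: "\<And>n. J \<le> n \<Longrightarrow> norm (d (\<rho> n) - l) < e / 2"
    using LIMSEQ_D[OF lim, of "e/2"] e by auto
  obtain m :: nat where m: "M < real m * (e / 2)" using e reals_Archimedean3[of "e/2"] by auto
  define x where "x = (\<Sum>n\<in>{J..<J + m}. d (\<rho> n))"
  have "real m * norm l - norm x \<le> norm (x - real m *\<^sub>R l)"
    using norm_triangle_ineq2[of "real m *\<^sub>R l" x] by (simp add: norm_minus_commute)
  also have "x - real m *\<^sub>R l = (\<Sum>n\<in>{J..<J + m}. d (\<rho> n) - l)"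
    by (simp add: x_def sum_subtractf scaleR_conv_of_real[symmetric] sum_constant_scaleR)
  also have "norm \<dots> \<le> (\<Sum>n\<in>{J..<J + m}. e / 2)"
    using J by (intro sum_norm_le) (auto intro: less_imp_le)
  also have "\<dots> = real m * (e / 2)" by simp
  finally have "real m * e \<le> real m * (e/2) + norm x"
    using mult_left_mono[OF l, of "real m"] by simp
  then have big: "M < norm x" using m by simp
  have inj: "inj \<rho>" using \<rho> by (rule strict_mono_imp_inj_on)
  have "x = sum d (\<rho> ` {J..<J + m})"
    unfolding x_def by (subst sum.reindex) (use inj in \<open>auto simp: inj_on_def\<close>)
  also have "\<dots> \<le> (\<Sum>n<\<rho> (J + m). d n)"
    using \<rho> d(1) by (intro sum_mono2) (auto simp: strict_mono_less)
  finally have "norm x \<le> norm (\<Sum>n<\<rho> (J + m). d n)"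
    using d(1) by (intro norm_mono_pos) (auto simp: x_def intro!: sum_nonneg)
  then show False using big d(2)[of "\<rho> (J + m)"] by simp
qed

lemma weak_GP_imp_KB:
  assumes "1 \<le> p" "weak_GP_property p TYPE('a::banach_lattice)"
  shows "KB_property TYPE('a)"
  unfolding KB_property_def
proof (intro allI impI)
  fix d :: "nat \<Rightarrow> 'a"
  assume d: "\<forall>n. 0 \<le> d n" "\<exists>M. \<forall>N. norm (\<Sum>n<N. d n) \<le> M"
  then obtain M where M: "\<And>N. norm (\<Sum>n<N. d n) \<le> M" by blast
  have "compact (closure (range d))"
    using positive_series_range_p_limited[OF assms(1) _ M] d assms(2) by (auto simp: weak_GP_property_def)
  then show "d \<longlonglongrightarrow> 0" using positive_series_compact_null[OF _ M] d by blast
qed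

section \<open>Weights for disjoint blocks of functionals\<close>

text \<open>
  The unit ball is sequentially compact for convergence of countably many coordinates: the limit
  coordinates have finite sums of norm at most \<open>1\<close>, so they belong to an element of the ball.
\<close>

lemma KB_ball_coordinate_compact:
  fixes u :: "nat \<Rightarrow> 'a::banach_lattice"
  assumes KB: "KB_property TYPE('a)"
    and A0: "countable A0" "A0 \<subseteq> unit_atoms" and u: "\<And>k. norm (u k) \<le> 1"
  shows "\<exists>r v. strict_mono r \<and> norm v \<le> 1 \<and> (\<forall>a\<in>A0. (\<lambda>k. coord a (u (r k :: nat))) \<longlonglongrightarrow> coord a v)"
proof -
  define en where "en = from_nat_into A0"
  \<comment> \<open>The enumeration is arbitrary if \<open>A0\<close> is empty, so coordinates outside the atoms are replaced by \<open>0\<close>.\<close>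
  define U where "U k i = (if en i \<in> unit_atoms then coord (en i) (u k) else 0)" for k i
  have "\<bar>U k i\<bar> \<le> 1" for k i
    using coord_norm_le[of "en i" "u k"] u[of k] by (auto simp: U_def)
  then obtain r l where r: "strict_mono r" "\<And>i. (\<lambda>k. U (r k) i) \<longlonglongrightarrow> l i"
    using bounded_pointwise_subseq[of U "\<lambda>_. 1"] by blast
  define t where "t a = (if a \<in> A0 then l (to_nat_on A0 a) else 0)" for a
  have lim: "(\<lambda>k. coord a (u (r k))) \<longlonglongrightarrow> t a" if "a \<in> A0" for a
    using r(2)[of "to_nat_on A0 a"] that A0 by (simp add: U_def t_def en_def subset_iff)
  have bd: "norm (\<Sum>a\<in>S. t a *\<^sub>R a) \<le> 1" if S: "finite S" "S \<subseteq> unit_atoms" for S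
  proof -
    have "(\<Sum>a\<in>S. t a *\<^sub>R a) = (\<Sum>a\<in>S \<inter> A0. t a *\<^sub>R a)"
      using S by (intro sum.mono_neutral_right) (auto simp: t_def)
    moreover have "(\<lambda>k. proj (S \<inter> A0) (u (r k))) \<longlonglongrightarrow> (\<Sum>a\<in>S \<inter> A0. t a *\<^sub>R a)"
      unfolding proj_def by (intro tendsto_sum tendsto_scaleR lim tendsto_const) auto
    moreover have "norm (proj (S \<inter> A0) (u (r k))) \<le> 1" for k
      using norm_proj_le[of "S \<inter> A0" "u (r k)"] S u[of "r k"] by (auto intro: order_trans)
    ultimately show ?thesis using LIMSEQ_le_const2[OF tendsto_norm] by (metis (no_types, lifting))
  qed
  obtain v where v: "((\<lambda>a. t a *\<^sub>R a) has_sum v) unit_atoms" "\<And>a. a \<in> unit_atoms \<Longrightarrow> coord a v = t a"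
    using KB_comb_has_sum[OF KB bd] by blast
  have "((\<lambda>S. norm (\<Sum>a\<in>S. t a *\<^sub>R a)) \<longlongrightarrow> norm v) (finite_subsets_at_top unit_atoms)"
    using v(1) unfolding has_sum_def by (rule tendsto_norm)
  then have "norm v \<le> 1"
    by (rule tendsto_upperbound) (auto intro!: eventually_finite_subsets_at_top_weakI bd)
  then show ?thesis using r(1) lim v(2) A0 by (intro exI[of _ r] exI[of _ v]) auto
qed

definition list_powr_sum :: "real \<Rightarrow> ('a::real_normed_vector \<Rightarrow>\<^sub>L real) list \<Rightarrow> 'a \<Rightarrow> real" where
  "list_powr_sum p fs x = (\<Sum>f\<leftarrow>fs. \<bar>f x\<bar> powr p)"

lemma list_powr_sum_simps [simp]:
  "list_powr_sum p [] x = 0" "list_powr_sum p (f # fs) x = \<bar>f x\<bar> powr p + list_powr_sum p fs x"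
  "list_powr_sum p (fs @ gs) x = list_powr_sum p fs x + list_powr_sum p gs x"
  by (simp_all add: list_powr_sum_def)

lemma list_powr_sum_nonneg: "0 \<le> list_powr_sum p fs x"
  by (induction fs) auto

lemma list_powr_sum_scaleR: "list_powr_sum p fs (c *\<^sub>R x) = \<bar>c\<bar> powr p * list_powr_sum p fs x"
  by (induction fs) (auto simp: blinfun.bilinear_simps abs_mult powr_mult distrib_left)

lemma list_powr_sum_tendsto:
  assumes "0 < p" "(u \<longlongrightarrow> x) F"
  shows "((\<lambda>k. list_powr_sum p fs (u k)) \<longlongrightarrow> list_powr_sum p fs x) F"
proof (induction fs)
  case (Cons f fs)
  have "((\<lambda>k. f (u k)) \<longlongrightarrow> f x) F" by (intro tendsto_intros assms)
  then have "((\<lambda>k. \<bar>f (u k)\<bar> powr p) \<longlongrightarrow> \<bar>f x\<bar> powr p) F"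
    using assms(1) by (intro tendsto_powr' tendsto_rabs tendsto_const) auto
  then show ?case using Cons by (auto intro: tendsto_add)
qed simp

text \<open>
  The functions \<open>w i\<close> that send \<open>x\<close> to the \<open>p\<close>-th power sum on its \<open>i\<close>-th block are at most \<open>1\<close> on the unit ball,
  depend on finitely many coordinates, and satisfy \<open>w i x \<le> norm (proj (B i) x) powr p\<close>, which tends
  to \<open>0\<close>. So the compactness argument for convex combinations applies. Multiplying the functionals of block \<open>i\<close> by
  \<open>\<alpha> i powr (1 / p)\<close> then yields weak* \<open>p\<close>-summable sequences with weights that are not summable; this is
  the source of both compactness results below.
\<close>

lemma KB_block_weights:
  fixes fs :: "nat \<Rightarrow> ('a::banach_lattice \<Rightarrow>\<^sub>L real) list"
  assumes KB: "KB_property TYPE('a)" and p: "1 \<le> p"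
    and B: "\<And>n::nat. finite (B n)" "\<And>n. B n \<subseteq> unit_atoms" "disjoint_family B"
    and le: "\<And>i x. norm x \<le> 1 \<Longrightarrow> list_powr_sum p (fs i) (proj (B i) x) \<le> 1"
  shows "\<exists>\<alpha>. (\<forall>i. 0 \<le> \<alpha> i) \<and> \<not> summable \<alpha> \<and> (\<forall>x. summable (\<lambda>i. \<alpha> i * list_powr_sum p (fs i) (proj (B i) x)))"
proof -
  define w where "w i x = list_powr_sum p (fs i) (proj (B i) x)" for i x
  have w0: "0 \<le> w i x" for i x by (simp add: w_def list_powr_sum_nonneg)
  have lin: "proj (B i) (c *\<^sub>R x) = c *\<^sub>R proj (B i) x" for i c x
    using linear_proj[OF B(2)] by (rule linear_scale)
  have hom: "w i (c *\<^sub>R x) = \<bar>c\<bar> powr p * w i x" for i c x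
    by (simp add: w_def lin list_powr_sum_scaleR)
  have idem: "w i (proj (B i) x) = w i x" for i x
    using proj_proj_subset[OF B(1)[of i] B(2)[of i] order_refl, of x] by (simp add: w_def)
  have w_le: "w i x \<le> norm x powr p" for i x
  proof (cases "x = 0")
    case True
    then show ?thesis using hom[of i 0 0] by simp
  next
    case False
    have "w i ((1 / norm x) *\<^sub>R x) \<le> 1" unfolding w_def using False by (intro le) simp
    then show ?thesis using False by (simp add: hom powr_divide divide_le_eq)
  qed
  have null: "(\<lambda>i. w i x) \<longlonglongrightarrow> 0" for x
  proof (rule tendsto_sandwich[OF _ _ tendsto_const])
    have "(\<lambda>i. norm (proj (B i) x)) \<longlonglongrightarrow> 0"
      by (rule tendsto_norm_zero[OF KB_proj_blocks_null[OF KB B]])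
    then have "(\<lambda>i. norm (proj (B i) x) powr p) \<longlonglongrightarrow> 0 powr p"
      using p by (intro tendsto_powr' tendsto_const) auto
    then show "(\<lambda>i. norm (proj (B i) x) powr p) \<longlonglongrightarrow> 0" using p by simp
    show "\<forall>\<^sub>F i in sequentially. w i x \<le> norm (proj (B i) x) powr p"
      using w_le[of i "proj (B i) x" for i] by (simp add: idem)
  qed (simp add: w0)
  have "\<exists>\<alpha>. (\<forall>i. 0 \<le> \<alpha> i) \<and> \<not> summable \<alpha> \<and> (\<forall>x\<in>{x. norm x \<le> 1}. summable (\<lambda>i. \<alpha> i * w i x))"
  proof (rule pointwise_null_imp_weights)
    show "{x::'a. norm x \<le> 1} \<noteq> {}" by (auto intro: exI[of _ 0])
    show "w i x \<le> 1" if "x \<in> {x. norm x \<le> 1}" for i x using le that by (simp add: w_def)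
    fix u :: "nat \<Rightarrow> 'a" assume "\<And>k. u k \<in> {x. norm x \<le> 1}"
    then have u: "\<And>k. norm (u k) \<le> 1" by simp
    have "countable (\<Union>i. B i)" "(\<Union>i. B i) \<subseteq> unit_atoms" using B by (auto simp: countable_finite)
    from KB_ball_coordinate_compact[of _ u, OF KB this u] obtain r v where r: "strict_mono r" "norm v \<le> 1"
      and lim: "\<And>a. a \<in> (\<Union>i. B i) \<Longrightarrow> (\<lambda>k. coord a (u (r k))) \<longlonglongrightarrow> coord a v" by blast
    have "(\<lambda>k. w i (u (r k))) \<longlonglongrightarrow> w i v" for i
    proof -
      have "(\<lambda>k. proj (B i) (u (r k))) \<longlonglongrightarrow> proj (B i) v"
        unfolding proj_def by (intro tendsto_sum tendsto_scaleR lim tendsto_const) auto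
      then show ?thesis unfolding w_def using p by (intro list_powr_sum_tendsto) auto
    qed
    then show "\<exists>r t. strict_mono r \<and> t \<in> {x. norm x \<le> 1} \<and> (\<forall>i. (\<lambda>k. w i (u (r k))) \<longlonglongrightarrow> w i t)"
      using r by blast
  qed (use w0 null in auto)
  then obtain \<alpha> where "(\<forall>i. 0 \<le> \<alpha> i) \<and> \<not> summable \<alpha> \<and> (\<forall>x\<in>{x. norm x \<le> 1}. summable (\<lambda>i. \<alpha> i * w i x))" ..
  then have \<alpha>: "\<And>i. 0 \<le> \<alpha> i" "\<not> summable \<alpha>"
    and s: "\<And>x. norm x \<le> 1 \<Longrightarrow> summable (\<lambda>i. \<alpha> i * w i x)" by simp_all
  have "summable (\<lambda>i. \<alpha> i * w i x)" for x
  proof (cases "x = 0")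
    case False
    have "summable (\<lambda>i. \<alpha> i * w i ((1 / norm x) *\<^sub>R x))" using False by (intro s) simp
    then have "summable (\<lambda>i. norm x powr p * (\<alpha> i * w i ((1 / norm x) *\<^sub>R x)))" by (rule summable_mult)
    then show ?thesis using False by (simp add: hom powr_divide)
  qed (simp add: s)
  with \<alpha> show ?thesis unfolding w_def by blast
qed

section \<open>Functionals carried by finitely many atoms\<close>

definition carried_by :: "('a::banach_lattice \<Rightarrow>\<^sub>L real) \<Rightarrow> 'a set \<Rightarrow> bool" where
  "carried_by f B \<longleftrightarrow> (\<forall>y. f (proj B y) = f y)"

lemma carried_by_expand:
  fixes f :: "'a::banach_lattice \<Rightarrow>\<^sub>L real"
  assumes "carried_by f B"
  shows "f y = (\<Sum>a\<in>B. coord a y * f a)"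
proof -
  have "f y = f (proj B y)" using assms by (simp add: carried_by_def)
  also have "\<dots> = (\<Sum>a\<in>B. coord a y * f a)"
    by (simp add: proj_def blinfun.sum_right blinfun.scaleR_right)
  finally show ?thesis .
qed

lemma coord_combination_blinfun:
  fixes h :: "'a::banach_lattice \<Rightarrow> real"
  assumes "finite B" "B \<subseteq> unit_atoms"
  shows "\<exists>f :: 'a \<Rightarrow>\<^sub>L real. carried_by f B \<and> (\<forall>y. f y = (\<Sum>a\<in>B. coord a y * h a))"
proof -
  have "bounded_linear (\<lambda>y. \<Sum>a\<in>B. coord a y * h a)"
    using assms by (intro bounded_linear_sum bounded_linear_mult_const bounded_linear_coord) auto
  then have *: "Blinfun (\<lambda>y. \<Sum>a\<in>B. coord a y * h a) y = (\<Sum>a\<in>B. coord a y * h a)" for y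
    by (simp add: bounded_linear_Blinfun_apply)
  show ?thesis
    by (rule exI[of _ "Blinfun (\<lambda>y. \<Sum>a\<in>B. coord a y * h a)"])
      (use assms in \<open>auto simp: carried_by_def * coord_proj subset_iff intro!: sum.cong\<close>)
qed

text \<open>
  Hahn-Banach on the span of finitely many atoms. The sublinear functional is first made odd at \<open>x0\<close>, which
  freezes its value there, and then at every atom of \<open>B\<close>; on the span of \<open>B\<close> the result is linear.
\<close>

lemma sublinear_block_functional:
  fixes q :: "'a::banach_lattice \<Rightarrow> real"
  assumes q: "sublinear q" and B: "finite B" "B \<subseteq> unit_atoms" and x0: "proj B x0 = x0"
  shows "\<exists>f :: 'a \<Rightarrow>\<^sub>L real. carried_by f B \<and> (\<forall>y. f y \<le> q (proj B y)) \<and> f x0 = q x0"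
proof -
  obtain m1 where m1: "sublinear m1" "\<And>x. m1 x \<le> q x" "m1 x0 = q x0" "m1 (- x0) = - m1 x0"
    using sublinear_odd_at[OF q] by blast
  obtain m where m: "sublinear m" "\<And>x. m x \<le> m1 x" "\<forall>a\<in>B. m (- a) = - m a"
    using sublinear_odd_on_finite[OF B(1) m1(1)] by blast
  have mx0: "m x0 = q x0" using sublinear_minorant_odd[OF m1(1) m(1,2) m1(4)] m1(3) by simp
  obtain f :: "'a \<Rightarrow>\<^sub>L real" where f: "carried_by f B" "\<And>y. f y = (\<Sum>a\<in>B. coord a y * m a)"
    using coord_combination_blinfun[OF B, of m] by blast
  have fm: "f y = m (proj B y)" for y
    unfolding f(2) proj_def by (rule sublinear_odd_sum[OF m(1) B(1) m(3), symmetric])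
  have "f y \<le> q (proj B y)" for y unfolding fm using m(2) m1(2) order_trans by blast
  moreover have "f x0 = q x0" unfolding fm x0 by (rule mx0)
  ultimately show ?thesis using f(1) by blast
qed

lemma norming_block_functional:
  fixes x :: "'a::banach_lattice"
  assumes B: "finite B" "B \<subseteq> unit_atoms"
  shows "\<exists>f :: 'a \<Rightarrow>\<^sub>L real. carried_by f B \<and> (\<forall>y. \<bar>f y\<bar> \<le> norm y) \<and> f x = norm (proj B x)"
proof -
  have "sublinear (norm :: 'a \<Rightarrow> real)" by (simp add: sublinear_def norm_triangle_ineq)
  from sublinear_block_functional[OF this B, of "proj B x"] obtain f :: "'a \<Rightarrow>\<^sub>L real"
    where f: "carried_by f B" "\<And>y. f y \<le> norm (proj B y)" "f (proj B x) = norm (proj B x)"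
    using proj_proj_subset[OF B order_refl] by blast
  have le: "f y \<le> norm y" for y using f(2)[of y] norm_proj_le[OF B, of y] by linarith
  have "\<bar>f y\<bar> \<le> norm y" for y using le[of y] le[of "- y"] by (simp add: blinfun.minus_right)
  then show ?thesis using f by (auto simp: carried_by_def)
qed

lemma carried_by_scaleR: "carried_by f B \<Longrightarrow> carried_by (c *\<^sub>R f) B"
  by (simp add: carried_by_def blinfun.scaleR_left)

text \<open>
  On the span of \<open>B\<close> the modulus is obtained by taking absolute values of the coefficients. A majorant
  \<open>h\<close> of \<open>f\<close> and \<open>- f\<close> is positive, so passing from \<open>proj B x\<close> to \<open>x\<close> only increases it.
\<close>

lemma carried_by_modulus:
  fixes f u :: "'a::banach_lattice \<Rightarrow>\<^sub>L real"
  assumes B: "finite B" "B \<subseteq> unit_atoms" and f: "carried_by f B"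
    and u: "\<And>y. u y = (\<Sum>a\<in>B. coord a y * \<bar>f a\<bar>)"
  shows "is_dual_sup f (- f) u"
  unfolding is_dual_sup_def dual_le_def
proof (intro conjI allI impI)
  have c0: "0 \<le> coord a x" if "0 \<le> x" "a \<in> B" for a x
    using that B by (intro coord_nonneg) auto
  show "f x \<le> u x" if "0 \<le> x" for x
    unfolding u carried_by_expand[OF f, of x] using c0[OF that] by (intro sum_mono mult_left_mono) auto
  show "(- f) x \<le> u x" if "0 \<le> x" for x
    unfolding u blinfun.minus_left carried_by_expand[OF f, of x] sum_negf[symmetric]
    using c0[OF that] mult_left_mono[OF abs_ge_minus_self, OF c0[OF that]] by (intro sum_mono) simp
  fix h :: "'a \<Rightarrow>\<^sub>L real" and x :: 'a
  assume "(\<forall>x\<ge>0. f x \<le> h x) \<and> (\<forall>x\<ge>0. (- f) x \<le> h x)" and x: "0 \<le> x"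
  then have h: "\<bar>f x\<bar> \<le> h x" if "0 \<le> x" for x using that by (fastforce simp: blinfun.minus_left)
  have "0 \<le> x - proj B x" using proj_pos_bounds[OF B x] by simp
  then have "0 \<le> h (x - proj B x)" using h by (meson abs_ge_zero order_trans)
  then have "h (proj B x) \<le> h x" by (simp add: blinfun.diff_right)
  moreover have "u x \<le> h (proj B x)"
    unfolding u proj_def blinfun.sum_right blinfun.scaleR_right real_scaleR_def
    using h B c0[OF x] by (intro sum_mono mult_left_mono) auto
  ultimately show "u x \<le> h x" by simp
qed

text \<open>
  A functional below both moduli is at most \<open>0\<close> on \<open>proj B x\<close>, where the second modulus vanishes, and on
  \<open>x - proj B x\<close>, where the first one does.
\<close>

lemma carried_by_disjoint:
  fixes f g :: "'a::banach_lattice \<Rightarrow>\<^sub>L real"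
  assumes B: "finite B" "B \<subseteq> unit_atoms" "carried_by f B"
    and B': "finite B'" "B' \<subseteq> unit_atoms" "carried_by g B'"
    and dis: "B \<inter> B' = {}"
  shows "dual_disjoint f g"
proof -
  obtain u :: "'a \<Rightarrow>\<^sub>L real" where u: "carried_by u B" "\<And>y. u y = (\<Sum>a\<in>B. coord a y * \<bar>f a\<bar>)"
    using coord_combination_blinfun[OF B(1,2), of "\<lambda>a. \<bar>f a\<bar>"] by blast
  obtain v :: "'a \<Rightarrow>\<^sub>L real" where v: "carried_by v B'" "\<And>y. v y = (\<Sum>a\<in>B'. coord a y * \<bar>g a\<bar>)"
    using coord_combination_blinfun[OF B'(1,2), of "\<lambda>a. \<bar>g a\<bar>"] by blast
  have "is_dual_inf u v 0"
    unfolding is_dual_inf_def dual_le_def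
  proof (intro conjI allI impI)
    show "(0 :: 'a \<Rightarrow>\<^sub>L real) x \<le> u x" if "0 \<le> x" for x
      using that B by (auto simp: u(2) intro!: sum_nonneg mult_nonneg_nonneg coord_nonneg)
    show "(0 :: 'a \<Rightarrow>\<^sub>L real) x \<le> v x" if "0 \<le> x" for x
      using that B' by (auto simp: v(2) intro!: sum_nonneg mult_nonneg_nonneg coord_nonneg)
    fix h :: "'a \<Rightarrow>\<^sub>L real" and x :: 'a
    assume h: "(\<forall>x\<ge>0. h x \<le> u x) \<and> (\<forall>x\<ge>0. h x \<le> v x)" and x: "0 \<le> x"
    have P: "0 \<le> proj B x" "0 \<le> x - proj B x" using proj_pos_bounds[OF B(1,2) x] by auto
    have "coord a (proj B x) = 0" if "a \<in> B'" for a
      using that dis B' by (subst coord_proj[OF B(1,2)]) auto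
    then have "v (proj B x) = 0" by (simp add: v(2))
    moreover have "u (x - proj B x) = 0" using u(1) by (simp add: carried_by_def blinfun.diff_right)
    moreover have "h x = h (proj B x) + h (x - proj B x)" by (simp add: blinfun.diff_right)
    ultimately show "h x \<le> (0 :: 'a \<Rightarrow>\<^sub>L real) x" using h P by fastforce
  qed
  with carried_by_modulus[OF B u(2)] carried_by_modulus[OF B' v(2)] show ?thesis
    unfolding dual_disjoint_def by blast
qed

section \<open>Relative compactness of almost p-limited sets\<close>

lemma almost_p_limitedD:
  assumes "almost_p_limited p A" "weak_star_p_summable p f"
    and "\<And>m n. m \<noteq> n \<Longrightarrow> dual_disjoint (f m) (f n)"
  shows "\<exists>a. lp_seq p a \<and> (\<forall>x\<in>A. \<forall>n. \<bar>f n x\<bar> \<le> a n)"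
  using assms by (simp add: almost_p_limited_def)

text \<open>
  The sequence that starts with the coordinate functional and continues with zeros is disjoint.
\<close>

lemma almost_p_limited_coord_bounded:
  fixes A :: "'a::banach_lattice set"
  assumes p: "1 \<le> p" and A: "almost_p_limited p A" and a: "a \<in> unit_atoms"
  shows "\<exists>R. \<forall>x\<in>A. \<bar>coord a x\<bar> \<le> R"
proof -
  define f where "f n = (if n = 0 then Blinfun (coord a) else 0)" for n :: nat
  define B where "B n = (if n = 0 then {a} else {})" for n :: nat
  have f0: "f 0 x = coord a x" for x
    using bounded_linear_coord[OF a] by (simp add: f_def bounded_linear_Blinfun_apply)
  have carr: "carried_by (f n) (B n)" for n
  proof (cases "n = 0")
    case True
    then show ?thesis using a coord_proj[of "{a}" a] by (auto simp: carried_by_def f0 B_def)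
  qed (simp add: carried_by_def f_def)
  have "dual_disjoint (f m) (f n)" if "m \<noteq> n" for m n
    by (rule carried_by_disjoint[OF _ _ carr _ _ carr]) (use that a in \<open>auto simp: B_def\<close>)
  moreover have "weak_star_p_summable p f"
    unfolding weak_star_p_summable_def lp_seq_def
  proof
    fix x
    show "summable (\<lambda>n. \<bar>f n x\<bar> powr p)"
      by (rule summable_finite[of "{0}"]) (auto simp: f_def)
  qed
  ultimately have "\<exists>b. lp_seq p b \<and> (\<forall>x\<in>A. \<forall>n. \<bar>f n x\<bar> \<le> b n)"
    using almost_p_limitedD[OF A, of f] by blast
  then show ?thesis using f0 by metis
qed

text \<open>
  Otherwise there are disjoint blocks \<open>B n\<close> and points \<open>x n\<close> of \<open>A\<close> with \<open>norm (proj (B n) (x n)) > e\<close>. Norming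
  functionals on the blocks, weighted by \<open>\<alpha> n powr (1 / p)\<close>, form a disjoint weak* \<open>p\<close>-summable sequence whose
  \<open>n\<close>-th term has \<open>p\<close>-th power at least \<open>\<alpha> n * e powr p\<close> at \<open>x n\<close>, which is not summable.
\<close>

lemma almost_p_limited_uniform_tail:
  fixes A :: "'a::banach_lattice set"
  assumes KB: "KB_property TYPE('a)" and p: "1 \<le> p" and A: "almost_p_limited p A" and e: "0 < e"
  shows "\<exists>S. finite S \<and> S \<subseteq> unit_atoms \<and>
    (\<forall>T. finite T \<longrightarrow> T \<subseteq> unit_atoms - S \<longrightarrow> (\<forall>x\<in>A. norm (proj T x) \<le> e))"
proof (rule ccontr)
  assume "\<not> ?thesis"
  then have "\<exists>T. finite T \<and> T \<subseteq> unit_atoms - S \<and> (\<exists>x\<in>A. e < norm (proj T x))"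
    if "finite S" "S \<subseteq> unit_atoms" for S using that by (meson not_le)
  from disjoint_blocks[of unit_atoms, OF this] obtain B :: "nat \<Rightarrow> 'a set"
    where B: "\<And>n. finite (B n)" "\<And>n. B n \<subseteq> unit_atoms" "disjoint_family B"
      and ex: "\<And>n. \<exists>x\<in>A. e < norm (proj (B n) x)" by blast
  obtain x where x: "\<And>n. x n \<in> A" "\<And>n. e < norm (proj (B n) (x n))" using ex by metis
  have "\<exists>f :: 'a \<Rightarrow>\<^sub>L real. carried_by f (B n) \<and> (\<forall>y. \<bar>f y\<bar> \<le> norm y) \<and> f (x n) = norm (proj (B n) (x n))" for n
    by (rule norming_block_functional[OF B(1,2)])
  then obtain f :: "nat \<Rightarrow> 'a \<Rightarrow>\<^sub>L real" where f: "\<And>n. carried_by (f n) (B n)" "\<And>n y. \<bar>f n y\<bar> \<le> norm y"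
    "\<And>n. f n (x n) = norm (proj (B n) (x n))" by metis
  have fp: "f n (proj (B n) y) = f n y" for n y using f(1) by (simp add: carried_by_def)
  have "list_powr_sum p [f i] (proj (B i) y) \<le> 1" if "norm y \<le> 1" for i y
  proof -
    have "\<bar>f i y\<bar> \<le> 1" using f(2)[of i y] that by linarith
    then show ?thesis using p by (simp add: fp powr_le1)
  qed
  from KB_block_weights[of p B "\<lambda>i. [f i]", OF KB p B this] obtain \<alpha> where \<alpha>: "\<And>i. 0 \<le> \<alpha> i" "\<not> summable \<alpha>"
    and s: "\<And>y. summable (\<lambda>i. \<alpha> i * \<bar>f i y\<bar> powr p)" by (auto simp: fp)
  define h where "h i = (\<alpha> i powr (1/p)) *\<^sub>R f i" for i
  have hp: "\<bar>h i y\<bar> powr p = \<alpha> i * \<bar>f i y\<bar> powr p" for i y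
    using p \<alpha>(1) by (simp add: h_def blinfun.scaleR_left abs_mult powr_mult powr_powr)
  have "weak_star_p_summable p h"
    unfolding weak_star_p_summable_def lp_seq_def hp using s by blast
  moreover have "dual_disjoint (h m) (h n)" if "m \<noteq> n" for m n
    unfolding h_def
    by (rule carried_by_disjoint[OF B(1,2) carried_by_scaleR[OF f(1)] B(1,2) carried_by_scaleR[OF f(1)]])
      (use B(3) that in \<open>auto simp: disjoint_family_on_def\<close>)
  ultimately have "\<exists>b. lp_seq p b \<and> (\<forall>y\<in>A. \<forall>n. \<bar>h n y\<bar> \<le> b n)" by (rule almost_p_limitedD[OF A])
  then obtain b where "lp_seq p b \<and> (\<forall>y\<in>A. \<forall>n. \<bar>h n y\<bar> \<le> b n)" ..
  then have b: "lp_seq p b" "\<And>y n. y \<in> A \<Longrightarrow> \<bar>h n y\<bar> \<le> b n" by simp_all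
  have le: "\<alpha> n * e powr p \<le> \<bar>b n\<bar> powr p" for n
  proof -
    have "\<alpha> n * e powr p \<le> \<alpha> n * \<bar>f n (x n)\<bar> powr p"
      using \<alpha>(1) x(2)[of n] e p by (intro mult_left_mono powr_mono2) (auto simp: f(3))
    also have "\<dots> = \<bar>h n (x n)\<bar> powr p" by (simp add: hp)
    also have "\<dots> \<le> \<bar>b n\<bar> powr p" using b(2)[OF x(1)[of n], of n] p by (intro powr_mono2) auto
    finally show ?thesis .
  qed
  have "summable (\<lambda>n. \<alpha> n * e powr p)"
    by (rule summable_comparison_test_ev[OF _ b(1)[unfolded lp_seq_def]]) (use le \<alpha>(1) in auto)
  from summable_divide[OF this, of "e powr p"] have "summable \<alpha>" using e by simp
  with \<alpha>(2) show False ..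
qed

lemma compact_bounded_combinations:
  fixes v :: "'i \<Rightarrow> 'a::real_normed_vector"
  assumes "finite S"
  shows "compact {\<Sum>a\<in>S. t a *\<^sub>R v a | t. \<forall>a\<in>S. \<bar>t a\<bar> \<le> R a}"
  using assms
proof (induction S rule: finite_induct)
  case (insert b S)
  have "{\<Sum>a\<in>insert b S. t a *\<^sub>R v a | t. \<forall>a\<in>insert b S. \<bar>t a\<bar> \<le> R a}
    = {x + y | x y. x \<in> (\<lambda>s. s *\<^sub>R v b) ` {- R b..R b} \<and> y \<in> {\<Sum>a\<in>S. t a *\<^sub>R v a | t. \<forall>a\<in>S. \<bar>t a\<bar> \<le> R a}}"
    (is "?L = ?R")
  proof
    show "?L \<subseteq> ?R"
    proof
      fix z assume "z \<in> ?L"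
      then obtain t where t: "z = (\<Sum>a\<in>insert b S. t a *\<^sub>R v a)" "\<forall>a\<in>insert b S. \<bar>t a\<bar> \<le> R a" by blast
      have "z = t b *\<^sub>R v b + (\<Sum>a\<in>S. t a *\<^sub>R v a)" using insert.hyps t by simp
      moreover have "t b \<in> {- R b..R b}" using t(2) by (auto simp: abs_le_iff)
      ultimately show "z \<in> ?R" using t(2) by blast
    qed
    show "?R \<subseteq> ?L"
    proof
      fix z assume "z \<in> ?R"
      then obtain s t where st: "z = s *\<^sub>R v b + (\<Sum>a\<in>S. t a *\<^sub>R v a)" "s \<in> {- R b..R b}" "\<forall>a\<in>S. \<bar>t a\<bar> \<le> R a"
        by blast
      have "z = (\<Sum>a\<in>insert b S. (t(b := s)) a *\<^sub>R v a)"
        using insert.hyps st(1) by (simp add: fun_upd_apply cong: sum.cong) (intro sum.cong, auto)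
      moreover have "\<forall>a\<in>insert b S. \<bar>(t(b := s)) a\<bar> \<le> R a" using st by (auto simp: abs_le_iff)
      ultimately show "z \<in> ?L" by blast
    qed
  qed
  moreover have "compact ((\<lambda>s. s *\<^sub>R v b) ` {- R b..R b})"
    by (intro compact_continuous_image continuous_intros compact_Icc)
  ultimately show ?case using compact_sums[OF _ insert.IH] by simp
qed simp

lemma compact_closure_if_near_compact:
  fixes A :: "'a::banach set"
  assumes "\<And>e. 0 < e \<Longrightarrow> \<exists>K. compact K \<and> (\<forall>x\<in>A. \<exists>y\<in>K. dist x y \<le> e)"
  shows "compact (closure A)"
  unfolding compact_eq_totally_bounded
proof (intro conjI allI impI)
  show "complete (closure A)" by (simp add: complete_eq_closed)
  fix e :: real assume e: "0 < e"
  then obtain K where K: "compact K" "\<And>x. x \<in> A \<Longrightarrow> \<exists>y\<in>K. dist x y \<le> e/4"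
    using assms[of "e/4"] by auto
  obtain k where k: "finite k" "K \<subseteq> (\<Union>x\<in>k. ball x (e/4))"
    using K(1) e unfolding compact_eq_totally_bounded by (meson divide_pos_pos zero_less_numeral)
  have "closure A \<subseteq> (\<Union>x\<in>k. ball x e)"
  proof
    fix x assume "x \<in> closure A"
    then obtain y where y: "y \<in> A" "dist y x < e/4"
      using e unfolding closure_approachable by (meson divide_pos_pos zero_less_numeral)
    obtain z where z: "z \<in> K" "dist y z \<le> e/4" using K(2)[OF y(1)] by blast
    obtain c where c: "c \<in> k" "dist c z < e/4" using k(2) z(1) by auto
    have "dist c x \<le> dist c z + dist y z + dist y x"
      using dist_triangle[of c x z] dist_triangle[of z x y] by (simp add: dist_commute)
    then have "dist c x < e" using y z c e by linarith
    then show "x \<in> (\<Union>x\<in>k. ball x e)" using c(1) by auto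
  qed
  with k(1) show "\<exists>k. finite k \<and> closure A \<subseteq> (\<Union>x\<in>k. ball x e)" by blast
qed

text \<open>
  Up to an arbitrarily small error the set is contained in a bounded set in the span of finitely many atoms.
\<close>

lemma KB_discrete_imp_strong_GP:
  assumes KB: "KB_property TYPE('a::banach_lattice)" and D: "discrete_banach_lattice TYPE('a)" and p: "1 \<le> p"
  shows "strong_GP_property p TYPE('a)"
  unfolding strong_GP_property_def
proof (intro allI impI)
  fix A :: "'a set" assume A: "almost_p_limited p A"
  have "\<forall>a. \<exists>R. a \<in> unit_atoms \<longrightarrow> (\<forall>x\<in>A. \<bar>coord a x\<bar> \<le> R)"
    using almost_p_limited_coord_bounded[OF p A] by blast
  then obtain R where R: "\<And>a x. a \<in> unit_atoms \<Longrightarrow> x \<in> A \<Longrightarrow> \<bar>coord a x\<bar> \<le> R a" by metis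
  show "compact (closure A)"
  proof (rule compact_closure_if_near_compact)
    fix e :: real assume "0 < e"
    from almost_p_limited_uniform_tail[OF KB p A this] obtain S where S': "finite S \<and> S \<subseteq> unit_atoms \<and>
      (\<forall>T. finite T \<longrightarrow> T \<subseteq> unit_atoms - S \<longrightarrow> (\<forall>x\<in>A. norm (proj T x) \<le> e))" ..
    then have S: "finite S" "S \<subseteq> unit_atoms"
      and tail: "\<And>T x. finite T \<Longrightarrow> T \<subseteq> unit_atoms - S \<Longrightarrow> x \<in> A \<Longrightarrow> norm (proj T x) \<le> e" by simp_all
    let ?K = "{\<Sum>a\<in>S. t a *\<^sub>R a | t. \<forall>a\<in>S. \<bar>t a\<bar> \<le> R a}"
    have "\<exists>y\<in>?K. dist x y \<le> e" if x: "x \<in> A" for x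
    proof (rule bexI[of _ "proj S x"])
      show "dist x (proj S x) \<le> e"
        unfolding dist_norm by (rule KB_remainder_le[OF KB D S tail[OF _ _ x]])
      show "proj S x \<in> ?K"
        unfolding proj_def using R[OF _ x] S by (intro CollectI exI[of _ "\<lambda>a. coord a x"]) auto
    qed
    then show "\<exists>K. compact K \<and> (\<forall>x\<in>A. \<exists>y\<in>K. dist x y \<le> e)"
      using compact_bounded_combinations[OF S(1), of "\<lambda>a. a" R] by blast
  qed
qed

section \<open>Relative compactness of relatively p-compact sets\<close>

lemma conj_exponent_gt1:
  assumes "1 < p"
  shows "1 < conj_exponent p" "1 / p + 1 / conj_exponent p = 1" "(p - 1) * conj_exponent p = p"
  using assms by (auto simp: conj_exponent_def field_simps)

lemma young_norm_le:
  assumes "1 < p" "0 \<le> a" "0 \<le> b"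
  shows "a * b \<le> a powr conj_exponent p + b powr p"
proof -
  have q: "1 < conj_exponent p" "1 / conj_exponent p + 1 / p = 1"
    using conj_exponent_gt1[OF assms(1)] by auto
  have "a * b \<le> a powr conj_exponent p / conj_exponent p + b powr p / p"
    by (rule Youngs_inequality[OF q(1) assms(1) q(2) assms(2,3)])
  also have "\<dots> \<le> a powr conj_exponent p / 1 + b powr p / 1"
    using q assms by (intro add_mono divide_left_mono) auto
  finally show ?thesis by simp
qed

text \<open>
  The series over \<open>j \<ge> N\<close> is uniformly small. Young's inequality is applied to \<open>s \<bar>c j\<bar>\<close> and \<open>norm (x j) / s\<close>:
  a small \<open>s\<close> takes care of the coefficients, after which a large \<open>N\<close> takes care of the vectors.
\<close>

lemma relatively_p_compact_imp_compact:
  fixes A :: "'a::banach set"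
  assumes p: "1 < p" and A: "relatively_p_compact p A"
  shows "compact (closure A)"
proof (rule compact_closure_if_near_compact)
  fix e :: real assume e: "0 < e"
  define q where "q = conj_exponent p"
  have q: "1 < q" using conj_exponent_gt1[OF p] by (simp add: q_def)
  obtain x :: "nat \<Rightarrow> 'a" where x: "summable (\<lambda>n. norm (x n) powr p)"
    and Ax: "A \<subseteq> {y. \<exists>c\<in>lq_unit_ball q. (\<lambda>j. c j *\<^sub>R x j) sums y}"
    using A by (auto simp: relatively_p_compact_def q_def)
  define s where "s = (e/2) powr (1/q)"
  have s: "0 < s" "s powr q = e/2" using e q by (auto simp: s_def powr_powr)
  obtain N where N: "\<And>m n. N \<le> m \<Longrightarrow> norm (\<Sum>j\<in>{m..<n}. norm (x j) powr p) < e/2 * s powr p"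
    using x e s unfolding summable_Cauchy by (metis half_gt_zero mult_pos_pos powr_gt_zero less_numeral_extra(3))
  let ?K = "{\<Sum>j\<in>{..<N}. c j *\<^sub>R x j | c. \<forall>j\<in>{..<N}. \<bar>c j\<bar> \<le> 1}"
  have "\<exists>z\<in>?K. dist y z \<le> e" if yA: "y \<in> A" for y
  proof -
    obtain c where c: "lp_seq q c" "(\<Sum>j. \<bar>c j\<bar> powr q) \<le> 1" "(\<lambda>j. c j *\<^sub>R x j) sums y"
      using subsetD[OF Ax yA] by (auto simp: lq_unit_ball_def)
    have part: "(\<Sum>j\<in>J. \<bar>c j\<bar> powr q) \<le> 1" if "finite J" for J
      using sum_le_suminf[of "\<lambda>j. \<bar>c j\<bar> powr q" J] c that by (simp add: lp_seq_def)
    have c1: "\<bar>c j\<bar> \<le> 1" for j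
    proof (rule ccontr)
      assume "\<not> \<bar>c j\<bar> \<le> 1"
      then have "1 < \<bar>c j\<bar> powr q" using q by (intro gr_one_powr) auto
      then show False using part[of "{j}"] by simp
    qed
    have tail: "norm (\<Sum>j\<in>{N..<m}. c j *\<^sub>R x j) \<le> e" for m
    proof -
      have "norm (\<Sum>j\<in>{N..<m}. c j *\<^sub>R x j) \<le> (\<Sum>j\<in>{N..<m}. (s * \<bar>c j\<bar>) * (norm (x j) / s))"
        using s by (intro sum_norm_le) simp
      also have "\<dots> \<le> (\<Sum>j\<in>{N..<m}. (s * \<bar>c j\<bar>) powr q + (norm (x j) / s) powr p)"
        unfolding q_def using s by (intro sum_mono young_norm_le p) auto
      also have "\<dots> = e/2 * (\<Sum>j\<in>{N..<m}. \<bar>c j\<bar> powr q) + (\<Sum>j\<in>{N..<m}. norm (x j) powr p) / s powr p"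
        unfolding s(2)[symmetric] using s(1)
        by (simp add: powr_mult powr_divide sum.distrib sum_distrib_left sum_divide_distrib)
      also have "\<dots> \<le> e/2 * 1 + e/2"
      proof (rule add_mono)
        show "e/2 * (\<Sum>j\<in>{N..<m}. \<bar>c j\<bar> powr q) \<le> e/2 * 1" using e part by (intro mult_left_mono) auto
        show "(\<Sum>j\<in>{N..<m}. norm (x j) powr p) / s powr p \<le> e/2"
          using N[OF order_refl, of m] s by (simp add: divide_le_eq)
      qed
      finally show ?thesis by simp
    qed
    have "(\<lambda>m. (\<Sum>j<m. c j *\<^sub>R x j) - (\<Sum>j<N. c j *\<^sub>R x j)) \<longlonglongrightarrow> y - (\<Sum>j<N. c j *\<^sub>R x j)"
      using c(3) unfolding sums_def by (intro tendsto_diff tendsto_const)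
    then have "norm (y - (\<Sum>j<N. c j *\<^sub>R x j)) \<le> e"
    proof (rule LIMSEQ_le_const2[OF tendsto_norm])
      have "(\<Sum>j<m. c j *\<^sub>R x j) - (\<Sum>j<N. c j *\<^sub>R x j) = (\<Sum>j\<in>{N..<m}. c j *\<^sub>R x j)" if "N \<le> m" for m
        using that by (simp add: sum_diff_nat_ivl flip: atLeast0LessThan)
      then show "\<exists>M. \<forall>m\<ge>M. norm ((\<Sum>j<m. c j *\<^sub>R x j) - (\<Sum>j<N. c j *\<^sub>R x j)) \<le> e"
        using tail by (intro exI[of _ N]) simp
    qed
    then show ?thesis using c1 by (intro bexI[of _ "\<Sum>j<N. c j *\<^sub>R x j"]) (auto simp: dist_norm)
  qed
  then show "\<exists>K. compact K \<and> (\<forall>y\<in>A. \<exists>z\<in>K. dist y z \<le> e)"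
    using compact_bounded_combinations[of "{..<N}" x "\<lambda>_. 1"] by blast
qed

section \<open>Tails of p-limited sets\<close>

lemma prod_decode_summable:
  fixes g :: "nat \<times> nat \<Rightarrow> real"
  assumes g0: "\<And>x. 0 \<le> g x" and z: "\<And>k l. n k \<le> l \<Longrightarrow> g (k, l) = 0"
    and bd: "\<And>K. (\<Sum>k<K. \<Sum>l<n k. g (k, l)) \<le> C"
  shows "summable (\<lambda>j. g (prod_decode j)) \<and> (\<Sum>j. g (prod_decode j)) \<le> C"
proof -
  have part: "(\<Sum>j<J. g (prod_decode j)) \<le> C" for J
  proof -
    have fst_less: "fst (prod_decode j) < J" if "j < J" for j
      using le_prod_encode_1[of "fst (prod_decode j)" "snd (prod_decode j)"] that by simp
    have "(\<Sum>j<J. g (prod_decode j)) = sum g (prod_decode ` {..<J})"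
      by (subst sum.reindex) (auto simp: inj_on_def)
    also have "\<dots> = sum g (prod_decode ` {..<J} \<inter> (SIGMA k:{..<J}. {..<n k}))"
    proof (rule sum.mono_neutral_right)
      show "\<forall>x\<in>prod_decode ` {..<J} - prod_decode ` {..<J} \<inter> (SIGMA k:{..<J}. {..<n k}). g x = 0"
      proof
        fix x assume x: "x \<in> prod_decode ` {..<J} - prod_decode ` {..<J} \<inter> (SIGMA k:{..<J}. {..<n k})"
        then have "fst x < J" using fst_less by blast
        then have "n (fst x) \<le> snd x" using x by (cases x) (auto simp: not_less)
        then show "g x = 0" using z[of "fst x" "snd x"] by simp
      qed
    qed auto
    also have "\<dots> \<le> sum g (SIGMA k:{..<J}. {..<n k})"
      using g0 by (intro sum_mono2) auto
    also have "\<dots> = (\<Sum>k<J. \<Sum>l<n k. g (k, l))" by (subst sum.Sigma) auto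
    also have "\<dots> \<le> C" by (rule bd)
    finally show ?thesis .
  qed
  have "summable (\<lambda>j. g (prod_decode j))" using part g0 by (intro summableI_nonneg_bounded)
  moreover have "(\<Sum>j. g (prod_decode j)) \<le> C" by (rule suminf_le_const[OF calculation part])
  ultimately show ?thesis by blast
qed

text \<open>
  In a list of pairs \<open>(f, x)\<close> the points \<open>x\<close> are allowed to depend on \<open>f\<close>. Bounding this sum for all choices of
  points in \<open>A\<close> thus bounds the sum of \<open>sup {\<bar>f (proj T x)\<bar> powr p | x. x \<in> A}\<close> over the functionals \<open>f\<close>.
\<close>

definition pair_list_sum :: "real \<Rightarrow> 'a::banach_lattice set \<Rightarrow> (('a \<Rightarrow>\<^sub>L real) \<times> 'a) list \<Rightarrow> real" where
  "pair_list_sum p T ps = (\<Sum>(f, x)\<leftarrow>ps. \<bar>f (proj T x)\<bar> powr p)"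

text \<open>
  Far out, the evaluation operator of \<open>A\<close>, from the dual into the bounded functions on \<open>A\<close>, has small
  \<open>p\<close>-summing norm. The proof is the gliding hump of \<open>almost_p_limited_uniform_tail\<close>, with a finite family
  of functionals on each block instead of a single norming one.
\<close>

lemma p_limited_tail:
  fixes A :: "'a::banach_lattice set"
  assumes KB: "KB_property TYPE('a)" and p: "1 \<le> p" and A: "p_limited p A" and \<delta>: "0 < \<delta>"
  shows "\<exists>S. finite S \<and> S \<subseteq> unit_atoms \<and>
    (\<forall>T. finite T \<longrightarrow> T \<subseteq> unit_atoms - S \<longrightarrow> (\<forall>ps. snd ` set ps \<subseteq> A \<longrightarrow>
       (\<forall>y. norm y \<le> 1 \<longrightarrow> list_powr_sum p (map fst ps) (proj T y) \<le> 1) \<longrightarrow> pair_list_sum p T ps \<le> \<delta>))"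
proof (rule ccontr)
  define bad where "bad T \<longleftrightarrow> (\<exists>ps. snd ` set ps \<subseteq> A \<and>
       (\<forall>y. norm y \<le> 1 \<longrightarrow> list_powr_sum p (map fst ps) (proj T y) \<le> 1) \<and> \<delta> < pair_list_sum p T ps)" for T
  assume "\<not> ?thesis"
  then have "\<exists>T. finite T \<and> T \<subseteq> unit_atoms - S \<and> bad T"
    if "finite S" "S \<subseteq> unit_atoms" for S using that unfolding bad_def by (meson not_le)
  from disjoint_blocks[of unit_atoms, OF this] obtain B :: "nat \<Rightarrow> 'a set"
    where B': "(\<forall>n. finite (B n) \<and> B n \<subseteq> unit_atoms \<and> bad (B n)) \<and> disjoint_family B" by blast
  then have B: "\<And>n. finite (B n)" "\<And>n. B n \<subseteq> unit_atoms" "disjoint_family B" by simp_all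
  have "\<forall>n. \<exists>ps. snd ` set ps \<subseteq> A \<and>
       (\<forall>y. norm y \<le> 1 \<longrightarrow> list_powr_sum p (map fst ps) (proj (B n) y) \<le> 1) \<and> \<delta> < pair_list_sum p (B n) ps"
    using B' unfolding bad_def by simp
  from choice[OF this] obtain ps where ps': "\<forall>n. snd ` set (ps n) \<subseteq> A \<and>
       (\<forall>y. norm y \<le> 1 \<longrightarrow> list_powr_sum p (map fst (ps n)) (proj (B n) y) \<le> 1) \<and> \<delta> < pair_list_sum p (B n) (ps n)" ..
  then have ps: "\<And>n. snd ` set (ps n) \<subseteq> A" "\<And>n. \<delta> < pair_list_sum p (B n) (ps n)"
    and ball: "\<And>n y. norm y \<le> 1 \<Longrightarrow> list_powr_sum p (map fst (ps n)) (proj (B n) y) \<le> 1" by simp_all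
  define W where "W n y = list_powr_sum p (map fst (ps n)) (proj (B n) y)" for n y
  from KB_block_weights[of p B "\<lambda>i. map fst (ps i)", OF KB p B ball]
  obtain \<alpha> where "(\<forall>i. 0 \<le> \<alpha> i) \<and> \<not> summable \<alpha> \<and> (\<forall>x. summable (\<lambda>i. \<alpha> i * W i x))"
    unfolding W_def ..
  then have \<alpha>: "\<And>i. 0 \<le> \<alpha> i" "\<not> summable \<alpha>" and s: "\<And>y. summable (\<lambda>i. \<alpha> i * W i y)" by simp_all
  define L where "L i = length (ps i)" for i
  define F where "F i k = fst (ps i ! k) o\<^sub>L Blinfun (proj (B i))" for i k
  define X where "X i k = snd (ps i ! k)" for i k
  have F: "F i k y = fst (ps i ! k) (proj (B i) y)" for i k y
    using bounded_linear_proj[OF B(2), of i] by (simp add: F_def bounded_linear_Blinfun_apply)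
  have XA: "X i k \<in> A" if "k < L i" for i k
    using ps(1)[of i] nth_mem[of k "ps i"] that by (auto simp: X_def L_def)
  have Wsum: "W i y = (\<Sum>k<L i. \<bar>F i k y\<bar> powr p)" for i y
    unfolding W_def list_powr_sum_def F L_def
    by (simp add: sum_list_sum_nth atLeast0LessThan)
  have Psum: "pair_list_sum p (B i) (ps i) = (\<Sum>k<L i. \<bar>F i k (X i k)\<bar> powr p)" for i
    unfolding pair_list_sum_def F L_def X_def
    by (simp add: sum_list_sum_nth atLeast0LessThan case_prod_beta)
  define h where "h j = (case prod_decode j of (i, k) \<Rightarrow> if k < L i then (\<alpha> i powr (1/p)) *\<^sub>R F i k else 0)" for j
  have hp: "\<bar>h j y\<bar> powr p = (case prod_decode j of (i, k) \<Rightarrow> if k < L i then \<alpha> i * \<bar>F i k y\<bar> powr p else 0)" for j y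
    using p \<alpha>(1) by (auto simp: h_def blinfun.scaleR_left abs_mult powr_mult powr_powr split: prod.split)
  have "weak_star_p_summable p h"
    unfolding weak_star_p_summable_def lp_seq_def hp
  proof
    fix y
    define g where "g = (\<lambda>(i, k). if k < L i then \<alpha> i * \<bar>F i k y\<bar> powr p else 0)"
    have "(\<Sum>i<K. \<Sum>k<L i. g (i, k)) \<le> suminf (\<lambda>i. \<alpha> i * W i y)" for K
    proof -
      have "(\<Sum>i<K. \<Sum>k<L i. g (i, k)) = (\<Sum>i<K. \<alpha> i * W i y)"
        by (simp add: g_def Wsum sum_distrib_left)
      also have "\<dots> \<le> suminf (\<lambda>i. \<alpha> i * W i y)"
        using \<alpha>(1) by (intro sum_le_suminf s) (auto simp: W_def list_powr_sum_nonneg)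
      finally show ?thesis .
    qed
    moreover have "g (k, l) = 0" if "L k \<le> l" for k l using that by (simp add: g_def)
    moreover have "0 \<le> g x" for x using \<alpha>(1) by (cases x) (simp add: g_def)
    ultimately have "summable (\<lambda>j. g (prod_decode j))"
      using prod_decode_summable[of g L] by blast
    then show "summable (\<lambda>j. case prod_decode j of (i, k) \<Rightarrow> if k < L i then \<alpha> i * \<bar>F i k y\<bar> powr p else 0)"
      by (simp add: g_def)
  qed
  then have "\<exists>b. lp_seq p b \<and> (\<forall>x\<in>A. \<forall>j. \<bar>h j x\<bar> \<le> b j)" using A unfolding p_limited_def by simp
  then obtain b where "lp_seq p b \<and> (\<forall>x\<in>A. \<forall>j. \<bar>h j x\<bar> \<le> b j)" ..
  then have b: "summable (\<lambda>j. \<bar>b j\<bar> powr p)" "\<And>x j. x \<in> A \<Longrightarrow> \<bar>h j x\<bar> \<le> b j" by (simp_all add: lp_seq_def)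
  have le: "\<alpha> i * \<bar>F i k (X i k)\<bar> powr p \<le> \<bar>b (prod_encode (i, k))\<bar> powr p" if "k < L i" for i k
  proof -
    have "\<alpha> i * \<bar>F i k (X i k)\<bar> powr p = \<bar>h (prod_encode (i, k)) (X i k)\<bar> powr p" using that by (simp add: hp)
    also have "\<dots> \<le> \<bar>b (prod_encode (i, k))\<bar> powr p"
      using b(2)[OF XA[OF that], of "prod_encode (i, k)"] p by (intro powr_mono2) auto
    finally show ?thesis .
  qed
  have "(\<Sum>i<N. \<alpha> i * \<delta>) \<le> suminf (\<lambda>j. \<bar>b j\<bar> powr p)" for N
  proof -
    have "(\<Sum>i<N. \<alpha> i * \<delta>) \<le> (\<Sum>i<N. \<alpha> i * pair_list_sum p (B i) (ps i))"
      using \<alpha>(1) ps(2) by (intro sum_mono mult_left_mono) (auto intro: less_imp_le)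
    also have "\<dots> \<le> (\<Sum>i<N. \<Sum>k<L i. \<bar>b (prod_encode (i, k))\<bar> powr p)"
      unfolding Psum sum_distrib_left using le by (intro sum_mono) auto
    also have "\<dots> = (\<Sum>x\<in>(SIGMA i:{..<N}. {..<L i}). \<bar>b (prod_encode x)\<bar> powr p)"
      by (subst sum.Sigma) auto
    also have "\<dots> = (\<Sum>j\<in>prod_encode ` (SIGMA i:{..<N}. {..<L i}). \<bar>b j\<bar> powr p)"
      by (subst sum.reindex) (auto intro: inj_on_subset[OF inj_prod_encode])
    also have "\<dots> \<le> suminf (\<lambda>j. \<bar>b j\<bar> powr p)" by (intro sum_le_suminf b(1)) auto
    finally show ?thesis .
  qed
  then have "summable (\<lambda>i. \<alpha> i * \<delta>)" using \<alpha>(1) \<delta> by (intro summableI_nonneg_bounded) auto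
  from summable_divide[OF this, of \<delta>] have "summable \<alpha>" using \<delta> by simp
  with \<alpha>(2) show False ..
qed

section \<open>Pietsch domination on a finite block\<close>

text \<open>
  If the points \<open>y l\<close> are \<open>1/2\<close>-dense in the unit ball of the span of \<open>T\<close>, then the supremum \<open>\<sigma>\<close> of the power
  sum satisfies \<open>\<sigma> \<le> 2 powr (p - 1) * (M + \<sigma> / 2 powr p)\<close>, because twice the difference of a point
  and a nearby point of the net is again in the unit ball. This can be solved for \<open>\<sigma>\<close>.
\<close>

lemma finite_norm_net:
  fixes T :: "'a::banach_lattice set"
  assumes T: "finite T" "T \<subseteq> unit_atoms" and p: "1 \<le> p"
  shows "\<exists>n y. (\<forall>l\<le>n::nat. norm (y l) \<le> 1 \<and> proj T (y l) = y l) \<and>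
    (\<forall>fs M. (\<forall>l\<le>n. list_powr_sum p fs (y l) \<le> M) \<longrightarrow>
       (\<forall>z. norm z \<le> 1 \<longrightarrow> list_powr_sum p fs (proj T z) \<le> 2 powr p * M))"
proof -
  define P where "P = proj T ` {z. norm z \<le> 1}"
  have Pn: "norm z \<le> 1" "proj T z = z" if "z \<in> P" for z
    using that norm_proj_le[OF T] proj_proj_subset[OF T order_refl] by (auto simp: P_def intro: order_trans)
  have PI: "z \<in> P" if "norm z \<le> 1" "proj T z = z" for z using that by (force simp: P_def)
  have "0 \<in> P" using linear_0[OF linear_proj[OF T(2)]] by (intro PI) auto
  have "P \<subseteq> {\<Sum>a\<in>T. t a *\<^sub>R a | t. \<forall>a\<in>T. \<bar>t a\<bar> \<le> 1}"
  proof
    fix z assume "z \<in> P"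
    then obtain x where x: "norm x \<le> 1" "z = proj T x" by (auto simp: P_def)
    have "\<bar>coord a x\<bar> \<le> 1" if "a \<in> T" for a using coord_norm_le[of a x] that T x by (auto intro: order_trans)
    then show "z \<in> {\<Sum>a\<in>T. t a *\<^sub>R a | t. \<forall>a\<in>T. \<bar>t a\<bar> \<le> 1}"
      unfolding x(2) proj_def by (intro CollectI exI[of _ "\<lambda>a. coord a x"]) simp
  qed
  then have cl: "closure P \<subseteq> {\<Sum>a\<in>T. t a *\<^sub>R a | t. \<forall>a\<in>T. \<bar>t a\<bar> \<le> 1}"
    using compact_bounded_combinations[OF T(1), of "\<lambda>a. a" "\<lambda>_. 1"] by (intro closure_minimal compact_imp_closed)
  have cP: "compact (closure P)"
    using compact_Int_closed[OF compact_bounded_combinations[OF T(1), of "\<lambda>a. a" "\<lambda>_. 1"] closed_closure, of P] cl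
    by (simp add: Int_absorb1)
  have cov: "closure P \<subseteq> (\<Union>x\<in>P. ball x (1/2))"
  proof
    fix z assume "z \<in> closure P"
    then obtain y where "y \<in> P" "dist y z < 1/2" unfolding closure_approachable by (meson half_gt_zero zero_less_one)
    then show "z \<in> (\<Union>x\<in>P. ball x (1/2))" by auto
  qed
  obtain D where D: "D \<subseteq> P" "finite D" "closure P \<subseteq> (\<Union>x\<in>D. ball x (1/2))"
    by (rule compactE_image[OF cP _ cov]) auto
  then have "D \<noteq> {}" using \<open>0 \<in> P\<close> closure_subset[of P] by auto
  then have "0 < card D" using D(2) by (simp add: card_gt_0_iff)
  define n where "n = card D - 1"
  obtain y where y: "bij_betw y {0..<card D} D" using ex_bij_betw_nat_finite[OF D(2)] by blast
  have yD: "y ` {..n} = D" using y \<open>0 < card D\<close> by (auto simp: bij_betw_def n_def atLeast0LessThan lessThan_Suc_atMost[symmetric])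
  have main: "list_powr_sum p fs (proj T z) \<le> 2 powr p * M"
    if M: "\<And>l. l \<le> n \<Longrightarrow> list_powr_sum p fs (y l) \<le> M" and z: "norm z \<le> 1" for fs M z
  proof -
    define s where "s = list_powr_sum p fs"
    have sn: "s z \<le> (\<Sum>f\<leftarrow>fs. norm f powr p)" if "norm z \<le> 1" for z
      unfolding s_def
    proof (induction fs)
      case (Cons f fs)
      have "\<bar>f z\<bar> \<le> norm f * norm z" using norm_blinfun[of f z] by simp
      also have "\<dots> \<le> norm f" using that by (simp add: mult_left_le)
      finally have "\<bar>f z\<bar> powr p \<le> norm f powr p" using p by (intro powr_mono2) auto
      then show ?case using Cons by simp
    qed simp
    define \<sigma> where "\<sigma> = (SUP z\<in>P. s z)"
    have s\<sigma>: "s z \<le> \<sigma>" if "z \<in> P" for z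
      unfolding \<sigma>_def using that sn[OF Pn(1)] by (intro cSUP_upper bdd_aboveI2[of _ _ "\<Sum>f\<leftarrow>fs. norm f powr p"])
    have add: "s (u + v) \<le> 2 powr (p - 1) * (s u + s v)" for u v
      unfolding s_def
    proof (induction fs)
      case (Cons f fs)
      then show ?case using powr_add_le[OF p, of "f u" "f v"] by (simp add: blinfun.add_right distrib_left)
    qed simp
    have "\<sigma> \<le> 2 powr (p - 1) * M + \<sigma> / 2"
      unfolding \<sigma>_def
    proof (rule cSUP_least)
      fix z assume z: "z \<in> P"
      then obtain x where x: "x \<in> D" "dist x z < 1/2" using D(3) closure_subset[of P] by force
      then obtain l where l: "l \<le> n" "x = y l" using yD by auto
      define v where "v = z - x"
      have xP: "x \<in> P" using x D by auto
      \<comment> \<open>By homogeneity this gains the factor \<open>2 powr p\<close> that makes the inequality for \<open>\<sigma>\<close> solvable.\<close>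
      have "2 *\<^sub>R v \<in> P"
      proof (rule PI)
        show "norm (2 *\<^sub>R v) \<le> 1" using x(2) by (simp add: v_def dist_norm norm_minus_commute)
        show "proj T (2 *\<^sub>R v) = 2 *\<^sub>R v"
          unfolding linear_scale[OF linear_proj[OF T(2)]] v_def linear_diff[OF linear_proj[OF T(2)]]
          by (simp add: Pn[OF z] Pn[OF xP])
      qed
      then have "2 powr p * s v \<le> \<sigma>" using s\<sigma>[of "2 *\<^sub>R v"] by (simp add: s_def list_powr_sum_scaleR)
      then have "2 powr (p - 1) * s v \<le> \<sigma> / 2" by (simp add: powr_diff)
      moreover have "s z \<le> 2 powr (p - 1) * (s x + s v)" using add[of x v] by (simp add: v_def)
      moreover have "2 powr (p - 1) * s x \<le> 2 powr (p - 1) * M"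
        using M[OF l(1)] l by (intro mult_left_mono) (auto simp: s_def)
      ultimately have "s z \<le> 2 powr (p - 1) * M + \<sigma> / 2" unfolding distrib_left by linarith
      then show "s z \<le> 2 powr (p - 1) * M + (SUP z\<in>P. s z) / 2" by (simp only: \<sigma>_def)
    qed (use \<open>0 \<in> P\<close> in auto)
    then have "\<sigma> \<le> 2 powr p * M" by (simp add: powr_diff)
    moreover have "proj T z \<in> P" using z by (auto simp: P_def)
    ultimately show ?thesis using s\<sigma>[of "proj T z"] by (simp add: s_def)
  qed
  have "\<forall>l\<le>n. norm (y l) \<le> 1 \<and> proj T (y l) = y l" using yD D(1) Pn by blast
  with main show ?thesis by blast
qed

definition scale_functionals :: "real \<Rightarrow> (('a::real_normed_vector \<Rightarrow>\<^sub>L real) \<times> 'a) list \<Rightarrow> (('a \<Rightarrow>\<^sub>L real) \<times> 'a) list" where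
  "scale_functionals c = map (\<lambda>(f, x). (c *\<^sub>R f, x))"

lemma list_powr_sum_scale_functionals:
  "list_powr_sum p (map fst (scale_functionals c ps)) y = \<bar>c\<bar> powr p * list_powr_sum p (map fst ps) y"
  by (induction ps) (auto simp: scale_functionals_def blinfun.scaleR_left abs_mult powr_mult distrib_left)

lemma pair_list_sum_scale_functionals:
  "pair_list_sum p T (scale_functionals c ps) = \<bar>c\<bar> powr p * pair_list_sum p T ps"
  by (induction ps)
    (auto simp: pair_list_sum_def scale_functionals_def blinfun.scaleR_left abs_mult powr_mult distrib_left)

lemma pair_list_sum_append: "pair_list_sum p T (ps @ qs) = pair_list_sum p T ps + pair_list_sum p T qs"
  by (simp add: pair_list_sum_def)

lemma snd_scale_functionals: "snd ` set (scale_functionals c ps) = snd ` set ps"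
  by (force simp: scale_functionals_def)

text \<open>
  Pietsch's domination theorem on the span of a finite set of atoms, with a measure on a finite net of the unit ball. The
  functions \<open>\<phi> l\<close> on lists of pairs are additive and \<open>p\<close>-homogeneous, hence affine in the sense of the minimax theorem, and
  by the hypothesis on \<open>A\<close> one of them is nonnegative on each list. The resulting weights \<open>\<mu> l\<close> are absorbed
  into the points of the net.
\<close>

lemma pietsch_domination_block:
  fixes A T :: "'a::banach_lattice set"
  assumes T: "finite T" "T \<subseteq> unit_atoms" and p: "1 \<le> p" and \<delta>: "0 < \<delta>"
    and bd: "\<And>ps. snd ` set ps \<subseteq> A \<Longrightarrow>
       (\<And>y. norm y \<le> 1 \<Longrightarrow> list_powr_sum p (map fst ps) (proj T y) \<le> 1) \<Longrightarrow> pair_list_sum p T ps \<le> \<delta>"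
  shows "\<exists>n y. (\<forall>l\<le>n::nat. proj T (y l) = y l) \<and> (\<Sum>l\<le>n. norm (y l) powr p) \<le> 2 powr p * \<delta> \<and>
    (\<forall>f :: 'a \<Rightarrow>\<^sub>L real. \<forall>x\<in>A. \<bar>f (proj T x)\<bar> powr p \<le> (\<Sum>l\<le>n. \<bar>f (y l)\<bar> powr p))"
proof -
  obtain n :: nat and y where "(\<forall>l\<le>n. norm (y l) \<le> 1 \<and> proj T (y l) = y l) \<and>
    (\<forall>fs M. (\<forall>l\<le>n. list_powr_sum p fs (y l) \<le> M) \<longrightarrow>
       (\<forall>z. norm z \<le> 1 \<longrightarrow> list_powr_sum p fs (proj T z) \<le> 2 powr p * M))"
    using finite_norm_net[OF T p] by blast
  then have y: "\<And>l. l \<le> n \<Longrightarrow> norm (y l) \<le> 1" "\<And>l. l \<le> n \<Longrightarrow> proj T (y l) = y l"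
    and net: "\<And>fs M z. (\<And>l. l \<le> n \<Longrightarrow> list_powr_sum p fs (y l) \<le> M) \<Longrightarrow> norm z \<le> 1 \<Longrightarrow>
      list_powr_sum p fs (proj T z) \<le> 2 powr p * M" by simp_all
  have bdM: "pair_list_sum p T ps \<le> \<delta> * M"
    if ps: "snd ` set ps \<subseteq> A" and M: "0 < M" and le: "\<And>z. norm z \<le> 1 \<Longrightarrow> list_powr_sum p (map fst ps) (proj T z) \<le> M"
    for ps M
  proof -
    define c where "c = (1 / M) powr (1/p)"
    have c: "\<bar>c\<bar> powr p = 1 / M" using p M by (simp add: c_def powr_powr)
    have "pair_list_sum p T (scale_functionals c ps) \<le> \<delta>"
    proof (rule bd)
      fix z :: 'a assume "norm z \<le> 1"
      then show "list_powr_sum p (map fst (scale_functionals c ps)) (proj T z) \<le> 1"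
        using le[of z] M by (simp add: list_powr_sum_scale_functionals c)
    qed (use ps in \<open>simp add: snd_scale_functionals\<close>)
    then show ?thesis using M by (simp add: pair_list_sum_scale_functionals c divide_le_eq)
  qed
  define K where "K = 2 powr p * \<delta>"
  have K: "0 < K" using \<delta> by (simp add: K_def)
  define \<phi> where "\<phi> l ps = K * list_powr_sum p (map fst ps) (y l) - pair_list_sum p T ps" for l ps
  have "\<exists>\<mu>. (\<forall>l. 0 \<le> \<mu> l) \<and> (\<Sum>l\<le>n. \<mu> l) = (1::real) \<and> (\<forall>ps\<in>{ps. snd ` set ps \<subseteq> A}. 0 \<le> (\<Sum>l\<le>n. \<mu> l * \<phi> l ps))"
  proof (rule finite_minimax)
    fix u v :: "(('a \<Rightarrow>\<^sub>L real) \<times> 'a) list" and t :: real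
    assume uv: "u \<in> {ps. snd ` set ps \<subseteq> A}" "v \<in> {ps. snd ` set ps \<subseteq> A}" and t: "0 \<le> t" "t \<le> 1"
    define w where "w = scale_functionals (t powr (1/p)) u @ scale_functionals ((1 - t) powr (1/p)) v"
    have "\<phi> l w = t * \<phi> l u + (1 - t) * \<phi> l v" for l
      using p t by (simp add: \<phi>_def w_def list_powr_sum_scale_functionals pair_list_sum_append
          pair_list_sum_scale_functionals powr_powr algebra_simps)
    moreover have "w \<in> {ps. snd ` set ps \<subseteq> A}" using uv by (simp add: w_def image_Un snd_scale_functionals)
    ultimately show "\<exists>w\<in>{ps. snd ` set ps \<subseteq> A}. \<forall>l\<le>n. \<phi> l w \<le> t * \<phi> l u + (1 - t) * \<phi> l v"
      by (intro bexI[of _ w]) simp_all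
  next
    fix ps :: "(('a \<Rightarrow>\<^sub>L real) \<times> 'a) list" assume "ps \<in> {ps. snd ` set ps \<subseteq> A}"
    then have ps: "snd ` set ps \<subseteq> A" by simp
    define V where "V = pair_list_sum p T ps"
    define s where "s l = list_powr_sum p (map fst ps) (y l)" for l
    show "\<exists>l\<le>n. 0 \<le> \<phi> l ps"
    proof (rule ccontr)
      assume neg: "\<not> ?thesis"
      have less: "K * s l < V" if l: "l \<le> n" for l
      proof -
        have "\<phi> l ps < 0" using neg l by (meson not_le)
        then show ?thesis by (simp add: \<phi>_def V_def s_def)
      qed
      define M where "M = Max (s ` {..n})"
      have sM: "s l \<le> M" if "l \<le> n" for l unfolding M_def using that by (intro Max_ge) auto
      have "M \<in> s ` {..n}" unfolding M_def by (intro Max_in) auto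
      then have KM: "K * M < V" using less by auto
      have M0: "0 \<le> M" using sM[of 0] list_powr_sum_nonneg[of p "map fst ps" "y 0"] by (simp add: s_def)
      have V: "0 < V" using KM K M0 by (meson mult_nonneg_nonneg less_imp_le order_le_less_trans)
      have "2 powr p * M < V / \<delta>" using KM \<delta> by (simp add: K_def field_simps)
      \<comment> \<open>The number \<open>b\<close> replaces \<open>2 powr p * M\<close>, which may be \<open>0\<close> and then cannot be used to rescale the list.\<close>
      then obtain b where b: "2 powr p * M < b" "b < V / \<delta>" using dense by blast
      have "V \<le> \<delta> * b"
        unfolding V_def
      proof (rule bdM[OF ps])
        have "0 \<le> 2 powr p * M" using M0 by simp
        then show "0 < b" using b(1) by linarith
        fix z :: 'a assume "norm z \<le> 1"
        then have "list_powr_sum p (map fst ps) (proj T z) \<le> 2 powr p * M"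
          using sM by (intro net) (auto simp: s_def)
        then show "list_powr_sum p (map fst ps) (proj T z) \<le> b" using b(1) by linarith
      qed
      then show False using b(2) \<delta> by (simp add: field_simps)
    qed
  qed
  then obtain \<mu> where "(\<forall>l. 0 \<le> \<mu> l) \<and> (\<Sum>l\<le>n. \<mu> l) = 1 \<and> (\<forall>ps\<in>{ps. snd ` set ps \<subseteq> A}. 0 \<le> (\<Sum>l\<le>n. \<mu> l * \<phi> l ps))" ..
  then have \<mu>: "\<And>l. 0 \<le> \<mu> l" "(\<Sum>l\<le>n. \<mu> l) = 1" and \<mu>\<phi>: "\<And>ps. snd ` set ps \<subseteq> A \<Longrightarrow> 0 \<le> (\<Sum>l\<le>n. \<mu> l * \<phi> l ps)"
    by simp_all
  define z where "z l = ((K * \<mu> l) powr (1/p)) *\<^sub>R y l" for l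
  have Kp: "\<bar>(K * \<mu> l) powr (1/p)\<bar> powr p = K * \<mu> l" for l using p K \<mu>(1) by (simp add: powr_powr)
  have "proj T (z l) = z l" if "l \<le> n" for l
    unfolding z_def linear_scale[OF linear_proj[OF T(2)]] y(2)[OF that] ..
  moreover have "(\<Sum>l\<le>n. norm (z l) powr p) \<le> 2 powr p * \<delta>"
  proof -
    have "norm (z l) powr p \<le> K * \<mu> l" if "l \<le> n" for l
    proof -
      have "norm (z l) powr p = K * \<mu> l * norm (y l) powr p" using Kp[of l] by (simp add: z_def powr_mult)
      also have "\<dots> \<le> K * \<mu> l * 1" using y(1)[OF that] K \<mu>(1) p by (intro mult_left_mono powr_le1) auto
      finally show ?thesis by simp
    qed
    then have "(\<Sum>l\<le>n. norm (z l) powr p) \<le> (\<Sum>l\<le>n. K * \<mu> l)" by (intro sum_mono) simp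
    also have "\<dots> = K" using \<mu>(2) by (simp flip: sum_distrib_left)
    finally show ?thesis by (simp add: K_def)
  qed
  moreover have "\<bar>f (proj T x)\<bar> powr p \<le> (\<Sum>l\<le>n. \<bar>f (z l)\<bar> powr p)" if x: "x \<in> A" for f :: "'a \<Rightarrow>\<^sub>L real" and x
  proof -
    have "0 \<le> (\<Sum>l\<le>n. \<mu> l * \<phi> l [(f, x)])" using x by (intro \<mu>\<phi>) simp
    also have "\<dots> = (\<Sum>l\<le>n. K * \<mu> l * \<bar>f (y l)\<bar> powr p) - (\<Sum>l\<le>n. \<mu> l) * \<bar>f (proj T x)\<bar> powr p"
      by (simp add: \<phi>_def pair_list_sum_def sum_subtractf right_diff_distrib sum_distrib_right mult_ac)
    also have "(\<Sum>l\<le>n. K * \<mu> l * \<bar>f (y l)\<bar> powr p) = (\<Sum>l\<le>n. \<bar>f (z l)\<bar> powr p)"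
      using Kp by (simp add: z_def blinfun.scaleR_right abs_mult powr_mult)
    finally show ?thesis using \<mu>(2) by simp
  qed
  ultimately show ?thesis by blast
qed

section \<open>From domination to combinations\<close>

definition fin_ball :: "nat \<Rightarrow> real \<Rightarrow> (nat \<Rightarrow> real) set" where
  "fin_ball n q = {c. (\<Sum>l\<le>n. \<bar>c l\<bar> powr q) \<le> 1}"

lemma fin_ball_convex:
  assumes q: "1 \<le> q" and c: "c \<in> fin_ball n q" "d \<in> fin_ball n q" and t: "0 \<le> t" "t \<le> 1"
  shows "(\<lambda>l. t * c l + (1 - t) * d l) \<in> fin_ball n q"
proof -
  have "(\<Sum>l\<le>n. \<bar>t * c l + (1 - t) * d l\<bar> powr q) \<le> (\<Sum>l\<le>n. t * \<bar>c l\<bar> powr q + (1 - t) * \<bar>d l\<bar> powr q)"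
  proof (rule sum_mono)
    fix l
    have "\<bar>t * c l + (1 - t) * d l\<bar> powr q \<le> (t * \<bar>c l\<bar> + (1 - t) * \<bar>d l\<bar>) powr q"
      using q t abs_triangle_ineq[of "t * c l" "(1 - t) * d l"] by (intro powr_mono2) (auto simp: abs_mult)
    also have "\<dots> \<le> t * \<bar>c l\<bar> powr q + (1 - t) * \<bar>d l\<bar> powr q" using q t by (intro powr_convex_comb) auto
    finally show "\<bar>t * c l + (1 - t) * d l\<bar> powr q \<le> t * \<bar>c l\<bar> powr q + (1 - t) * \<bar>d l\<bar> powr q" .
  qed
  also have "\<dots> = t * (\<Sum>l\<le>n. \<bar>c l\<bar> powr q) + (1 - t) * (\<Sum>l\<le>n. \<bar>d l\<bar> powr q)"
    by (simp add: sum.distrib sum_distrib_left)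
  also have "\<dots> \<le> t * 1 + (1 - t) * 1" using c t unfolding fin_ball_def by (intro add_mono mult_left_mono) auto
  finally show ?thesis by (simp add: fin_ball_def)
qed

text \<open>
  The gauge of the convex hull of \<open>{\<Sum>l\<le>n. c l *\<^sub>R y l | c. c \<in> fin_ball n q}\<close> and the ball of radius \<open>1 / M\<close>. The
  ball makes the gauge finite on the whole space.
\<close>

definition comb_gauge :: "real \<Rightarrow> nat \<Rightarrow> real \<Rightarrow> (nat \<Rightarrow> 'a::real_normed_vector) \<Rightarrow> 'a \<Rightarrow> real" where
  "comb_gauge M n q y z =
     (INF (t, c)\<in>{0..} \<times> fin_ball n q. t + M * norm (z - t *\<^sub>R (\<Sum>l\<le>n. c l *\<^sub>R y l)))"

lemma comb_gauge_le:
  assumes "0 \<le> M" "0 \<le> t" "c \<in> fin_ball n q"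
  shows "comb_gauge M n q y z \<le> t + M * norm (z - t *\<^sub>R (\<Sum>l\<le>n. c l *\<^sub>R y l))"
proof -
  let ?h = "\<lambda>(t, c). t + M * norm (z - t *\<^sub>R (\<Sum>l\<le>n. c l *\<^sub>R y l))"
  have "bdd_below (?h ` ({0..} \<times> fin_ball n q))"
    using assms(1) by (intro bdd_belowI2[of _ 0]) auto
  from cINF_lower[OF this, of "(t, c)"] show ?thesis using assms by (simp add: comb_gauge_def)
qed

lemma zero_in_fin_ball: "(\<lambda>_. 0) \<in> fin_ball n q"
  by (simp add: fin_ball_def)

lemma comb_gauge_ge:
  assumes "\<And>t c. 0 \<le> t \<Longrightarrow> c \<in> fin_ball n q \<Longrightarrow> b \<le> t + M * norm (z - t *\<^sub>R (\<Sum>l\<le>n. c l *\<^sub>R y l))"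
  shows "b \<le> comb_gauge M n q y z"
  unfolding comb_gauge_def using assms zero_in_fin_ball[of n q] by (intro cINF_greatest) auto

lemma sublinear_comb_gauge:
  assumes M: "0 \<le> M" and q: "1 \<le> q"
  shows "sublinear (comb_gauge M n q y)"
proof -
  let ?g = "comb_gauge M n q y"
  let ?Y = "\<lambda>c. \<Sum>l\<le>n. c l *\<^sub>R y l"
  have add: "?g (z + w) \<le> ?g z + ?g w" for z w
  proof -
    have "?g (z + w) - ?g w \<le> ?g z"
    proof (rule comb_gauge_ge)
      fix t c assume t: "0 \<le> (t::real)" and c: "c \<in> fin_ball n q"
      have "?g (z + w) - (t + M * norm (z - t *\<^sub>R ?Y c)) \<le> ?g w"
      proof (rule comb_gauge_ge)
        fix s d assume s: "0 \<le> (s::real)" and d: "d \<in> fin_ball n q"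
        have "\<exists>e\<in>fin_ball n q. (t + s) *\<^sub>R ?Y e = t *\<^sub>R ?Y c + s *\<^sub>R ?Y d"
        proof (cases "t + s = 0")
          case True
          then have "t = 0" "s = 0" using t s by auto
          then show ?thesis using c by (intro bexI[of _ c]) auto
        next
          case False
          define r where "r = t / (t + s)"
          have ts: "0 < t + s" using False t s by simp
          have r: "0 \<le> r" "r \<le> 1" "(t + s) * r = t" "(t + s) * (1 - r) = s"
            using t s ts by (auto simp: r_def field_simps)
          have "(t + s) *\<^sub>R ?Y (\<lambda>l. r * c l + (1 - r) * d l)
              = ((t + s) * r) *\<^sub>R ?Y c + ((t + s) * (1 - r)) *\<^sub>R ?Y d"
            by (simp add: scaleR_sum_right sum.distrib[symmetric] algebra_simps)
          then show ?thesis using r fin_ball_convex[OF q c d] by (intro bexI[of _ "\<lambda>l. r * c l + (1 - r) * d l"]) auto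
        qed
        then obtain e where e: "e \<in> fin_ball n q" "(t + s) *\<^sub>R ?Y e = t *\<^sub>R ?Y c + s *\<^sub>R ?Y d" by blast
        have "?g (z + w) \<le> (t + s) + M * norm (z + w - (t + s) *\<^sub>R ?Y e)"
          using M t s e by (intro comb_gauge_le) auto
        also have "norm (z + w - (t + s) *\<^sub>R ?Y e) \<le> norm (z - t *\<^sub>R ?Y c) + norm (w - s *\<^sub>R ?Y d)"
          unfolding e(2) using norm_triangle_ineq[of "z - t *\<^sub>R ?Y c" "w - s *\<^sub>R ?Y d"] by (simp add: algebra_simps)
        finally have "?g (z + w) \<le> (t + s) + M * (norm (z - t *\<^sub>R ?Y c) + norm (w - s *\<^sub>R ?Y d))"
          using M by (simp add: mult_left_mono)
        then show "?g (z + w) - (t + M * norm (z - t *\<^sub>R ?Y c)) \<le> s + M * norm (w - s *\<^sub>R ?Y d)"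
          by (simp add: algebra_simps)
      qed
      then show "?g (z + w) - ?g w \<le> t + M * norm (z - t *\<^sub>R ?Y c)" by linarith
    qed
    then show ?thesis by simp
  qed
  have le: "?g (b *\<^sub>R z) \<le> b * ?g z" if b: "0 < b" for b z
  proof -
    have "?g (b *\<^sub>R z) / b \<le> ?g z"
    proof (rule comb_gauge_ge)
      fix t c assume t: "0 \<le> (t::real)" and c: "c \<in> fin_ball n q"
      have "?g (b *\<^sub>R z) \<le> b * t + M * norm (b *\<^sub>R z - (b * t) *\<^sub>R ?Y c)"
        using M t c b by (intro comb_gauge_le) auto
      also have "b *\<^sub>R z - (b * t) *\<^sub>R ?Y c = b *\<^sub>R (z - t *\<^sub>R ?Y c)" by (simp add: algebra_simps)
      also have "b * t + M * norm (b *\<^sub>R (z - t *\<^sub>R ?Y c)) = b * (t + M * norm (z - t *\<^sub>R ?Y c))"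
        unfolding norm_scaleR using b by (simp add: distrib_left mult.left_commute)
      finally show "?g (b *\<^sub>R z) / b \<le> t + M * norm (z - t *\<^sub>R ?Y c)" using b by (simp add: field_simps)
    qed
    then show ?thesis using b by (simp add: field_simps)
  qed
  have hom: "?g (b *\<^sub>R z) = b * ?g z" if "0 \<le> b" for b z
  proof (cases "b = 0")
    case True
    have "?g 0 \<le> 0" using comb_gauge_le[OF M order_refl zero_in_fin_ball, of n q y 0] by simp
    moreover have "0 \<le> ?g 0" using M by (intro comb_gauge_ge) simp
    ultimately show ?thesis using True by simp
  next
    case False
    then have b: "0 < b" using that by simp
    have "?g ((1/b) *\<^sub>R (b *\<^sub>R z)) \<le> (1/b) * ?g (b *\<^sub>R z)" using b by (intro le) simp
    then have "b * ?g z \<le> ?g (b *\<^sub>R z)" using b by (simp add: field_simps)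
    with le[OF b, of z] show ?thesis by simp
  qed
  show ?thesis using add hom by (simp add: sublinear_def)
qed

text \<open>
  The unit ball of \<open>\<ell>\<^sub>q\<close> is tested on the normalised extremal sequence for Hoelder's inequality.
\<close>

lemma dual_pairing_le_one:
  fixes r :: "nat \<Rightarrow> real"
  assumes p: "1 < p" and le: "\<And>c. c \<in> fin_ball n (conj_exponent p) \<Longrightarrow> (\<Sum>l\<le>n. c l * r l) \<le> 1"
  shows "(\<Sum>l\<le>n. \<bar>r l\<bar> powr p) \<le> 1"
proof (rule ccontr)
  assume big: "\<not> ?thesis"
  define q where "q = conj_exponent p"
  define S where "S = (\<Sum>l\<le>n. \<bar>r l\<bar> powr p)"
  have S: "1 < S" using big by (simp add: S_def)
  have q: "1 < q" "1 / p + 1 / q = 1" "(p - 1) * q = p" using conj_exponent_gt1[OF p] by (auto simp: q_def)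
  \<comment> \<open>The case of equality in Hoelder's inequality.\<close>
  define c where "c l = sgn (r l) * \<bar>r l\<bar> powr (p - 1) / S powr (1/q)" for l
  have "\<bar>c l\<bar> powr q = \<bar>r l\<bar> powr p / S" for l
  proof -
    have "\<bar>c l\<bar> = \<bar>r l\<bar> powr (p - 1) / S powr (1/q)" by (cases "r l = 0") (auto simp: c_def abs_mult)
    then show ?thesis using q S by (simp add: powr_divide powr_powr)
  qed
  then have "(\<Sum>l\<le>n. \<bar>c l\<bar> powr q) = (\<Sum>l\<le>n. \<bar>r l\<bar> powr p) / S" by (simp only: sum_divide_distrib)
  then have "(\<Sum>l\<le>n. \<bar>c l\<bar> powr q) = S / S" by (simp only: S_def)
  then have "c \<in> fin_ball n q" using S by (simp add: fin_ball_def)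
  then have "(\<Sum>l\<le>n. c l * r l) \<le> 1" using le by (simp add: q_def)
  moreover have "c l * r l = \<bar>r l\<bar> powr p / S powr (1/q)" for l
  proof (cases "r l = 0")
    case False
    have "sgn (r l) * r l = \<bar>r l\<bar>" by (simp add: abs_sgn mult.commute)
    moreover have "\<bar>r l\<bar> powr (p - 1) * \<bar>r l\<bar> = \<bar>r l\<bar> powr p" using False by (simp add: powr_mult_base[symmetric] powr_diff)
    ultimately have "sgn (r l) * \<bar>r l\<bar> powr (p - 1) * r l = \<bar>r l\<bar> powr p"
      by (metis mult.assoc mult.commute)
    then show ?thesis by (simp add: c_def)
  qed (simp add: c_def)
  ultimately have "S / S powr (1/q) \<le> 1" by (simp add: S_def sum_divide_distrib)
  moreover have "S / S powr (1/q) = S powr (1/p)"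
  proof -
    have "1 / p = 1 - 1 / q" using q(2) by linarith
    then show ?thesis using S powr_diff[of S 1 "1/q"] by simp
  qed
  moreover have "1 < S powr (1/p)" using S p by (intro gr_one_powr) auto
  ultimately show False by simp
qed

lemma fin_ball_coeff_bound:
  assumes "0 < q" "c \<in> fin_ball n q" "l \<le> n"
  shows "\<bar>c l\<bar> \<le> 1"
proof (rule ccontr)
  assume "\<not> \<bar>c l\<bar> \<le> 1"
  then have "1 < \<bar>c l\<bar> powr q" using assms by (intro gr_one_powr) auto
  moreover have "\<bar>c l\<bar> powr q \<le> (\<Sum>l\<le>n. \<bar>c l\<bar> powr q)"
    using assms(3) by (intro member_le_sum) auto
  ultimately show False using assms(2) by (simp add: fin_ball_def)
qed

text \<open>
  Hahn-Banach turns domination into membership. A functional \<open>f\<close> below \<open>comb_gauge M\<close> that agrees with it at \<open>x\<close>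
  is at most \<open>1\<close> on all combinations, so \<open>(f (y l))\<^sub>l\<close> is in the unit ball of \<open>\<ell>\<^sub>p\<close>; domination gives \<open>f x \<le> 1\<close>,
  so \<open>comb_gauge M\<close> is at most \<open>1\<close> at \<open>x\<close>. Letting \<open>M\<close> tend to infinity, compactness of the coefficient
  ball produces an exact representation.
\<close>

lemma dominated_imp_combination:
  fixes x :: "'a::banach_lattice"
  assumes T: "finite T" "T \<subseteq> unit_atoms" and p: "1 < p"
    and x: "proj T x = x" and y: "\<And>l. l \<le> n \<Longrightarrow> proj T (y l) = y l"
    and dom: "\<And>f :: 'a \<Rightarrow>\<^sub>L real. \<bar>f x\<bar> powr p \<le> (\<Sum>l\<le>n. \<bar>f (y l)\<bar> powr p)"
  shows "\<exists>c\<in>fin_ball n (conj_exponent p). x = (\<Sum>l\<le>n. c l *\<^sub>R y l)"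
proof -
  define q where "q = conj_exponent p"
  have q: "1 < q" using conj_exponent_gt1[OF p] by (auto simp: q_def)
  let ?Y = "\<lambda>c. \<Sum>l\<le>n. c l *\<^sub>R y l"
  have gauge: "comb_gauge M n q y x \<le> 1" if M: "0 \<le> M" for M
  proof -
    have sub: "sublinear (comb_gauge M n q y)" using M q by (intro sublinear_comb_gauge) auto
    obtain f :: "'a \<Rightarrow>\<^sub>L real" where f: "\<And>z. f z \<le> comb_gauge M n q y (proj T z)" "f x = comb_gauge M n q y x"
      using sublinear_block_functional[OF sub T x] by blast
    have "(\<Sum>l\<le>n. \<bar>f (y l)\<bar> powr p) \<le> 1"
    proof (rule dual_pairing_le_one[OF p])
      fix c assume c: "c \<in> fin_ball n (conj_exponent p)"
      have "proj T (?Y c) = ?Y c"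
        using y by (simp add: linear_sum[OF linear_proj[OF T(2)]] linear_scale[OF linear_proj[OF T(2)]])
      then have "f (?Y c) \<le> comb_gauge M n q y (?Y c)" using f(1)[of "?Y c"] by simp
      also have "\<dots> \<le> 1" using comb_gauge_le[OF M, of 1 c n q y "?Y c"] c by (simp add: q_def)
      finally show "(\<Sum>l\<le>n. c l * f (y l)) \<le> 1" by (simp add: blinfun.sum_right blinfun.scaleR_right)
    qed
    then have "\<bar>f x\<bar> powr p \<le> 1" using dom[of f] by linarith
    then have "\<bar>f x\<bar> \<le> 1" using gr_one_powr[of "\<bar>f x\<bar>" p] p by linarith
    then show ?thesis using f(2) by simp
  qed
  have "\<exists>t c. 0 \<le> t \<and> c \<in> fin_ball n q \<and> t + real (Suc k) * norm (x - t *\<^sub>R ?Y c) \<le> 1 + 1 / real (Suc k)" for k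
  proof (rule ccontr)
    assume "\<not> ?thesis"
    then have "1 + 1 / real (Suc k) \<le> comb_gauge (real (Suc k)) n q y x"
      by (intro comb_gauge_ge) (meson not_le less_imp_le)
    then have "1 + 1 / real (Suc k) \<le> 1" using gauge[of "real (Suc k)"] by linarith
    moreover have "0 < 1 / real (Suc k)" by simp
    ultimately show False by linarith
  qed
  then obtain t c where tc: "\<And>k. 0 \<le> t k" "\<And>k. c k \<in> fin_ball n q"
    "\<And>k. t k + real (Suc k) * norm (x - t k *\<^sub>R ?Y (c k)) \<le> 1 + 1 / real (Suc k)" by metis
  have t_le: "t k \<le> 1 + 1 / real (Suc k)" for k
    using tc(3)[of k] by (smt (verit) mult_nonneg_nonneg norm_ge_zero of_nat_0_le_iff)
  have r_le: "norm (x - t k *\<^sub>R ?Y (c k)) \<le> 2 / real (Suc k)" for k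
  proof -
    have "1 / real (Suc k) \<le> 1" by simp
    then have "real (Suc k) * norm (x - t k *\<^sub>R ?Y (c k)) \<le> 2" using tc(1)[of k] tc(3)[of k] by linarith
    then show ?thesis by (simp add: field_simps del: of_nat_Suc)
  qed
  \<comment> \<open>Position \<open>0\<close> holds the scalar and the later positions hold the coefficients, so that one subsequence serves both.\<close>
  define U where "U k i = (case i of 0 \<Rightarrow> t k | Suc l \<Rightarrow> if l \<le> n then c k l else 0)" for k i
  have "\<bar>U k i\<bar> \<le> 2" for k i
  proof -
    have "1 / real (Suc k) \<le> 1" by simp
    then have "t k \<le> 2" using t_le[of k] by linarith
    moreover have "\<bar>c k l\<bar> \<le> 2" if "l \<le> n" for l
      using fin_ball_coeff_bound[OF _ tc(2)[of k] that] q by simp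
    ultimately show ?thesis using tc(1)[of k] by (auto simp: U_def split: nat.split)
  qed
  from bounded_pointwise_subseq[of U "\<lambda>_. 2", OF this] obtain r L
    where r: "strict_mono r" "\<And>i. (\<lambda>k. U (r k) i) \<longlonglongrightarrow> L i" by blast
  have tl: "(\<lambda>k. t (r k)) \<longlonglongrightarrow> L 0" using r(2)[of 0] by (simp add: U_def)
  have cl: "(\<lambda>k. c (r k) l) \<longlonglongrightarrow> L (Suc l)" if "l \<le> n" for l using r(2)[of "Suc l"] that by (simp add: U_def)
  define d where "d l = L (Suc l)" for l
  have inv0: "(\<lambda>k. 1 / real (Suc (r k))) \<longlonglongrightarrow> 0"
    using LIMSEQ_subseq_LIMSEQ[OF LIMSEQ_inverse_real_of_nat r(1)] by (simp add: o_def inverse_eq_divide)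
  have "L 0 \<le> 1 + 0" using t_le by (intro LIMSEQ_le[OF tl tendsto_add[OF tendsto_const inv0]]) auto
  moreover have "0 \<le> L 0" using tc(1) by (intro LIMSEQ_le_const[OF tl]) auto
  moreover have dB: "d \<in> fin_ball n q"
  proof -
    have "(\<lambda>k. \<Sum>l\<le>n. \<bar>c (r k) l\<bar> powr q) \<longlonglongrightarrow> (\<Sum>l\<le>n. \<bar>d l\<bar> powr q)"
      using q unfolding d_def by (intro tendsto_sum tendsto_powr' tendsto_rabs cl tendsto_const) auto
    then have "(\<Sum>l\<le>n. \<bar>d l\<bar> powr q) \<le> 1"
      using tc(2) by (intro LIMSEQ_le_const2) (auto simp: fin_ball_def)
    then show ?thesis by (simp add: fin_ball_def)
  qed
  moreover have "x = L 0 *\<^sub>R ?Y d"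
  proof -
    have "(\<lambda>k. norm (x - t (r k) *\<^sub>R ?Y (c (r k)))) \<longlonglongrightarrow> norm (x - L 0 *\<^sub>R ?Y d)"
      unfolding d_def by (intro tendsto_norm tendsto_diff tendsto_const tendsto_scaleR tl tendsto_sum cl) auto
    moreover have "(\<lambda>k. 2 * (1 / real (Suc (r k)))) \<longlonglongrightarrow> 2 * 0" by (intro tendsto_mult_left inv0)
    ultimately have "norm (x - L 0 *\<^sub>R ?Y d) \<le> 2 * 0"
      using r_le by (intro LIMSEQ_le) auto
    then show ?thesis by simp
  qed
  moreover have "L 0 *\<^sub>R ?Y d = (\<Sum>l\<le>n. (L 0 * d l) *\<^sub>R y l)" by (simp add: scaleR_sum_right)
  ultimately have "x = (\<Sum>l\<le>n. (L 0 * d l) *\<^sub>R y l)" by simp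
  moreover have "(\<lambda>l. L 0 * d l + (1 - L 0) * 0) \<in> fin_ball n q"
    using q \<open>0 \<le> L 0\<close> \<open>L 0 \<le> 1 + 0\<close> by (intro fin_ball_convex zero_in_fin_ball dB) auto
  ultimately show ?thesis by (intro bexI[of _ "\<lambda>l. L 0 * d l"]) (auto simp: q_def)
qed

section \<open>Assembling p-compactness from blocks\<close>

text \<open>
  A set with bounded coordinates in the span of finitely many atoms is generated by large multiples of these
  atoms: dividing the coordinates by their number and their bounds makes the sum of the coefficients at most \<open>1\<close>.
\<close>

lemma finite_block_combination:
  fixes A T :: "'a::banach_lattice set"
  assumes T: "finite T" "T \<subseteq> unit_atoms" and q: "1 \<le> q"
    and bd: "\<And>a. a \<in> T \<Longrightarrow> \<exists>R. \<forall>x\<in>A. \<bar>coord a x\<bar> \<le> R"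
  shows "\<exists>n y. \<forall>x\<in>A. \<exists>c\<in>fin_ball n q. proj T x = (\<Sum>l\<le>n. c l *\<^sub>R y l)"
proof -
  have "\<forall>a\<in>T. \<exists>R. \<forall>x\<in>A. \<bar>coord a x\<bar> \<le> R" using bd by blast
  from bchoice[OF this] obtain R where R: "\<And>a x. a \<in> T \<Longrightarrow> x \<in> A \<Longrightarrow> \<bar>coord a x\<bar> \<le> R a" by blast
  \<comment> \<open>The bounds are made positive because the coefficients are divided by them.\<close>
  define R' where "R' a = max (R a) 1" for a
  \<comment> \<open>There is one generator more than there are atoms; its coefficient is \<open>0\<close>.\<close>
  define n where "n = card T"
  obtain g where g: "bij_betw g {..<n} T"
    using ex_bij_betw_nat_finite[OF T(1)] by (auto simp: n_def atLeast0LessThan)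
  define y where "y l = (real (Suc n) * R' (g l)) *\<^sub>R g l" for l
  have "\<exists>c\<in>fin_ball n q. proj T x = (\<Sum>l\<le>n. c l *\<^sub>R y l)" if x: "x \<in> A" for x
  proof
    define c where "c l = (if l < n then coord (g l) x / (real (Suc n) * R' (g l)) else 0)" for l
    have R'0: "0 < R' a" for a by (simp add: R'_def less_max_iff_disj)
    have "\<bar>c l\<bar> \<le> 1 / real (Suc n)" for l
    proof (cases "l < n")
      case True
      then have gT: "g l \<in> T" using g by (auto simp: bij_betw_def)
      have "\<bar>coord (g l) x\<bar> \<le> R' (g l)" using R[OF gT x] by (simp add: R'_def)
      then have "\<bar>coord (g l) x\<bar> / R' (g l) \<le> 1" using R'0[of "g l"] by simp
      then have "\<bar>coord (g l) x\<bar> / R' (g l) / real (Suc n) \<le> 1 / real (Suc n)" by (intro divide_right_mono) auto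
      then show ?thesis using True R'0[of "g l"] by (simp add: c_def abs_mult mult.commute del: of_nat_Suc)
    qed (simp add: c_def)
    moreover have "\<bar>c l\<bar> powr q \<le> \<bar>c l\<bar>" if "\<bar>c l\<bar> \<le> 1" for l
      using powr_mono'[of 1 q "\<bar>c l\<bar>"] q that by (cases "c l = 0") auto
    moreover have "1 / real (Suc n) \<le> 1" by simp
    ultimately have "\<bar>c l\<bar> powr q \<le> 1 / real (Suc n)" for l by (meson order_trans)
    then have "(\<Sum>l\<le>n. \<bar>c l\<bar> powr q) \<le> (\<Sum>l\<le>n. 1 / real (Suc n))" by (intro sum_mono)
    also have "\<dots> = 1" by simp
    finally show "c \<in> fin_ball n q" by (simp add: fin_ball_def)
    have "(\<Sum>l\<le>n. c l *\<^sub>R y l) = (\<Sum>l<n. c l *\<^sub>R y l)"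
      by (rule sum.mono_neutral_right) (auto simp: c_def)
    also have "\<dots> = (\<Sum>l<n. coord (g l) x *\<^sub>R g l)"
      using R'0 by (intro sum.cong) (auto simp: c_def y_def less_imp_neq[symmetric] simp del: of_nat_Suc)
    also have "\<dots> = proj T x" unfolding proj_def by (rule sum.reindex_bij_betw[OF g])
    finally show "proj T x = (\<Sum>l\<le>n. c l *\<^sub>R y l)" ..
  qed
  then show ?thesis by blast
qed

text \<open>
  The coefficients of block \<open>k\<close> are scaled by \<open>2 ^ - (k + 1)\<close>, so that all of them together lie in the unit ball
  of \<open>\<ell>\<^sub>q\<close>, and the generators by \<open>2 ^ (k + 1)\<close>. The hypothesis \<open>small\<close> is what keeps the latter \<open>p\<close>-summable.
  All blocks are then enumerated as one sequence, which converges absolutely by Young's inequality.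
\<close>

lemma blocks_imp_relatively_p_compact:
  fixes A :: "'a::banach set" and P :: "nat \<Rightarrow> 'a \<Rightarrow> 'a"
  assumes p: "1 < p"
    and lim: "\<And>x. x \<in> A \<Longrightarrow> (\<lambda>k. P k x) sums x"
    and rep: "\<And>k x. x \<in> A \<Longrightarrow> \<exists>c\<in>fin_ball (n k) (conj_exponent p). P k x = (\<Sum>l\<le>n k. c l *\<^sub>R y k l)"
    and small: "\<And>k. (\<Sum>l\<le>n (Suc k). norm (y (Suc k) l) powr p) \<le> (1/2)^Suc k / (2^(k + 2)) powr p"
  shows "relatively_p_compact p A"
proof -
  define q where "q = conj_exponent p"
  have q: "1 < q" using conj_exponent_gt1[OF p] by (simp add: q_def)
  define X where "X = (\<lambda>(k, l). if l \<le> n k then 2^Suc k *\<^sub>R y k l else 0)"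
  define \<sigma> where "\<sigma> k = (\<Sum>l<Suc (n k). norm (X (k, l)) powr p)" for k
  have \<sigma>: "\<sigma> k = (2^Suc k) powr p * (\<Sum>l\<le>n k. norm (y k l) powr p)" for k
    by (simp add: \<sigma>_def X_def lessThan_Suc_atMost powr_mult sum_distrib_left)
  have \<sigma>S: "\<sigma> (Suc k) \<le> (1/2)^Suc k" for k
  proof -
    have "\<sigma> (Suc k) \<le> (2^(k + 2)) powr p * ((1/2)^Suc k / (2^(k + 2)) powr p)"
      unfolding \<sigma> using small[of k] by (intro mult_mono) (auto intro!: sum_nonneg)
    then show ?thesis by simp
  qed
  have \<sigma>0: "0 \<le> \<sigma> k" for k unfolding \<sigma>_def by (intro sum_nonneg) auto
  have \<sigma>sum: "(\<Sum>k<K. \<sigma> k) \<le> \<sigma> 0 + 1" for K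
  proof -
    have "(\<Sum>k<Suc K. \<sigma> k) \<le> \<sigma> 0 + 1 - (1/2)^K" for K
    proof (induction K)
      case (Suc K)
      then show ?case using \<sigma>S[of K] by simp
    qed simp
    from this[of K] have "(\<Sum>k<Suc K. \<sigma> k) \<le> \<sigma> 0 + 1" by (smt (verit) zero_le_power zero_le_divide_1_iff zero_le_numeral)
    then show ?thesis using \<sigma>0[of K] by simp
  qed
  have X: "summable (\<lambda>j. norm (X (prod_decode j)) powr p)" "(\<Sum>j. norm (X (prod_decode j)) powr p) \<le> \<sigma> 0 + 1"
    using prod_decode_summable[of "\<lambda>x. norm (X x) powr p" "\<lambda>k. Suc (n k)" "\<sigma> 0 + 1"] \<sigma>sum
    unfolding \<sigma>_def by (simp_all add: X_def)
  have main: "\<exists>c\<in>lq_unit_ball q. (\<lambda>j. c j *\<^sub>R X (prod_decode j)) sums x \<and> norm x \<le> \<sigma> 0 + 2" if x: "x \<in> A" for x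
  proof -
    have "\<forall>k. \<exists>c. c \<in> fin_ball (n k) q \<and> P k x = (\<Sum>l\<le>n k. c l *\<^sub>R y k l)"
      using rep[OF x] unfolding q_def by blast
    from choice[OF this] obtain c where c: "\<And>k. c k \<in> fin_ball (n k) q" "\<And>k. P k x = (\<Sum>l\<le>n k. c k l *\<^sub>R y k l)"
      by blast
    define C where "C = (\<lambda>(k, l). if l \<le> n k then (1/2)^Suc k * c k l else 0)"
    have "(\<Sum>l<Suc (n k). \<bar>C (k, l)\<bar> powr q) \<le> (1/2)^Suc k" for k
    proof -
      have "(\<Sum>l<Suc (n k). \<bar>C (k, l)\<bar> powr q) = ((1/2)^Suc k) powr q * (\<Sum>l\<le>n k. \<bar>c k l\<bar> powr q)"
        by (simp add: C_def lessThan_Suc_atMost abs_mult powr_mult sum_distrib_left del: power_Suc)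
      also have "\<dots> \<le> (1/2)^Suc k * 1"
      proof (rule mult_mono)
        have "((1/2)^Suc k) powr q \<le> ((1/2::real)^Suc k) powr 1"
          using q power_le_one[of "1/2::real" "Suc k"] by (intro powr_mono') (simp_all del: power_Suc)
        then show "((1/2)^Suc k) powr q \<le> (1/2::real)^Suc k" by simp
        show "(\<Sum>l\<le>n k. \<bar>c k l\<bar> powr q) \<le> 1" using c(1)[of k] by (simp add: fin_ball_def)
      qed (auto intro!: sum_nonneg)
      finally show ?thesis by simp
    qed
    then have "(\<Sum>k<K. \<Sum>l<Suc (n k). \<bar>C (k, l)\<bar> powr q) \<le> (\<Sum>k<K. (1/2)^Suc k)" for K by (intro sum_mono)
    moreover have "(\<Sum>k<K. (1/2::real)^Suc k) = 1 - (1/2)^K" for K by (induction K) auto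
    ultimately have bd: "(\<Sum>k<K. \<Sum>l<Suc (n k). \<bar>C (k, l)\<bar> powr q) \<le> 1" for K
      by (smt (verit) zero_le_power zero_le_divide_1_iff zero_le_numeral)
    have z: "\<bar>C (k, l)\<bar> powr q = 0" if "Suc (n k) \<le> l" for k l using that by (simp add: C_def)
    have C: "summable (\<lambda>j. \<bar>C (prod_decode j)\<bar> powr q)" "(\<Sum>j. \<bar>C (prod_decode j)\<bar> powr q) \<le> 1"
      using prod_decode_summable[of "\<lambda>x. \<bar>C x\<bar> powr q" "\<lambda>k. Suc (n k)" 1, OF _ z bd] by simp_all
    define V where "V x = C x *\<^sub>R X x" for x
    have V_le: "norm (V x) \<le> \<bar>C x\<bar> powr q + norm (X x) powr p" for x
      using young_norm_le[OF p, of "\<bar>C x\<bar>" "norm (X x)"] by (simp add: V_def q_def)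
    have sCX: "summable (\<lambda>j. \<bar>C (prod_decode j)\<bar> powr q + norm (X (prod_decode j)) powr p)"
      by (intro summable_add C X)
    have sV: "summable (\<lambda>j. norm (V (prod_decode j)))"
      by (rule summable_comparison_test_ev[OF _ sCX]) (use V_le in auto)
    define v where "v = (\<Sum>j. V (prod_decode j))"
    have Vs: "(\<lambda>j. V (prod_decode j)) sums v"
      using summable_norm_cancel[OF sV] by (simp add: v_def summable_sums)
    then have "((\<lambda>j. V (prod_decode j)) has_sum v) UNIV" using norm_summable_imp_has_sum[OF sV] by blast
    then have hs: "(V has_sum v) (UNIV \<times> UNIV)"
      using has_sum_reindex_bij_betw[OF bij_prod_decode, of V v] by simp
    have inner: "((\<lambda>l. V (k, l)) has_sum P k x) UNIV" for k
    proof (rule has_sum_finite_neutralI[of "{..n k}"])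
      show "P k x = (\<Sum>l\<in>{..n k}. V (k, l))"
        unfolding c(2) by (intro sum.cong) (auto simp: V_def C_def X_def power_divide)
    qed (auto simp: V_def C_def)
    have "((\<lambda>k. P k x) has_sum v) UNIV" using has_sum_SigmaD[OF hs inner] by simp
    then have "v = x" using has_sum_imp_sums sums_unique2[OF _ lim[OF x]] by blast
    moreover have "norm v \<le> \<sigma> 0 + 2"
    proof -
      have "norm v \<le> (\<Sum>j. norm (V (prod_decode j)))" unfolding v_def by (rule summable_norm[OF sV])
      also have "\<dots> \<le> (\<Sum>j. \<bar>C (prod_decode j)\<bar> powr q + norm (X (prod_decode j)) powr p)"
        by (intro suminf_le V_le sV sCX)
      also have "\<dots> = (\<Sum>j. \<bar>C (prod_decode j)\<bar> powr q) + (\<Sum>j. norm (X (prod_decode j)) powr p)"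
        by (intro suminf_add[symmetric] C X)
      finally show ?thesis using C X by linarith
    qed
    moreover have "(\<lambda>j. C (prod_decode j)) \<in> lq_unit_ball q" using C by (simp add: lq_unit_ball_def lp_seq_def)
    ultimately show ?thesis using Vs unfolding V_def by (intro bexI[of _ "\<lambda>j. C (prod_decode j)"]) simp_all
  qed
  show ?thesis
    unfolding relatively_p_compact_def q_def[symmetric]
  proof (intro conjI exI[of _ "\<lambda>j. X (prod_decode j)"])
    show "bounded A" unfolding bounded_iff using main by blast
    show "A \<subseteq> {z. \<exists>c\<in>lq_unit_ball q. (\<lambda>j. c j *\<^sub>R X (prod_decode j)) sums z}" using main by blast
  qed (rule X(1))
qed

text \<open>
  The tails of \<open>A\<close> beyond \<open>S k\<close> have \<open>p\<close>-summing constant at most \<open>\<delta> k\<close>, which decreases fast enough for the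
  blocks between consecutive sets \<open>S k\<close> to be reassembled with coefficients in a single \<open>\<ell>\<^sub>q\<close> ball.
\<close>

lemma KB_discrete_imp_GP:
  assumes KB: "KB_property TYPE('a::banach_lattice)" and D: "discrete_banach_lattice TYPE('a)" and p: "1 < p"
  shows "GP_property p TYPE('a)"
  unfolding GP_property_def
proof (intro allI impI)
  fix A :: "'a set" assume A: "p_limited p A"
  define q where "q = conj_exponent p"
  have q: "1 < q" using conj_exponent_gt1[OF p] by (simp add: q_def)
  \<comment> \<open>Domination costs the factor \<open>2 powr p\<close>, and block \<open>k + 1\<close> is scaled up by \<open>2 ^ (k + 2)\<close>.\<close>
  define \<delta> where "\<delta> k = (1/2)^Suc k / (2^(k + 2)) powr p / 2 powr p" for k :: nat
  have \<delta>0: "0 < \<delta> k" for k by (simp add: \<delta>_def)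
  have \<delta>le: "\<delta> k \<le> (1/2)^Suc k" for k
  proof -
    have "1 \<le> (2^(k + 2)::real) powr p" "1 \<le> (2::real) powr p"
      using p by (auto intro!: ge_one_powr_ge_zero one_le_power simp del: power_Suc power_add add_2_eq_Suc')
    then have "1 \<le> (2^(k + 2)::real) powr p * 2 powr p" using mult_mono[of 1 _ 1] by fastforce
    then show ?thesis unfolding \<delta>_def divide_divide_eq_left by (intro divide_le_eq[THEN iffD2]) (auto simp: mult_le_cancel_left1)
  qed
  have "\<forall>k. \<exists>S. finite S \<and> S \<subseteq> unit_atoms \<and>
    (\<forall>T. finite T \<longrightarrow> T \<subseteq> unit_atoms - S \<longrightarrow> (\<forall>ps. snd ` set ps \<subseteq> A \<longrightarrow>
       (\<forall>y. norm y \<le> 1 \<longrightarrow> list_powr_sum p (map fst ps) (proj T y) \<le> 1) \<longrightarrow> pair_list_sum p T ps \<le> \<delta> k))"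
    using p_limited_tail[OF KB _ A \<delta>0] p by simp
  from choice[OF this] obtain S' where S': "\<forall>k. finite (S' k) \<and> S' k \<subseteq> unit_atoms \<and>
    (\<forall>T. finite T \<longrightarrow> T \<subseteq> unit_atoms - S' k \<longrightarrow> (\<forall>ps. snd ` set ps \<subseteq> A \<longrightarrow>
       (\<forall>y. norm y \<le> 1 \<longrightarrow> list_powr_sum p (map fst ps) (proj T y) \<le> 1) \<longrightarrow> pair_list_sum p T ps \<le> \<delta> k))" ..
  define S where "S k = (\<Union>i\<le>k. S' i)" for k
  have S: "finite (S k)" "S k \<subseteq> unit_atoms" "S' k \<subseteq> S k" for k using S' by (auto simp: S_def)
  have Smono: "S k \<subseteq> S (Suc k)" for k unfolding S_def by (intro UN_mono) auto
  have tail: "pair_list_sum p T ps \<le> \<delta> k"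
    if "finite T" "T \<subseteq> unit_atoms - S k" "snd ` set ps \<subseteq> A"
      "\<And>y. norm y \<le> 1 \<Longrightarrow> list_powr_sum p (map fst ps) (proj T y) \<le> 1" for T k ps
  proof -
    have "T \<subseteq> unit_atoms - S' k" using that(2) S(3)[of k] by blast
    then show ?thesis using S' that by simp
  qed
  \<comment> \<open>A single norming functional shows that the \<open>p\<close>-summing constant of a tail controls its norm.\<close>
  have tail_norm: "norm (proj T x) \<le> \<delta> k powr (1/p)"
    if T: "finite T" "T \<subseteq> unit_atoms - S k" and x: "x \<in> A" for T k x
  proof -
    have TU: "T \<subseteq> unit_atoms" using T by blast
    obtain f :: "'a \<Rightarrow>\<^sub>L real" where f: "carried_by f T" "\<And>y. \<bar>f y\<bar> \<le> norm y" "f x = norm (proj T x)"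
      using norming_block_functional[OF T(1) TU] by blast
    have fT: "f (proj T y) = f y" for y using f(1) by (simp add: carried_by_def)
    have "pair_list_sum p T [(f, x)] \<le> \<delta> k"
    proof (rule tail[OF T])
      fix y :: 'a assume "norm y \<le> 1"
      then have "\<bar>f y\<bar> \<le> 1" using f(2)[of y] by linarith
      then show "list_powr_sum p (map fst [(f, x)]) (proj T y) \<le> 1" using p by (simp add: fT powr_le1)
    qed (use x in simp)
    then have "norm (proj T x) powr p \<le> \<delta> k" by (simp add: pair_list_sum_def fT f(3))
    then have "(norm (proj T x) powr p) powr (1/p) \<le> \<delta> k powr (1/p)" using p by (intro powr_mono2) auto
    then show ?thesis using p by (simp add: powr_powr)
  qed
  define T where "T k = (case k of 0 \<Rightarrow> S 0 | Suc j \<Rightarrow> S (Suc j) - S j)" for k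
  have T: "finite (T k)" "T k \<subseteq> unit_atoms" for k using S by (auto simp: T_def split: nat.split)
  have partial: "(\<Sum>k<Suc K. proj (T k) x) = proj (S K) x" for K x
  proof (induction K)
    case (Suc K)
    have "proj (S (Suc K)) x = proj (S K) x + proj (T (Suc K)) x"
      unfolding proj_def T_def nat.case using sum.subset_diff[OF Smono S(1)] by (simp add: add.commute)
    then show ?case using Suc by simp
  qed (simp add: T_def)
  have coordbd: "\<exists>R. \<forall>x\<in>A. \<bar>coord a x\<bar> \<le> R" if "a \<in> unit_atoms" for a
    using almost_p_limited_coord_bounded[OF _ p_limited_imp_almost[OF A] that] p by simp
  have "\<forall>k. \<exists>ny. (\<forall>x\<in>A. \<exists>c\<in>fin_ball (fst ny) q. proj (T k) x = (\<Sum>l\<le>fst ny. c l *\<^sub>R snd ny l)) \<and>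
    (\<forall>j. k = Suc j \<longrightarrow> (\<Sum>l\<le>fst ny. norm (snd ny l) powr p) \<le> 2 powr p * \<delta> j)"
  proof
    fix k
    show "\<exists>ny. (\<forall>x\<in>A. \<exists>c\<in>fin_ball (fst ny) q. proj (T k) x = (\<Sum>l\<le>fst ny. c l *\<^sub>R snd ny l)) \<and>
      (\<forall>j. k = Suc j \<longrightarrow> (\<Sum>l\<le>fst ny. norm (snd ny l) powr p) \<le> 2 powr p * \<delta> j)"
    proof (cases k)
      case 0
      have "1 \<le> q" using q by simp
      moreover have "\<exists>R. \<forall>x\<in>A. \<bar>coord a x\<bar> \<le> R" if "a \<in> T k" for a
        using coordbd[of a] that T(2)[of k] by (meson subsetD)
      ultimately obtain n y where "\<forall>x\<in>A. \<exists>c\<in>fin_ball n q. proj (T k) x = (\<Sum>l\<le>n. c l *\<^sub>R y l)"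
        using finite_block_combination[OF T[of k], of q A] by blast
      then show ?thesis using 0 by (intro exI[of _ "(n, y)"]) simp
    next
      case (Suc j)
      have Tj: "T k \<subseteq> unit_atoms - S j" using S(2) by (auto simp: T_def Suc)
      have "\<exists>n y. (\<forall>l\<le>n::nat. proj (T k) (y l) = y l) \<and> (\<Sum>l\<le>n. norm (y l) powr p) \<le> 2 powr p * \<delta> j \<and>
        (\<forall>f :: 'a \<Rightarrow>\<^sub>L real. \<forall>x\<in>A. \<bar>f (proj (T k) x)\<bar> powr p \<le> (\<Sum>l\<le>n. \<bar>f (y l)\<bar> powr p))"
      proof (rule pietsch_domination_block[OF T _ \<delta>0])
        show "1 \<le> p" using p by simp
        fix ps :: "(('a \<Rightarrow>\<^sub>L real) \<times> 'a) list"
        assume "snd ` set ps \<subseteq> A" "\<And>y. norm y \<le> 1 \<Longrightarrow> list_powr_sum p (map fst ps) (proj (T k) y) \<le> 1"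
        then show "pair_list_sum p (T k) ps \<le> \<delta> j" by (rule tail[OF T(1) Tj])
      qed
      then obtain n :: nat and y where "(\<forall>l\<le>n. proj (T k) (y l) = y l) \<and> (\<Sum>l\<le>n. norm (y l) powr p) \<le> 2 powr p * \<delta> j \<and>
        (\<forall>f :: 'a \<Rightarrow>\<^sub>L real. \<forall>x\<in>A. \<bar>f (proj (T k) x)\<bar> powr p \<le> (\<Sum>l\<le>n. \<bar>f (y l)\<bar> powr p))"
        by (elim exE)
      then have y: "\<And>l. l \<le> n \<Longrightarrow> proj (T k) (y l) = y l"
        "(\<Sum>l\<le>n. norm (y l) powr p) \<le> 2 powr p * \<delta> j"
        "\<And>(f :: 'a \<Rightarrow>\<^sub>L real) x. x \<in> A \<Longrightarrow> \<bar>f (proj (T k) x)\<bar> powr p \<le> (\<Sum>l\<le>n. \<bar>f (y l)\<bar> powr p)"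
        by simp_all
      have "\<exists>c\<in>fin_ball n q. proj (T k) x = (\<Sum>l\<le>n. c l *\<^sub>R y l)" if x: "x \<in> A" for x
        unfolding q_def
        using dominated_imp_combination[OF T p _ y(1) y(3)[OF x]] proj_proj_subset[OF T order_refl] by blast
      then show ?thesis using y(2) Suc by (intro exI[of _ "(n, y)"]) simp
    qed
  qed
  from choice[OF this] obtain ny where ny: "\<forall>k. (\<forall>x\<in>A. \<exists>c\<in>fin_ball (fst (ny k)) q. proj (T k) x = (\<Sum>l\<le>fst (ny k). c l *\<^sub>R snd (ny k) l)) \<and>
    (\<forall>j. k = Suc j \<longrightarrow> (\<Sum>l\<le>fst (ny k). norm (snd (ny k) l) powr p) \<le> 2 powr p * \<delta> j)" ..
  show "relatively_p_compact p A"
  proof (rule blocks_imp_relatively_p_compact[OF p, of A "\<lambda>k. proj (T k)" "\<lambda>k. fst (ny k)" "\<lambda>k. snd (ny k)"])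
    fix x k assume "x \<in> A"
    then show "\<exists>c\<in>fin_ball (fst (ny k)) (conj_exponent p). proj (T k) x = (\<Sum>l\<le>fst (ny k). c l *\<^sub>R snd (ny k) l)"
      using ny by (simp add: q_def)
  next
    fix k
    have "2 powr p * \<delta> k = (1/2)^Suc k / (2^(k + 2)) powr p" by (simp add: \<delta>_def)
    then show "(\<Sum>l\<le>fst (ny (Suc k)). norm (snd (ny (Suc k)) l) powr p) \<le> (1/2)^Suc k / (2^(k + 2)) powr p"
      using spec[OF ny, of "Suc k"] by simp
  next
    fix x assume x: "x \<in> A"
    have le: "norm (x - proj (S K) x) \<le> ((1/2)^Suc K) powr (1/p)" for K
    proof -
      have "norm (x - proj (S K) x) \<le> \<delta> K powr (1/p)"
        by (rule KB_remainder_le[OF KB D S(1,2) tail_norm[OF _ _ x]])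
      also have "\<dots> \<le> ((1/2)^Suc K) powr (1/p)" using \<delta>le[of K] \<delta>0[of K] p by (intro powr_mono2) auto
      finally show ?thesis .
    qed
    have "(\<lambda>K. ((1/2::real)^Suc K) powr (1/p)) \<longlonglongrightarrow> 0 powr (1/p)"
      using p by (intro tendsto_powr' tendsto_const LIMSEQ_Suc LIMSEQ_power_zero) auto
    moreover have "(0::real) powr (1/p) = 0" by simp
    ultimately have "(\<lambda>K. ((1/2::real)^Suc K) powr (1/p)) \<longlonglongrightarrow> 0" by (simp only:)
    with always_eventually[OF allI[OF le]] have "(\<lambda>K. x - proj (S K) x) \<longlonglongrightarrow> 0"
      by (rule Lim_null_comparison)
    then have "(\<lambda>K. x - (x - proj (S K) x)) \<longlonglongrightarrow> x - 0" by (intro tendsto_diff tendsto_const)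
    then have "(\<lambda>K. \<Sum>k<Suc K. proj (T k) x) \<longlonglongrightarrow> x" unfolding partial by simp
    then show "(\<lambda>k. proj (T k) x) sums x" unfolding sums_def by (rule LIMSEQ_imp_Suc)
  qed
qed

section \<open>The equivalence\<close>

theorem corollary3p8:
  fixes p :: real
  assumes "2 \<le> p"
    and "discrete_banach_lattice TYPE('a::banach_lattice)"
  shows "(strong_GP_property p TYPE('a) \<longleftrightarrow> weak_GP_property p TYPE('a)) \<and>
         (weak_GP_property p TYPE('a) \<longleftrightarrow> GP_property p TYPE('a))"
proof -
  have p: "1 \<le> p" "1 < p" using assms(1) by auto
  have ab: "weak_GP_property p TYPE('a)" if "strong_GP_property p TYPE('a)"
    using that p_limited_imp_almost unfolding strong_GP_property_def weak_GP_property_def by blast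
  have cb: "weak_GP_property p TYPE('a)" if "GP_property p TYPE('a)"
    using that relatively_p_compact_imp_compact[OF p(2)] unfolding GP_property_def weak_GP_property_def by blast
  have ba: "strong_GP_property p TYPE('a) \<and> GP_property p TYPE('a)" if "weak_GP_property p TYPE('a)"
    using KB_discrete_imp_strong_GP[OF _ assms(2) p(1)] KB_discrete_imp_GP[OF _ assms(2) p(2)]
      weak_GP_imp_KB[OF p(1) that] by blast
  show ?thesis using ab cb ba by blast
qed

end
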